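(* Let $n\ge2$. If $\mathcal{S}$ is an invariant subspace of finite codimension in $H^2(\mathbb{D}^n)$, then $\mathcal{T}(\mathcal{S})$ and $\mathcal{T}(H^2(\mathbb{D}^n))$ are unitarily equivalent; that is, there exists a unitary $U:\mathcal{S}\to H^2(\mathbb{D}^n)$ such that $U\mathcal{T}(\mathcal{S})U^*=\mathcal{T}(H^2(\mathbb{D}^n))$.
   Context: $H^2(\mathbb{D}^n)$ is the Hardy space over the unit polydisc $\mathbb{D}^n$ and $M_{z_i}$ is multiplication by the coordinate function $z_i$ on it. A closed subspace $\mathcal{S}\subseteq H^2(\mathbb{D}^n)$ is an invariant subspace if $M_{z_i}\mathcal{S}\subseteq\mathcal{S}$ for all $i=1,\ldots,n$. For such $\mathcal{S}$, $R_{z_i}=M_{z_i}|_{\mathcal{S}}\in\mathcal{B}(\mathcal{S})$ and $\mathcal{T}(\mathcal{S})\subseteq\mathcal{B}(\mathcal{S})$ is the $C^*$-algebra generated by $\{R_{z_1},\ldots,R_{z_n}\}$. *)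

theory Defs
  imports "HOL-Analysis.Analysis" "HOL-Computational_Algebra.Primes"
begin

section \<open>Complex Hilbert spaces\<close>

class scaleC =
  fixes scaleC :: "complex \<Rightarrow> 'a \<Rightarrow> 'a"  (infixr "*\<^sub>C" 75)

text \<open>
  The complex inner product is linear in the first argument.  Its real part is the inner product
  of the underlying real space, so norm, metric and topology are the ones of the class
  \<open>real_inner\<close>.
\<close>

class complex_inner = real_inner + scaleC +
  fixes cinner :: "'a \<Rightarrow> 'a \<Rightarrow> complex"
  assumes scaleC_add_right: "c *\<^sub>C (x + y) = c *\<^sub>C x + c *\<^sub>C y"
    and scaleC_add_left: "(c + d) *\<^sub>C x = c *\<^sub>C x + d *\<^sub>C x"
    and scaleC_scaleC: "c *\<^sub>C d *\<^sub>C x = (c * d) *\<^sub>C x"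
    and scaleR_scaleC: "r *\<^sub>R x = complex_of_real r *\<^sub>C x"
    and cinner_commute: "cinner x y = cnj (cinner y x)"
    and cinner_add_left: "cinner (x + y) z = cinner x z + cinner y z"
    and cinner_scaleC_left: "cinner (c *\<^sub>C x) y = c * cinner x y"
    and inner_eq_Re_cinner: "inner x y = Re (cinner x y)"

class complex_hilbert = complex_inner + complete_space

global_interpretation complex_vector:
  vector_space "scaleC :: complex \<Rightarrow> 'a \<Rightarrow> 'a::complex_inner"
proof
  fix x :: 'a
  show "1 *\<^sub>C x = x"
    using scaleR_scaleC[of 1 x] by simp
qed (simp_all add: scaleC_add_right scaleC_add_left scaleC_scaleC)


section \<open>Operators between closed subspaces and C*-algebras of operators\<close>

definition closed_csubspace :: "'a::complex_inner set \<Rightarrow> bool" where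
  "closed_csubspace S \<longleftrightarrow> complex_vector.subspace S \<and> closed S"

text \<open>
  The codimension of \<open>S\<close> is the dimension of the quotient by \<open>S\<close>; it is finite iff the
  classes of finitely many vectors span the quotient.
\<close>

definition finite_codim :: "'a::complex_inner set \<Rightarrow> bool" where
  "finite_codim S \<longleftrightarrow> (\<exists>B. finite B \<and> complex_vector.span (S \<union> B) = UNIV)"

text \<open>
  An operator from \<open>S\<close> to \<open>K\<close> is a function on the ambient type which is zero outside \<open>S\<close>.
  This makes its representation unique, and sums, scalar multiples and composites of functions
  are again representations of the corresponding operators.
\<close>

definition bounded_ops :: "'a::complex_inner set \<Rightarrow> 'b::complex_inner set \<Rightarrow> ('a \<Rightarrow> 'b) set" where
  "bounded_ops S K = {T.
     (\<forall>x\<in>S. T x \<in> K) \<and>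
     (\<forall>x. x \<notin> S \<longrightarrow> T x = 0) \<and>
     (\<forall>x\<in>S. \<forall>y\<in>S. T (x + y) = T x + T y) \<and>
     (\<forall>c. \<forall>x\<in>S. T (c *\<^sub>C x) = c *\<^sub>C T x) \<and>
     (\<exists>M. \<forall>x\<in>S. norm (T x) \<le> M * norm x)}"

definition restrict_op :: "'a set \<Rightarrow> ('a \<Rightarrow> 'b::zero) \<Rightarrow> 'a \<Rightarrow> 'b" where
  "restrict_op S T = (\<lambda>x. if x \<in> S then T x else 0)"

definition op_norm :: "'a::complex_inner set \<Rightarrow> ('a \<Rightarrow> 'b::complex_inner) \<Rightarrow> real" where
  "op_norm S T = (SUP x\<in>{x \<in> S. norm x \<le> 1}. norm (T x))"

text \<open>
  For closed subspaces of Hilbert spaces the adjoint of a bounded operator exists by the Riesz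
  representation theorem, and it is unique because operators vanish outside their domain.
\<close>

definition adjoint_op ::
  "'a::complex_inner set \<Rightarrow> 'b::complex_inner set \<Rightarrow> ('a \<Rightarrow> 'b) \<Rightarrow> 'b \<Rightarrow> 'a" where
  "adjoint_op S K T = (THE T'. T' \<in> bounded_ops K S \<and>
     (\<forall>x\<in>S. \<forall>y\<in>K. cinner (T x) y = cinner x (T' y)))"

definition unitary_op ::
  "'a::complex_inner set \<Rightarrow> 'b::complex_inner set \<Rightarrow> ('a \<Rightarrow> 'b) \<Rightarrow> bool" where
  "unitary_op S K U \<longleftrightarrow> U \<in> bounded_ops S K \<and> U ` S = K \<and>
     (\<forall>x\<in>S. \<forall>y\<in>S. cinner (U x) (U y) = cinner x y)"

definition cstar_subalgebra :: "'a::complex_inner set \<Rightarrow> ('a \<Rightarrow> 'a) set \<Rightarrow> bool" where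
  "cstar_subalgebra S A \<longleftrightarrow>
     A \<subseteq> bounded_ops S S \<and>
     (\<lambda>x. 0) \<in> A \<and>
     (\<forall>T\<in>A. \<forall>T'\<in>A. (\<lambda>x. T x + T' x) \<in> A) \<and>
     (\<forall>c. \<forall>T\<in>A. (\<lambda>x. c *\<^sub>C T x) \<in> A) \<and>
     (\<forall>T\<in>A. \<forall>T'\<in>A. T \<circ> T' \<in> A) \<and>
     (\<forall>T\<in>A. adjoint_op S S T \<in> A) \<and>
     (\<forall>X. \<forall>T\<in>bounded_ops S S. (\<forall>m::nat. X m \<in> A) \<longrightarrow>
        (\<lambda>m. op_norm S (\<lambda>x. X m x - T x)) \<longlonglongrightarrow> 0 \<longrightarrow> T \<in> A)"

text \<open>
  No unit is required of a C*-subalgebra.  The algebras generated below are unital, since their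
  generators are isometries.
\<close>

definition cstar_generated :: "'a::complex_inner set \<Rightarrow> ('a \<Rightarrow> 'a) set \<Rightarrow> ('a \<Rightarrow> 'a) set" where
  "cstar_generated S G = \<Inter>{A. cstar_subalgebra S A \<and> G \<subseteq> A}"


section \<open>The Hardy space over the polydisc\<close>

text \<open>
  The dimension is the cardinality of the index type, and multi-indices are functions from the
  index type to the naturals.
\<close>

definition polydisc :: "(complex ^ 'n) set" where
  "polydisc = {z. \<forall>i. cmod (z $ i) < 1}"

definition mpow :: "complex ^ 'n \<Rightarrow> ('n::finite \<Rightarrow> nat) \<Rightarrow> complex" where
  "mpow z k = (\<Prod>i\<in>UNIV. (z $ i) ^ k i)"

definition square_summable :: "('k \<Rightarrow> complex) \<Rightarrow> bool" where
  "square_summable a \<longleftrightarrow> (\<lambda>k. (cmod (a k))\<^sup>2) summable_on UNIV"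

text \<open>
  The Hardy space consists of the functions on the polydisc that are sums of power series with
  square summable coefficients.  The functions are extended by zero to all of the ambient space.
\<close>

definition hardy_expansion ::
  "(('n::finite \<Rightarrow> nat) \<Rightarrow> complex) \<Rightarrow> (complex ^ 'n \<Rightarrow> complex) \<Rightarrow> bool" where
  "hardy_expansion a f \<longleftrightarrow> square_summable a \<and>
     (\<forall>z\<in>polydisc. ((\<lambda>k. a k * mpow z k) has_sum f z) UNIV) \<and>
     (\<forall>z. z \<notin> polydisc \<longrightarrow> f z = 0)"

lemma hardy_expansion_0: "hardy_expansion (\<lambda>k. 0) (\<lambda>z. 0)"
  by (simp add: hardy_expansion_def square_summable_def)

typedef (overloaded) 'n hardy =
  "{f :: complex ^ ('n::finite) \<Rightarrow> complex. \<exists>a. hardy_expansion a f}"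
  morphisms hardy_fun Abs_hardy
  using hardy_expansion_0 by blast

text \<open>By \<open>hardy_expansion_unique\<close> below, the coefficients are determined by the function.\<close>

definition hardy_coeff :: "('n::finite) hardy \<Rightarrow> ('n \<Rightarrow> nat) \<Rightarrow> complex" where
  "hardy_coeff f = (THE a. hardy_expansion a (hardy_fun f))"

lemma cmod_mult_le_squares: "cmod (x * y) \<le> (cmod x)\<^sup>2 + (cmod y)\<^sup>2"
proof -
  have "0 \<le> (cmod x - cmod y)\<^sup>2" by simp
  then have "2 * (cmod x * cmod y) \<le> (cmod x)\<^sup>2 + (cmod y)\<^sup>2"
    by (simp add: power2_diff algebra_simps)
  moreover have "0 \<le> cmod x * cmod y" by simp
  ultimately have "cmod x * cmod y \<le> (cmod x)\<^sup>2 + (cmod y)\<^sup>2" by linarith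
  then show ?thesis by (simp add: norm_mult)
qed

lemma square_summable_mult:
  assumes "square_summable a" "square_summable b"
  shows "(\<lambda>k. cmod (a k * b k)) summable_on UNIV"
proof (rule summable_on_comparison_test)
  show "(\<lambda>k. (cmod (a k))\<^sup>2 + (cmod (b k))\<^sup>2) summable_on UNIV"
    using assms unfolding square_summable_def by (rule summable_on_add)
qed (use cmod_mult_le_squares in auto)

lemma square_summable_cnj: "square_summable (\<lambda>k. cnj (a k)) \<longleftrightarrow> square_summable a"
  by (simp add: square_summable_def)

lemma square_summable_mult_cnj:
  assumes "square_summable a" "square_summable b"
  shows "(\<lambda>k. a k * cnj (b k)) summable_on UNIV"
  using square_summable_mult[of a "\<lambda>k. cnj (b k)"] assms
  by (intro abs_summable_summable[where f = "\<lambda>k. a k * cnj (b k)"]) (simp add: square_summable_cnj)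

lemma square_summable_add:
  assumes "square_summable a" "square_summable b"
  shows "square_summable (\<lambda>k. a k + b k)"
  unfolding square_summable_def
proof (rule summable_on_comparison_test)
  show "(\<lambda>k. 2 * ((cmod (a k))\<^sup>2 + (cmod (b k))\<^sup>2)) summable_on UNIV"
    using assms unfolding square_summable_def
    by (intro summable_on_cmult_right summable_on_add)
  fix k
  have "(cmod (a k + b k))\<^sup>2 \<le> (cmod (a k) + cmod (b k))\<^sup>2"
    by (intro power_mono norm_triangle_ineq) auto
  also have "\<dots> \<le> 2 * ((cmod (a k))\<^sup>2 + (cmod (b k))\<^sup>2)"
    using zero_le_power2[of "cmod (a k) - cmod (b k)"]
    by (simp add: power2_diff power2_sum)
  finally show "(cmod (a k + b k))\<^sup>2 \<le> 2 * ((cmod (a k))\<^sup>2 + (cmod (b k))\<^sup>2)" .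
qed auto

lemma square_summable_cmult:
  assumes "square_summable a"
  shows "square_summable (\<lambda>k. c * a k)"
  using assms unfolding square_summable_def
  by (simp add: norm_mult power_mult_distrib summable_on_cmult_right)

lemma square_summable_diff:
  assumes "square_summable a" "square_summable b"
  shows "square_summable (\<lambda>k. a k - b k)"
  using square_summable_add[OF assms(1) square_summable_cmult[OF assms(2), of "-1"]] by simp

lemma abs_summable_mpow:
  fixes z :: "complex ^ 'n::finite"
  assumes "z \<in> polydisc"
  shows "(\<lambda>k. cmod (mpow z k)) summable_on UNIV"
proof -
  have "Infinite_Set_Sum.abs_summable_on (\<lambda>k. \<Prod>i\<in>UNIV. (z $ i) ^ k i) (PiE UNIV (\<lambda>_. UNIV))"
  proof (rule abs_summable_on_prod_PiE)
    fix i :: 'n assume "i \<in> UNIV"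
    have "cmod (z $ i) < 1" using assms by (auto simp: polydisc_def)
    then show "Infinite_Set_Sum.abs_summable_on (\<lambda>j. (z $ i) ^ j) UNIV"
      by (simp add: abs_summable_on_nat_iff' norm_power summable_geometric)
  qed auto
  then have "Infinite_Sum.abs_summable_on (mpow z) UNIV"
    by (simp add: abs_summable_equivalent mpow_def[abs_def])
  then show ?thesis .
qed

lemma square_summable_mpow:
  fixes z :: "complex ^ 'n::finite"
  assumes "z \<in> polydisc"
  shows "square_summable (mpow z)"
  unfolding square_summable_def
proof (rule summable_on_comparison_test)
  show "(\<lambda>k. cmod (mpow z k)) summable_on UNIV"
    by (rule abs_summable_mpow[OF assms])
  fix k
  have "cmod (mpow z k) \<le> 1"
    unfolding mpow_def prod_norm[symmetric] norm_power
    using assms by (intro prod_le_1 conjI power_le_one) (auto simp: polydisc_def less_imp_le)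
  then show "(cmod (mpow z k))\<^sup>2 \<le> cmod (mpow z k)"
    by (simp add: power2_eq_square mult_left_le)
qed auto

lemma hardy_expansion_exists:
  fixes a :: "('n::finite \<Rightarrow> nat) \<Rightarrow> complex"
  assumes "square_summable a"
  shows "hardy_expansion a (\<lambda>z. if z \<in> polydisc then \<Sum>\<^sub>\<infinity>k. a k * mpow z k else 0)"
proof -
  have "(\<lambda>k. a k * mpow z k) summable_on UNIV" if "z \<in> polydisc" for z
    by (rule abs_summable_summable, rule square_summable_mult[OF assms square_summable_mpow[OF that]])
  then show ?thesis
    using assms by (simp add: hardy_expansion_def has_sum_infsum)
qed

lemma hardy_expansion_add:
  assumes "hardy_expansion a f" "hardy_expansion b g"
  shows "hardy_expansion (\<lambda>k. a k + b k) (\<lambda>z. f z + g z)"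
  using assms by (auto simp: hardy_expansion_def distrib_right
      intro!: has_sum_add square_summable_add)

lemma hardy_expansion_cmult:
  assumes "hardy_expansion a f"
  shows "hardy_expansion (\<lambda>k. c * a k) (\<lambda>z. c * f z)"
  using assms by (auto simp: hardy_expansion_def mult.assoc
      intro!: has_sum_cmult_right square_summable_cmult)

lemma hardy_expansion_zero_imp:
  fixes a :: "('n::finite \<Rightarrow> nat) \<Rightarrow> complex"
  assumes "hardy_expansion a (\<lambda>z. 0)"
  shows "a = (\<lambda>k. 0)"
proof (rule ccontr)
  assume "a \<noteq> (\<lambda>k. 0)"
  then obtain k1 where k1: "a k1 \<noteq> 0" by auto
  obtain B where B: "finite B" "card B = CARD('n)" "B \<subseteq> {q::nat. prime q}"
    using infinite_arbitrarily_large[OF primes_infinite] by metis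
  then obtain p :: "'n \<Rightarrow> nat" where "bij_betw p UNIV B"
    using finite_same_card_bij[of "UNIV :: 'n set" B] by auto
  with B have p: "inj p" "\<And>i. prime (p i)"
    by (auto simp: bij_betw_def)
  define N where "N k = (\<Prod>i\<in>UNIV. p i ^ k i)" for k :: "'n \<Rightarrow> nat"
  have N_inj: "k = l" if "N k = N l" for k l
  proof
    fix i
    have "multiplicity (p i) (N m) = m i" for m
    proof -
      have "multiplicity (p i) (N m) = (\<Sum>j\<in>UNIV. multiplicity (p i) (p j ^ m j))"
        unfolding N_def using p
        by (intro prime_elem_multiplicity_prod_distrib)
          (auto simp: image_iff dest: prime_gt_0_nat[of "p _"])
      also have "\<dots> = (\<Sum>j\<in>UNIV. if j = i then m i else 0)"
      proof (rule sum.cong[OF refl])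
        fix j
        show "multiplicity (p i) (p j ^ m j) = (if j = i then m i else 0)"
        proof (cases "j = i")
          case True
          then show ?thesis using p(2)[of i]
            by (simp add: prime_gt_1_nat multiplicity_same_power prime_gt_0_nat)
        next
          case False
          then have "p i \<noteq> p j" using p(1) by (auto dest: injD)
          then show ?thesis using p(2) False
            by (simp add: multiplicity_distinct_prime_power)
        qed
      qed
      finally show ?thesis by simp
    qed
    then show "k i = l i" using that by metis
  qed
  have N_pos: "N k > 0" for k
    using p(2) by (auto simp: N_def prime_gt_0_nat intro!: prod_pos)
  define k0 where "k0 = arg_min N (\<lambda>k. a k \<noteq> 0)"
  have k0: "a k0 \<noteq> 0" and k0_min: "\<And>k. a k \<noteq> 0 \<Longrightarrow> N k0 \<le> N k"
    using arg_min_natI[of "\<lambda>k. a k \<noteq> 0", OF k1] arg_min_nat_le[of "\<lambda>k. a k \<noteq> 0" _ N]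
    unfolding k0_def by auto
  define z :: "nat \<Rightarrow> complex ^ 'n" where "z s = (\<chi> i. 1 / of_nat (p i) ^ Suc s)" for s
  have mp: "mpow (z s) k = 1 / of_nat (N k) ^ Suc s" for s k
  proof -
    have "mpow (z s) k = (\<Prod>i\<in>UNIV. 1 / (of_nat (p i) ^ k i) ^ Suc s)"
      unfolding mpow_def z_def
      by (intro prod.cong refl)
        (simp add: power_divide power_mult[symmetric] mult.commute del: power_Suc)
    also have "\<dots> = 1 / of_nat (N k) ^ Suc s"
      by (simp add: N_def prod_dividef prod_power_distrib del: power_Suc)
    finally show ?thesis .
  qed
  have zD: "z s \<in> polydisc" for s
  proof -
    have "cmod (1 / of_nat (p i) ^ Suc s) < 1" for i
    proof -
      have "real (p i) ^ Suc s > 1"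
        using prime_gt_1_nat[OF p(2)[of i]] by (intro one_less_power) auto
      then show ?thesis by (simp add: norm_divide norm_power divide_less_eq del: power_Suc)
    qed
    then show ?thesis by (simp add: polydisc_def z_def del: power_Suc)
  qed
  define q where "q = real (N k0) / real (N k0 + 1)"
  have q: "0 \<le> q" "q < 1" by (auto simp: q_def)
  define g where "g k = cmod (a k * mpow (z 0) k)" for k
  have gs: "g summable_on UNIV"
    unfolding g_def using assms zD
    by (intro square_summable_mult square_summable_mpow) (auto simp: hardy_expansion_def)
  define C where "C = real (N k0) * infsum g UNIV"
  have bound: "cmod (a k0) \<le> C * q ^ s" for s
  proof -
    have hs: "((\<lambda>k. a k * mpow (z s) k) has_sum 0) UNIV"
      using assms zD[of s] by (auto simp: hardy_expansion_def)
    have "((\<lambda>k. a k * mpow (z s) k) has_sum (0 - a k0 * mpow (z s) k0)) (UNIV - {k0})"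
      by (rule has_sum_Diff[OF hs]) (auto intro: has_sum_finiteI)
    then have h: "((\<lambda>k. of_nat (N k0) ^ Suc s * (a k * mpow (z s) k)) has_sum
        (of_nat (N k0) ^ Suc s * (0 - a k0 * mpow (z s) k0))) (UNIV - {k0})"
      by (rule has_sum_cmult_right)
    have e: "of_nat (N k0) ^ Suc s * (0 - a k0 * mpow (z s) k0) = - a k0"
      using N_pos[of k0] by (simp add: mp del: power_Suc)
    have le: "cmod (of_nat (N k0) ^ Suc s * (a k * mpow (z s) k)) \<le> real (N k0) * q ^ s * g k"
      if "k \<in> UNIV - {k0}" for k
    proof (cases "a k = 0")
      case True
      then show ?thesis by (simp add: g_def)
    next
      case False
      then have "N k0 < N k"
        using k0_min[of k] N_inj[of k k0] that by (cases "N k = N k0") auto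
      then have "real (N k0) / real (N k) \<le> q"
        unfolding q_def by (intro divide_left_mono) auto
      then have "(real (N k0) / real (N k)) ^ s \<le> q ^ s"
        by (intro power_mono) auto
      then have "real (N k0) * (real (N k0) / real (N k)) ^ s * g k \<le> real (N k0) * q ^ s * g k"
        by (intro mult_right_mono mult_left_mono) (auto simp: g_def)
      moreover have "cmod (of_nat (N k0) ^ Suc s * (a k * mpow (z s) k))
          = real (N k0) * (real (N k0) / real (N k)) ^ s * g k"
        by (simp add: mp g_def norm_mult norm_divide norm_power power_divide)
      ultimately show ?thesis by simp
    qed
    have "cmod (- a k0) \<le> (\<Sum>\<^sub>\<infinity>k\<in>UNIV - {k0}. real (N k0) * q ^ s * g k)"
    proof (rule norm_infsum_le)
      show "((\<lambda>k. of_nat (N k0) ^ Suc s * (a k * mpow (z s) k)) has_sum - a k0) (UNIV - {k0})"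
        using h by (simp only: e)
      show "((\<lambda>k. real (N k0) * q ^ s * g k) has_sum
          (\<Sum>\<^sub>\<infinity>k\<in>UNIV - {k0}. real (N k0) * q ^ s * g k)) (UNIV - {k0})"
        by (intro has_sum_infsum summable_on_cmult_right
            summable_on_subset_banach[OF gs]) auto
    qed (rule le)
    also have "\<dots> = real (N k0) * q ^ s * infsum g (UNIV - {k0})"
      by (intro infsum_cmult_right summable_on_subset_banach[OF gs]) auto
    also have "\<dots> \<le> real (N k0) * q ^ s * infsum g UNIV"
      using q by (intro mult_left_mono infsum_mono_neutral
          summable_on_subset_banach[OF gs]) (auto simp: g_def intro: gs[unfolded g_def])
    finally show ?thesis by (simp add: C_def algebra_simps)
  qed
  have "(\<lambda>s. C * q ^ s) \<longlonglongrightarrow> C * 0"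
    using q by (intro tendsto_mult tendsto_const LIMSEQ_power_zero) auto
  then have "cmod (a k0) \<le> C * 0"
    by (rule LIMSEQ_le_const) (use bound in auto)
  with k0 show False by simp
qed

lemma hardy_expansion_unique:
  assumes "hardy_expansion a f" "hardy_expansion b f"
  shows "a = b"
proof -
  have "hardy_expansion (\<lambda>k. a k + (-1) * b k) (\<lambda>z. f z + (-1) * f z)"
    by (intro hardy_expansion_add hardy_expansion_cmult assms)
  then have "(\<lambda>k. a k + (-1) * b k) = (\<lambda>k. 0)"
    by (intro hardy_expansion_zero_imp) simp
  then show ?thesis by (auto simp: fun_eq_iff)
qed

lemma hardy_expansion_hardy_coeff: "hardy_expansion (hardy_coeff f) (hardy_fun f)"
proof -
  obtain a where a: "hardy_expansion a (hardy_fun f)" using hardy_fun[of f] by auto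
  show ?thesis
    unfolding hardy_coeff_def by (rule theI[where P = "\<lambda>a. hardy_expansion a (hardy_fun f)", OF a])
      (rule hardy_expansion_unique[OF _ a])
qed

lemma square_summable_hardy_coeff: "square_summable (hardy_coeff f)"
  using hardy_expansion_hardy_coeff by (auto simp: hardy_expansion_def)

lemma hardy_fun_Abs: "hardy_expansion a f \<Longrightarrow> hardy_fun (Abs_hardy f) = f"
  by (rule Abs_hardy_inverse) auto

lemma hardy_coeff_Abs:
  assumes "hardy_expansion a f"
  shows "hardy_coeff (Abs_hardy f) = a"
  using hardy_expansion_hardy_coeff[of "Abs_hardy f"] assms
  unfolding hardy_fun_Abs[OF assms] by (rule hardy_expansion_unique)

lemma hardy_coeff_eqI:
  assumes "\<And>k. hardy_coeff f k = hardy_coeff g k"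
  shows "f = g"
proof -
  have eq: "hardy_coeff f = hardy_coeff g" using assms by auto
  have f: "hardy_expansion (hardy_coeff g) (hardy_fun f)"
    using hardy_expansion_hardy_coeff[of f] by (simp only: eq)
  have g: "hardy_expansion (hardy_coeff g) (hardy_fun g)"
    by (rule hardy_expansion_hardy_coeff)
  have "hardy_fun f z = hardy_fun g z" for z
  proof (cases "z \<in> polydisc")
    case True
    then have "((\<lambda>k. hardy_coeff g k * mpow z k) has_sum hardy_fun f z) UNIV"
      "((\<lambda>k. hardy_coeff g k * mpow z k) has_sum hardy_fun g z) UNIV"
      using f g unfolding hardy_expansion_def by blast+
    then show ?thesis by (rule has_sum_unique)
  next
    case False
    then show ?thesis using f g by (simp add: hardy_expansion_def)
  qed
  then have "hardy_fun f = hardy_fun g" by (rule ext)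
  then show ?thesis by (rule hardy_fun_inject[THEN iffD1])
qed

lemma hardy_coeff_surj:
  fixes a :: "('n::finite \<Rightarrow> nat) \<Rightarrow> complex"
  assumes "square_summable a"
  obtains f :: "'n hardy" where "hardy_coeff f = a"
  by (rule that) (rule hardy_coeff_Abs[OF hardy_expansion_exists[OF assms]])

instantiation hardy :: (finite) complex_inner
begin

definition zero_hardy :: "'a hardy" where
  "0 = Abs_hardy (\<lambda>z. 0)"

definition plus_hardy :: "'a hardy \<Rightarrow> 'a hardy \<Rightarrow> 'a hardy" where
  "f + g = Abs_hardy (\<lambda>z. hardy_fun f z + hardy_fun g z)"

definition scaleC_hardy :: "complex \<Rightarrow> 'a hardy \<Rightarrow> 'a hardy" where
  "c *\<^sub>C f = Abs_hardy (\<lambda>z. c * hardy_fun f z)"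

definition uminus_hardy :: "'a hardy \<Rightarrow> 'a hardy" where
  "- (f :: 'a hardy) = (-1) *\<^sub>C f"

definition minus_hardy :: "'a hardy \<Rightarrow> 'a hardy \<Rightarrow> 'a hardy" where
  "(f :: 'a hardy) - g = f + - (g :: 'a hardy)"

definition scaleR_hardy :: "real \<Rightarrow> 'a hardy \<Rightarrow> 'a hardy" where
  "r *\<^sub>R (f :: 'a hardy) = complex_of_real r *\<^sub>C f"

definition cinner_hardy :: "'a hardy \<Rightarrow> 'a hardy \<Rightarrow> complex" where
  "cinner f g = (\<Sum>\<^sub>\<infinity>k. hardy_coeff f k * cnj (hardy_coeff g k))"

definition inner_hardy :: "'a hardy \<Rightarrow> 'a hardy \<Rightarrow> real" where
  "inner (f :: 'a hardy) g = Re (cinner f g)"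

definition norm_hardy :: "'a hardy \<Rightarrow> real" where
  "norm (f :: 'a hardy) = sqrt (inner f f)"

definition sgn_hardy :: "'a hardy \<Rightarrow> 'a hardy" where
  "sgn (f :: 'a hardy) = inverse (norm f) *\<^sub>R f"

definition dist_hardy :: "'a hardy \<Rightarrow> 'a hardy \<Rightarrow> real" where
  "dist (f :: 'a hardy) g = norm (f - g)"

definition uniformity_hardy :: "('a hardy \<times> 'a hardy) filter" where
  "uniformity = (INF e\<in>{0 <..}. principal {(f :: 'a hardy, g). dist f g < e})"

definition open_hardy :: "'a hardy set \<Rightarrow> bool" where
  "open (U :: 'a hardy set) \<longleftrightarrow>
     (\<forall>f\<in>U. eventually (\<lambda>(f', g). f' = f \<longrightarrow> g \<in> U) uniformity)"

lemma hardy_coeff_0: "hardy_coeff (0 :: 'a hardy) k = 0"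
  by (simp add: zero_hardy_def hardy_coeff_Abs[OF hardy_expansion_0])

lemma hardy_coeff_add: "hardy_coeff (f + g :: 'a hardy) k = hardy_coeff f k + hardy_coeff g k"
  by (simp add: plus_hardy_def hardy_coeff_Abs[OF hardy_expansion_add[OF
        hardy_expansion_hardy_coeff hardy_expansion_hardy_coeff]])

lemma hardy_coeff_scaleC: "hardy_coeff (c *\<^sub>C f :: 'a hardy) k = c * hardy_coeff f k"
  by (simp add: scaleC_hardy_def hardy_coeff_Abs[OF hardy_expansion_cmult[OF
        hardy_expansion_hardy_coeff]])

lemma hardy_coeff_minus: "hardy_coeff (- f :: 'a hardy) k = - hardy_coeff f k"
  by (simp add: uminus_hardy_def hardy_coeff_scaleC)

lemma hardy_coeff_diff: "hardy_coeff (f - g :: 'a hardy) k = hardy_coeff f k - hardy_coeff g k"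
  by (simp add: minus_hardy_def hardy_coeff_add hardy_coeff_minus)

lemma hardy_coeff_scaleR: "hardy_coeff (r *\<^sub>R f :: 'a hardy) k = of_real r * hardy_coeff f k"
  by (simp add: scaleR_hardy_def hardy_coeff_scaleC)

lemmas hardy_coeff_simps = hardy_coeff_0 hardy_coeff_add hardy_coeff_scaleC hardy_coeff_minus
  hardy_coeff_diff hardy_coeff_scaleR

lemma inner_hardy_self: "inner f (f :: 'a hardy) = (\<Sum>\<^sub>\<infinity>k. (cmod (hardy_coeff f k))\<^sup>2)"
proof -
  have "cinner f f = (\<Sum>\<^sub>\<infinity>k. complex_of_real ((cmod (hardy_coeff f k))\<^sup>2))"
    unfolding cinner_hardy_def complex_norm_square by simp
  also have "\<dots> = complex_of_real (\<Sum>\<^sub>\<infinity>k. (cmod (hardy_coeff f k))\<^sup>2)"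
    by (intro infsumI has_sum_of_real_iff[THEN iffD2] has_sum_infsum)
      (use square_summable_hardy_coeff[of f] in \<open>simp add: square_summable_def\<close>)
  finally show ?thesis by (simp add: inner_hardy_def)
qed

lemma hardy_cinner_commute: "cinner f (g :: 'a hardy) = cnj (cinner g f)"
proof -
  have "cnj (cinner g f) = (\<Sum>\<^sub>\<infinity>k. cnj (hardy_coeff g k * cnj (hardy_coeff f k)))"
    unfolding cinner_hardy_def by (rule infsum_cnj[symmetric])
  also have "\<dots> = cinner f g"
    unfolding cinner_hardy_def by (rule infsum_cong) (simp add: mult.commute)
  finally show ?thesis by (rule sym)
qed

lemma hardy_cinner_add: "cinner (f + g) (h :: 'a hardy) = cinner f h + cinner g h"
  unfolding cinner_hardy_def hardy_coeff_add distrib_right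
  by (intro infsum_add square_summable_mult_cnj square_summable_hardy_coeff)

lemma hardy_cinner_scaleC: "cinner (c *\<^sub>C f) (h :: 'a hardy) = c * cinner f h"
  unfolding cinner_hardy_def hardy_coeff_scaleC mult.assoc
  by (intro infsum_cmult_right square_summable_mult_cnj square_summable_hardy_coeff)

instance
proof
  fix f g h :: "'a hardy" and c d :: complex and r s :: real and U :: "'a hardy set"
  show "f + g + h = f + (g + h)" "f + g = g + f" "0 + f = f" "- f + f = 0" "f - g = f + - g"
    by (auto intro!: hardy_coeff_eqI simp: hardy_coeff_simps)
  show "r *\<^sub>R (f + g) = r *\<^sub>R f + r *\<^sub>R g" "(r + s) *\<^sub>R f = r *\<^sub>R f + s *\<^sub>R f"
    "r *\<^sub>R s *\<^sub>R f = (r * s) *\<^sub>R f" "1 *\<^sub>R f = f"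
    "c *\<^sub>C (f + g) = c *\<^sub>C f + c *\<^sub>C g" "(c + d) *\<^sub>C f = c *\<^sub>C f + d *\<^sub>C f"
    "c *\<^sub>C d *\<^sub>C f = (c * d) *\<^sub>C f"
    by (auto intro!: hardy_coeff_eqI simp: hardy_coeff_simps algebra_simps)
  show "r *\<^sub>R f = complex_of_real r *\<^sub>C f" by (fact scaleR_hardy_def)
  show "sgn (f :: 'a hardy) = inverse (norm f) *\<^sub>R f" by (fact sgn_hardy_def)
  show "dist f g = norm (f - g)" by (fact dist_hardy_def)
  show "uniformity = (INF e\<in>{0 <..}. principal {(f :: 'a hardy, g). dist f g < e})"
    by (fact uniformity_hardy_def)
  show "open U \<longleftrightarrow> (\<forall>f\<in>U. eventually (\<lambda>(f', g). f' = f \<longrightarrow> g \<in> U) uniformity)"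
    by (fact open_hardy_def)
  show "cinner f g = cnj (cinner g f)" by (fact hardy_cinner_commute)
  then show "inner f g = inner g f" by (simp add: inner_hardy_def)
  show "cinner (f + g) h = cinner f h + cinner g h" by (fact hardy_cinner_add)
  then show "inner (f + g) h = inner f h + inner g h" by (simp add: inner_hardy_def)
  show "cinner (c *\<^sub>C f) g = c * cinner f g" by (fact hardy_cinner_scaleC)
  show "inner (r *\<^sub>R f) g = r * inner f g"
    by (simp add: inner_hardy_def scaleR_hardy_def hardy_cinner_scaleC)
  show "inner f g = Re (cinner f g)" by (fact inner_hardy_def)
  show "norm f = sqrt (inner f f)" by (fact norm_hardy_def)
  show "0 \<le> inner f f" unfolding inner_hardy_self by (simp add: infsum_nonneg)
  show "inner f f = 0 \<longleftrightarrow> f = 0"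
  proof
    assume "inner f f = 0"
    then have "(cmod (hardy_coeff f k))\<^sup>2 = 0" for k
      using square_summable_hardy_coeff[of f]
      by (intro nonneg_infsum_le_0D[where A = UNIV and f = "\<lambda>k. (cmod (hardy_coeff f k))\<^sup>2"])
        (auto simp: inner_hardy_self square_summable_def)
    then show "f = 0" by (intro hardy_coeff_eqI) (simp add: hardy_coeff_simps)
  qed (simp add: inner_hardy_self hardy_coeff_simps)
qed

end

lemma norm_hardy_sqr: "(norm f)\<^sup>2 = (\<Sum>\<^sub>\<infinity>k. (cmod (hardy_coeff f k))\<^sup>2)"
  by (simp add: power2_norm_eq_inner inner_hardy_self)

lemma hardy_finite_sum_le: "finite F \<Longrightarrow> (\<Sum>k\<in>F. (cmod (hardy_coeff f k))\<^sup>2) \<le> (norm f)\<^sup>2"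
  unfolding norm_hardy_sqr
  using square_summable_hardy_coeff[of f]
  by (intro finite_sum_le_infsum) (auto simp: square_summable_def)

instance hardy :: (finite) complex_hilbert
proof
  fix X :: "nat \<Rightarrow> 'a hardy"
  assume X: "Cauchy X"
  let ?c = "\<lambda>m. hardy_coeff (X m)"
  have "Cauchy (\<lambda>m. ?c m k)" for k
  proof (rule metric_CauchyI)
    fix e :: real assume "0 < e"
    then obtain M where M: "\<And>m n. m \<ge> M \<Longrightarrow> n \<ge> M \<Longrightarrow> dist (X m) (X n) < e"
      using X by (meson Cauchy_def)
    have "dist (?c m k) (?c n k) < e" if "m \<ge> M" "n \<ge> M" for m n
    proof -
      have "(cmod (hardy_coeff (X m - X n) k))\<^sup>2 \<le> (norm (X m - X n))\<^sup>2"
        using hardy_finite_sum_le[of "{k}" "X m - X n"] by simp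
      then have "cmod (hardy_coeff (X m - X n) k) \<le> norm (X m - X n)"
        by (rule power2_le_imp_le) simp
      with M[OF that] show ?thesis by (simp add: dist_norm hardy_coeff_diff)
    qed
    then show "\<exists>M. \<forall>m\<ge>M. \<forall>n\<ge>M. dist (?c m k) (?c n k) < e" by blast
  qed
  then have "\<exists>b. \<forall>k. (\<lambda>m. ?c m k) \<longlonglongrightarrow> b k"
    by (intro choice allI) (meson Cauchy_convergent convergent_def)
  then obtain b where b: "\<And>k. (\<lambda>m. ?c m k) \<longlonglongrightarrow> b k" by blast
  have fin: "(\<Sum>k\<in>F. (cmod (?c m k - b k))\<^sup>2) \<le> e\<^sup>2"
    if "finite F" "\<forall>n\<ge>M. dist (X m) (X n) < e" for F m M e
  proof (rule LIMSEQ_le_const2)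
    show "(\<lambda>n. \<Sum>k\<in>F. (cmod (?c m k - ?c n k))\<^sup>2) \<longlonglongrightarrow> (\<Sum>k\<in>F. (cmod (?c m k - b k))\<^sup>2)"
      by (intro tendsto_intros b)
    show "\<exists>M. \<forall>n\<ge>M. (\<Sum>k\<in>F. (cmod (?c m k - ?c n k))\<^sup>2) \<le> e\<^sup>2"
    proof (intro exI allI impI)
      fix n assume "n \<ge> M"
      then have "norm (X m - X n) \<le> e" using that(2) by (simp add: dist_norm less_imp_le)
      then have "(norm (X m - X n))\<^sup>2 \<le> e\<^sup>2" by (intro power_mono) auto
      then show "(\<Sum>k\<in>F. (cmod (?c m k - ?c n k))\<^sup>2) \<le> e\<^sup>2"
        using hardy_finite_sum_le[OF that(1), of "X m - X n"]
        by (simp add: hardy_coeff_diff)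
    qed
  qed
  have ss: "square_summable (\<lambda>k. ?c m k - b k)" if "\<forall>n\<ge>M. dist (X m) (X n) < e" for m M e
    unfolding square_summable_def
  proof (rule nonneg_bdd_above_summable_on)
    show "bdd_above (sum (\<lambda>k. (cmod (?c m k - b k))\<^sup>2) ` {F. F \<subseteq> UNIV \<and> finite F})"
      by (rule bdd_aboveI[where M = "e\<^sup>2"]) (use fin[OF _ that] in auto)
  qed auto
  obtain M1 where "\<forall>m\<ge>M1. \<forall>n\<ge>M1. dist (X m) (X n) < 1"
    using X unfolding Cauchy_def by (meson zero_less_one)
  then have "square_summable (\<lambda>k. ?c M1 k - b k)" by (intro ss[of M1]) auto
  from square_summable_diff[OF square_summable_hardy_coeff[of "X M1"] this]
  have "square_summable b" by simp
  then obtain f :: "'a hardy" where f: "hardy_coeff f = b" by (rule hardy_coeff_surj)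
  have "X \<longlonglongrightarrow> f"
  proof (rule metric_LIMSEQ_I)
    fix e :: real assume e: "0 < e"
    then obtain M where M: "\<And>m n. m \<ge> M \<Longrightarrow> n \<ge> M \<Longrightarrow> dist (X m) (X n) < e / 2"
      using X by (meson Cauchy_def half_gt_zero)
    have "dist (X m) f < e" if m: "m \<ge> M" for m
    proof -
      have d: "\<forall>n\<ge>M. dist (X m) (X n) < e / 2" using M m by auto
      have "(norm (X m - f))\<^sup>2 \<le> (e / 2)\<^sup>2"
        unfolding norm_hardy_sqr hardy_coeff_diff f
        using ss[OF d] fin[OF _ d]
        by (intro infsum_le_finite_sums) (auto simp: square_summable_def)
      then have "norm (X m - f) \<le> e / 2" by (rule power2_le_imp_le) (use e in auto)
      with e show ?thesis by (simp add: dist_norm)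
    qed
    then show "\<exists>M. \<forall>m\<ge>M. dist (X m) f < e" by blast
  qed
  then show "convergent X" by (auto simp: convergent_def)
qed

definition coord_mult :: "'n::finite \<Rightarrow> 'n hardy \<Rightarrow> 'n hardy" where
  "coord_mult i f = Abs_hardy (\<lambda>z. z $ i * hardy_fun f z)"

text \<open>Multiplication by a coordinate function does not leave the Hardy space.\<close>

lemma hardy_fun_coord_mult: "hardy_fun (coord_mult i f) z = z $ i * hardy_fun f z"
proof -
  let ?a = "hardy_coeff f" and ?h = "\<lambda>k. k(i := Suc (k i))"
  define b where "b k = (if k i = 0 then 0 else ?a (k(i := k i - 1)))" for k
  have inj: "inj ?h"
    by (rule injI) (metis fun_upd_same fun_upd_triv fun_upd_upd nat.inject)
  have ran: "k \<in> range ?h" if "k i \<noteq> 0" for k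
    using that by (intro image_eqI[of _ _ "k(i := k i - 1)"]) auto
  have bh: "b (?h k) = ?a k" for k by (simp add: b_def)
  have b0: "b k = 0" if "k \<notin> range ?h" for k using ran[of k] that by (auto simp: b_def)
  have a: "hardy_expansion ?a (hardy_fun f)" by (rule hardy_expansion_hardy_coeff)
  have mp: "mpow z (?h k) = z $ i * mpow z k" for z :: "complex ^ 'a" and k
  proof -
    have "(\<Prod>j\<in>UNIV - {i}. (z $ j) ^ (?h k) j) = (\<Prod>j\<in>UNIV - {i}. (z $ j) ^ k j)"
      by (rule prod.cong) auto
    then show ?thesis
      unfolding mpow_def by (simp add: prod.remove[of UNIV i])
  qed
  have "hardy_expansion b (\<lambda>z. z $ i * hardy_fun f z)"
    unfolding hardy_expansion_def
  proof (intro conjI ballI allI impI)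
    have "(\<lambda>k. (cmod (b k))\<^sup>2) summable_on range ?h"
      using a by (subst summable_on_reindex[OF inj])
        (simp add: o_def bh hardy_expansion_def square_summable_def)
    then show "square_summable b"
      unfolding square_summable_def
      by (rule summable_on_cong_neutral[THEN iffD1, rotated -1]) (auto simp: b0)
  next
    fix z :: "complex ^ 'a" assume "z \<in> polydisc"
    then have "((\<lambda>k. ?a k * mpow z k) has_sum hardy_fun f z) UNIV"
      using a by (auto simp: hardy_expansion_def)
    then have "((\<lambda>k. z $ i * (?a k * mpow z k)) has_sum (z $ i * hardy_fun f z)) UNIV"
      by (rule has_sum_cmult_right)
    then have "((\<lambda>k. b k * mpow z k) has_sum (z $ i * hardy_fun f z)) (range ?h)"
      by (subst has_sum_reindex[OF inj]) (simp add: o_def bh mp algebra_simps)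
    then show "((\<lambda>k. b k * mpow z k) has_sum (z $ i * hardy_fun f z)) UNIV"
      by (rule has_sum_cong_neutral[THEN iffD1, rotated -1]) (auto simp: b0)
  next
    fix z :: "complex ^ 'a" assume "z \<notin> polydisc"
    then show "z $ i * hardy_fun f z = 0" using a by (simp add: hardy_expansion_def)
  qed
  then show ?thesis by (simp add: coord_mult_def hardy_fun_Abs)
qed


section \<open>Invariant subspaces and their C*-algebras\<close>

definition invariant_subspace :: "('n::finite) hardy set \<Rightarrow> bool" where
  "invariant_subspace S \<longleftrightarrow> closed_csubspace S \<and> (\<forall>i. coord_mult i ` S \<subseteq> S)"

definition toeplitz_algebra :: "('n::finite) hardy set \<Rightarrow> ('n hardy \<Rightarrow> 'n hardy) set" where
  "toeplitz_algebra S = cstar_generated S (range (\<lambda>i. restrict_op S (coord_mult i)))"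

end

theory Submission
  imports Defs "HOL-Computational_Algebra.Fundamental_Theorem_Algebra"
begin

text \<open>
  Write \<open>H\<close> for the Hardy space and \<open>P\<close> for the projection onto \<open>S\<close>.  Multiplication by
  coordinates has no nontrivial reducing subspace in \<open>S\<close>, and the algebra of \<open>S\<close> contains a
  nonzero finite rank operator, namely the compression analogue of the projection onto the
  constants; hence it contains all finite rank operators on \<open>S\<close>.  As \<open>1 - P\<close> has finite rank,
  the compression to \<open>S\<close> of every operator in the algebra of \<open>H\<close> lies in the algebra of \<open>S\<close>.
  Conversely \<open>T P\<close> lies in the algebra of \<open>H\<close> for all \<open>T\<close> in the algebra of \<open>S\<close>.  So it
  suffices to find an isometry \<open>A\<close> with range \<open>S\<close> inside the algebra of \<open>H\<close>; then \<open>A\<^sup>*\<close>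
  restricted to \<open>S\<close> is the required unitary.  An isometry whose range has codimension one is
  given by shifting along a single coordinate axis, and a composite of such isometries, with
  Householder reflections in between, has range \<open>S\<close>.
\<close>

section \<open>Hilbert spaces\<close>

text \<open>The unitary is not asked to carry \<open>coord_restr S i\<close> to
  \<open>coord_mult i\<close>; only the two algebras are matched. This leaves freedom in the choice
  of \<open>A\<close>, and having \<open>A\<close> inside the algebra of H turns both inclusions
  into algebra: \<open>A\<^sup>* T A = A\<^sup>* (T P) A\<close>, with
  \<open>P = A A\<^sup>*\<close> obtained for free, and conversely \<open>X\<close> is the image of
  the compression of \<open>A X A\<^sup>*\<close>. Finite rank operators enter twice. On H they
  supply the reflections that turn the complement of 1 into the complement of any prescribed vector.
  On \<open>S\<close> they absorb the failure of compression to be multiplicative. One argument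
  serves both cases, H being an invariant subspace of codimension zero. The difficulty in
  irreducibility is that the projection onto a reducing subspace commutes with the multiplications
  on \<open>S\<close> only. Preceding it by multiplication by a nonzero polynomial lying in
  \<open>S\<close> gives an operator on all of H, and multipliers of H have no zero
  divisors.\<close>

lemma cinner_add_right: "cinner x (y + z) = cinner x y + cinner x (z :: 'a::complex_inner)"
  by (metis cinner_add_left cinner_commute complex_cnj_add)

lemma cinner_scaleC_right: "cinner x (c *\<^sub>C y) = cnj c * cinner x (y :: 'a::complex_inner)"
  by (metis cinner_scaleC_left cinner_commute complex_cnj_mult)

lemma cinner_zero_left [simp]: "cinner 0 (y :: 'a::complex_inner) = 0"
  using cinner_add_left[of 0 0 y] by simp

lemma cinner_zero_right [simp]: "cinner (y :: 'a::complex_inner) 0 = 0"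
  using cinner_add_right[of y 0 0] by simp

lemma cinner_minus_left: "cinner (- x) (y :: 'a::complex_inner) = - cinner x y"
  using cinner_add_left[of x "- x" y] by (simp add: eq_neg_iff_add_eq_0 add.commute)

lemma cinner_minus_right: "cinner x (- y :: 'a::complex_inner) = - cinner x y"
  using cinner_add_right[of x y "- y"] by (simp add: eq_neg_iff_add_eq_0 add.commute)

lemma cinner_diff_left: "cinner (x - y) (z :: 'a::complex_inner) = cinner x z - cinner y z"
  using cinner_add_left[of x "- y" z] by (simp add: cinner_minus_left)

lemma cinner_diff_right: "cinner x (y - z :: 'a::complex_inner) = cinner x y - cinner x z"
  using cinner_add_right[of x y "- z"] by (simp add: cinner_minus_right)

lemmas cinner_simps = cinner_add_left cinner_add_right cinner_diff_left cinner_diff_right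
  cinner_scaleC_left cinner_scaleC_right cinner_minus_left cinner_minus_right

lemma cinner_sum_left: "cinner (\<Sum>i\<in>F. f i) (y :: 'a::complex_inner) = (\<Sum>i\<in>F. cinner (f i) y)"
  by (induction F rule: infinite_finite_induct) (auto simp: cinner_add_left)

lemma cinner_self: "cinner x (x :: 'a::complex_inner) = complex_of_real ((norm x)\<^sup>2)"
proof -
  have "Im (cinner x x) = 0"
    using cinner_commute[of x x] by (metis complex_cnj_cancel_iff Reals_cnj_iff complex_is_Real_iff)
  moreover have "Re (cinner x x) = (norm x)\<^sup>2"
    by (simp add: power2_norm_eq_inner inner_eq_Re_cinner)
  ultimately show ?thesis by (simp add: complex_eq_iff)
qed

lemma cinner_eq_zero_iff [simp]: "cinner x (x :: 'a::complex_inner) = 0 \<longleftrightarrow> x = 0"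
  by (simp add: cinner_self)

lemma cinner_eq_zero_commute: "cinner x (y :: 'a::complex_inner) = 0 \<longleftrightarrow> cinner y x = 0"
  by (subst cinner_commute) simp

lemma norm_scaleC: "norm (c *\<^sub>C (x :: 'a::complex_inner)) = cmod c * norm x"
proof -
  have "complex_of_real ((norm (c *\<^sub>C x))\<^sup>2) = complex_of_real ((cmod c * norm x)\<^sup>2)"
    unfolding cinner_self[symmetric] power_mult_distrib of_real_mult cinner_scaleC_left
      cinner_scaleC_right complex_norm_square by simp
  then have "(norm (c *\<^sub>C x))\<^sup>2 = (cmod c * norm x)\<^sup>2"
    by (simp only: of_real_eq_iff)
  then show ?thesis by (rule power2_eq_imp_eq) auto
qed

text \<open>The first argument is rotated by a unimodular \<open>c\<close> that makes the inner
  product real and nonnegative; the real Cauchy-Schwarz inequality then applies.\<close>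

lemma cmod_cinner_le: "cmod (cinner x y) \<le> norm x * norm (y :: 'a::complex_inner)"
proof (cases "cinner x y = 0")
  case False
  define c where "c = cnj (sgn (cinner x y))"
  have c: "c * cinner x y = complex_of_real (cmod (cinner x y))"
    using False by (simp add: c_def sgn_div_norm scaleR_conv_of_real complex_norm_square[symmetric]
        mult.commute power2_eq_square divide_simps)
  have c1: "cmod c = 1" using False by (simp add: c_def norm_sgn)
  have "cmod (cinner x y) = inner (c *\<^sub>C x) y"
    unfolding inner_eq_Re_cinner cinner_scaleC_left c by simp
  also have "\<dots> \<le> norm (c *\<^sub>C x) * norm y" by (rule norm_cauchy_schwarz)
  finally show ?thesis by (simp add: norm_scaleC c1)
qed auto

lemma bounded_linear_cinner_left: "bounded_linear (\<lambda>x. cinner x (y :: 'a::complex_inner))"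
proof
  show "\<exists>K. \<forall>x. cmod (cinner x y) \<le> norm x * K" using cmod_cinner_le by blast
qed (auto simp: cinner_add_left scaleR_scaleC cinner_scaleC_left scaleR_conv_of_real)

lemmas continuous_on_cinner_left [continuous_intros] =
  bounded_linear.continuous_on[OF bounded_linear_cinner_left]

lemma closed_csubspaceD:
  assumes "closed_csubspace S"
  shows "0 \<in> S" "x \<in> S \<Longrightarrow> y \<in> S \<Longrightarrow> x + y \<in> S" "x \<in> S \<Longrightarrow> y \<in> S \<Longrightarrow> x - y \<in> S"
    "x \<in> S \<Longrightarrow> c *\<^sub>C x \<in> S" "x \<in> S \<Longrightarrow> - x \<in> S" "closed S" "complex_vector.subspace S"
  using assms unfolding closed_csubspace_def
  by (auto simp: complex_vector.subspace_0 complex_vector.subspace_add complex_vector.subspace_diff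
      complex_vector.subspace_scale complex_vector.subspace_neg)

lemma closed_csubspace_UNIV: "closed_csubspace UNIV"
  by (simp add: closed_csubspace_def)

lemma closed_csubspace_Int:
  "closed_csubspace S \<Longrightarrow> closed_csubspace T \<Longrightarrow> closed_csubspace (S \<inter> T)"
  by (simp add: closed_csubspace_def closed_Int complex_vector.subspace_inter)

lemma closed_csubspace_orthogonal: "closed_csubspace {x :: 'a::complex_inner. \<forall>y\<in>F. cinner x y = 0}"
proof -
  have eq: "{x :: 'a. \<forall>y\<in>F. cinner x y = 0} = (\<Inter>y\<in>F. {x. cinner x y = 0})" by auto
  have "closed {x :: 'a. \<forall>y\<in>F. cinner x y = 0}"
    unfolding eq by (intro closed_INT ballI closed_Collect_eq continuous_intros)
  then show ?thesis
    by (auto simp: closed_csubspace_def cinner_simps complex_vector.subspace_def)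
qed

section \<open>Orthogonal projection onto a closed subspace\<close>

lemma ex_projection:
  fixes S :: "'a::complex_hilbert set"
  assumes S: "closed_csubspace S"
  shows "\<exists>y\<in>S. \<forall>z\<in>S. cinner (x - y) z = 0"
proof -
  note S' = closed_csubspaceD[OF S]
  define d where "d = (INF y\<in>S. (norm (x - y))\<^sup>2)"
  have bdd: "bdd_below ((\<lambda>y. (norm (x - y))\<^sup>2) ` S)" by (rule bdd_belowI[of _ 0]) auto
  have d_le: "d \<le> (norm (x - y))\<^sup>2" if "y \<in> S" for y
    unfolding d_def by (rule cINF_lower[OF bdd that])
  have "\<exists>y\<in>S. (norm (x - y))\<^sup>2 < d + 1 / Suc m" for m
    using cINF_less_iff[of S "\<lambda>y. (norm (x - y))\<^sup>2" "d + 1 / Suc m"] bdd S'(1)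
    unfolding d_def by auto
  then obtain y where y: "\<And>m. y m \<in> S" "\<And>m. (norm (x - y m))\<^sup>2 < d + 1 / Suc m"
    by metis
  \<comment> \<open>Parallelogram law for \<open>x - u\<close> and \<open>x - v\<close>: the
    midpoint of \<open>u\<close> and \<open>v\<close> lies in \<open>S\<close>, so its squared
    distance from \<open>x\<close> is at least \<open>d\<close>. Hence a minimizing sequence is
    Cauchy.\<close>
  have par: "(norm (u - v))\<^sup>2 + 4 * d \<le> 2 * (norm (x - u))\<^sup>2 + 2 * (norm (x - v))\<^sup>2"
    if "u \<in> S" "v \<in> S" for u v
  proof -
    have "(1/2) *\<^sub>R (u + v) \<in> S"
      unfolding scaleR_scaleC by (intro S' that)
    then have "4 * d \<le> 4 * (norm (x - (1/2) *\<^sub>R (u + v)))\<^sup>2" using d_le by simp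
    also have "\<dots> = (norm (2 *\<^sub>R (x - (1/2) *\<^sub>R (u + v))))\<^sup>2"
      by (simp only: norm_scaleR power_mult_distrib) simp
    also have "2 *\<^sub>R (x - (1/2) *\<^sub>R (u + v)) = (x - u) + (x - v)"
      by (simp add: algebra_simps scaleR_2)
    finally have "4 * d \<le> (norm ((x - u) + (x - v)))\<^sup>2" .
    moreover have "(norm (u - v))\<^sup>2 = (norm ((x - v) - (x - u)))\<^sup>2" by simp
    ultimately show ?thesis
      unfolding power2_norm_eq_inner by (simp add: inner_simps inner_commute)
  qed
  have "Cauchy y"
  proof (rule metric_CauchyI)
    fix e :: real assume "e > 0"
    obtain M where "4 / e\<^sup>2 < real M" using reals_Archimedean2 by blast
    then have "4 < real M * e\<^sup>2" using \<open>e > 0\<close> by (simp add: divide_less_eq)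
    also have "\<dots> \<le> real (Suc M) * e\<^sup>2" by (intro mult_right_mono) auto
    finally have M: "4 / Suc M < e\<^sup>2" by (simp add: divide_less_eq mult.commute)
    have "dist (y m) (y n) < e" if "m \<ge> M" "n \<ge> M" for m n
    proof -
      have "1 / Suc m \<le> 1 / Suc M" "1 / Suc n \<le> 1 / Suc M" using that by (auto simp: frac_le)
      then have "(norm (y m - y n))\<^sup>2 < e\<^sup>2"
        using par[OF y(1)[of m] y(1)[of n]] y(2)[of m] y(2)[of n] M by simp
      then show ?thesis using \<open>e > 0\<close> by (simp add: dist_norm power2_less_imp_less)
    qed
    then show "\<exists>M. \<forall>m\<ge>M. \<forall>n\<ge>M. dist (y m) (y n) < e" by blast
  qed
  then obtain l where l: "y \<longlonglongrightarrow> l" using Cauchy_convergent convergent_def by blast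
  have lS: "l \<in> S" using S'(6) l y(1) closed_sequentially by blast
  have "(norm (x - l))\<^sup>2 \<le> d + 0"
  proof (rule LIMSEQ_le)
    show "(\<lambda>m. (norm (x - y m))\<^sup>2) \<longlonglongrightarrow> (norm (x - l))\<^sup>2" by (intro tendsto_intros l)
    show "(\<lambda>m. d + 1 / Suc m) \<longlonglongrightarrow> d + 0"
      using LIMSEQ_inverse_real_of_nat by (intro tendsto_intros) (simp add: inverse_eq_divide)
    show "\<exists>N. \<forall>n\<ge>N. (norm (x - y n))\<^sup>2 \<le> d + 1 / real (Suc n)" using y(2) less_imp_le by blast
  qed
  then have min: "(norm (x - l))\<^sup>2 \<le> (norm (x - z))\<^sup>2" if "z \<in> S" for z
    using d_le[OF that] by linarith
  have "cinner (x - l) z = 0" if z: "z \<in> S" for z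
  proof (cases "z = 0")
    case False
    \<comment> \<open>Moving from \<open>l\<close> by this multiple of \<open>z\<close> lowers the
      squared distance as far as the direction of \<open>z\<close> permits; minimality at
      \<open>l\<close> forces the gain to be 0.\<close>
    define c where "c = cinner (x - l) z / (norm z)\<^sup>2"
    have "complex_of_real ((norm (x - (l + c *\<^sub>C z)))\<^sup>2) =
        complex_of_real ((norm (x - l))\<^sup>2 - (cmod (cinner (x - l) z))\<^sup>2 / (norm z)\<^sup>2)"
    proof -
      have e: "cinner z (x - l) = cnj (cinner (x - l) z)" by (rule cinner_commute)
      have "x - (l + c *\<^sub>C z) = (x - l) - c *\<^sub>C z" by simp
      then have "complex_of_real ((norm (x - (l + c *\<^sub>C z)))\<^sup>2) =
          cinner (x - l) (x - l) - cnj c * cinner (x - l) z - c * cinner z (x - l)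
            + c * cnj c * cinner z z"
        unfolding cinner_self[symmetric]
        by (simp only: cinner_diff_left cinner_diff_right cinner_scaleC_left cinner_scaleC_right)
          (simp add: algebra_simps)
      also have "\<dots> = complex_of_real ((norm (x - l))\<^sup>2 - (cmod (cinner (x - l) z))\<^sup>2 / (norm z)\<^sup>2)"
        using False unfolding e cinner_self c_def
        by (simp add: field_simps power2_eq_square) (metis complex_norm_square of_real_mult power2_eq_square)
      finally show ?thesis .
    qed
    then have "(norm (x - (l + c *\<^sub>C z)))\<^sup>2 = (norm (x - l))\<^sup>2 - (cmod (cinner (x - l) z))\<^sup>2 / (norm z)\<^sup>2"
      by (simp only: of_real_eq_iff)
    with min[of "l + c *\<^sub>C z"] have "(cmod (cinner (x - l) z))\<^sup>2 / (norm z)\<^sup>2 \<le> 0"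
      using z lS S' by simp
    then show ?thesis using False by (simp add: divide_le_0_iff)
  qed auto
  then show ?thesis using lS by blast
qed

definition proj :: "'a::complex_hilbert set \<Rightarrow> 'a \<Rightarrow> 'a" where
  "proj S x = (SOME y. y \<in> S \<and> (\<forall>z\<in>S. cinner (x - y) z = 0))"

lemma proj_in: "closed_csubspace S \<Longrightarrow> proj S x \<in> S"
  and proj_orthogonal: "closed_csubspace S \<Longrightarrow> z \<in> S \<Longrightarrow> cinner (x - proj S x) z = 0"
  using someI_ex[OF ex_projection[of S x, unfolded Bex_def]] unfolding proj_def by auto

lemma projI:
  assumes S: "closed_csubspace S" and "y \<in> S" "\<And>z. z \<in> S \<Longrightarrow> cinner (x - y) z = 0"
  shows "proj S x = y"
proof -
  have "proj S x - y \<in> S" by (intro closed_csubspaceD[OF S] proj_in assms)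
  from assms(3)[OF this] proj_orthogonal[OF S this, of x]
  have "cinner (proj S x - y) (proj S x - y) = 0"
    by (simp add: cinner_diff_left)
  then show ?thesis by simp
qed

lemma proj_ident: "closed_csubspace S \<Longrightarrow> x \<in> S \<Longrightarrow> proj S x = x"
  by (rule projI) auto

lemma cinner_proj:
  assumes "closed_csubspace S" "z \<in> S"
  shows "cinner (proj S x) z = cinner x z" "cinner z (proj S x) = cinner z x"
proof -
  show "cinner (proj S x) z = cinner x z"
    using proj_orthogonal[OF assms, of x] by (simp add: cinner_diff_left)
  then show "cinner z (proj S x) = cinner z x" by (metis cinner_commute)
qed

lemma proj_add: "closed_csubspace S \<Longrightarrow> proj S (x + y) = proj S x + proj S y"
  by (rule projI) (auto simp: proj_in closed_csubspaceD cinner_simps cinner_proj)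

lemma proj_scaleC: "closed_csubspace S \<Longrightarrow> proj S (c *\<^sub>C x) = c *\<^sub>C proj S x"
  by (rule projI) (auto simp: proj_in closed_csubspaceD cinner_simps cinner_proj)

lemma norm_proj_le:
  assumes S: "closed_csubspace S"
  shows "norm (proj S x) \<le> norm x"
proof (cases "proj S x = 0")
  case False
  have "complex_of_real ((norm (proj S x))\<^sup>2) = cinner x (proj S x)"
    unfolding cinner_self[symmetric] by (rule cinner_proj[OF S proj_in[OF S]])
  then have "(norm (proj S x))\<^sup>2 \<le> norm x * norm (proj S x)"
    using cmod_cinner_le[of x "proj S x"] by (metis abs_of_nonneg norm_of_real zero_le_power2)
  with False show ?thesis by (simp add: power2_eq_square)
qed auto

text \<open>A proper closed subspace \<open>N\<close> leaves some \<open>x - proj N x\<close>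
  nonzero and orthogonal to it. Every density argument below is thereby reduced to an orthogonality
  check.\<close>

lemma closed_csubspace_eqI:
  fixes S :: "'a::complex_hilbert set"
  assumes N: "closed_csubspace N" and S: "closed_csubspace S" and "N \<subseteq> S"
    and "\<And>g. g \<in> S \<Longrightarrow> (\<And>x. x \<in> N \<Longrightarrow> cinner x g = 0) \<Longrightarrow> g = 0"
  shows "N = S"
proof -
  have "x \<in> N" if "x \<in> S" for x
  proof -
    have "x - proj N x = 0"
    proof (rule assms(4))
      show "x - proj N x \<in> S" using that proj_in[OF N] \<open>N \<subseteq> S\<close> by (intro closed_csubspaceD[OF S]) auto
    qed (metis proj_orthogonal[OF N] cinner_eq_zero_commute)
    then show ?thesis using proj_in[OF N, of x] by simp
  qed
  with \<open>N \<subseteq> S\<close> show ?thesis by blast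
qed


section \<open>Bounded operators\<close>

lemma bounded_opsI:
  assumes "\<And>x. x \<in> S \<Longrightarrow> T x \<in> K" "\<And>x. x \<notin> S \<Longrightarrow> T x = 0"
    "\<And>x y. x \<in> S \<Longrightarrow> y \<in> S \<Longrightarrow> T (x + y) = T x + T y"
    "\<And>c x. x \<in> S \<Longrightarrow> T (c *\<^sub>C x) = c *\<^sub>C T x"
    "\<And>x. x \<in> S \<Longrightarrow> norm (T x) \<le> M * norm x"
  shows "T \<in> bounded_ops S K"
  using assms unfolding bounded_ops_def by blast

lemma bounded_opsD:
  assumes "T \<in> bounded_ops S K"
  shows "x \<in> S \<Longrightarrow> T x \<in> K" "x \<notin> S \<Longrightarrow> T x = 0"
    "x \<in> S \<Longrightarrow> y \<in> S \<Longrightarrow> T (x + y) = T x + T y" "x \<in> S \<Longrightarrow> T (c *\<^sub>C x) = c *\<^sub>C T x"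
  using assms unfolding bounded_ops_def by auto

lemma bounded_ops_0 [simp]: "T \<in> bounded_ops S K \<Longrightarrow> T 0 = 0"
  using bounded_opsD(2)[of T S K 0] bounded_opsD(4)[of T S K 0 0] by (cases "0 \<in> S") auto

lemma bounded_ops_diff_arg:
  assumes "T \<in> bounded_ops S K" "closed_csubspace S" "x \<in> S" "y \<in> S"
  shows "T (x - y) = T x - T y"
proof -
  have "T (x - y + y) = T (x - y) + T y"
    by (intro bounded_opsD[OF assms(1)] closed_csubspaceD[OF assms(2)] assms)
  then show ?thesis by simp
qed

lemma bounded_opsE:
  assumes "T \<in> bounded_ops S K"
  obtains M where "M \<ge> 0" "\<And>x. norm (T x) \<le> M * norm x"
proof -
  obtain M where M: "\<And>x. x \<in> S \<Longrightarrow> norm (T x) \<le> M * norm x"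
    using assms unfolding bounded_ops_def by blast
  \<comment> \<open>On a trivial \<open>S\<close> the constant \<open>M\<close> may be negative;
    outside \<open>S\<close> the operator vanishes, so the bound holds for every
    \<open>x\<close>.\<close>
  have "norm (T x) \<le> max M 0 * norm x" for x
  proof (cases "x \<in> S")
    case True
    then show ?thesis using M[OF True] by (meson max.cobounded1 mult_right_mono norm_ge_zero order_trans)
  next
    case False
    then show ?thesis using bounded_opsD(2)[OF assms False] by simp
  qed
  then show ?thesis using that[of "max M 0"] by simp
qed

lemma bounded_ops_mono: "T \<in> bounded_ops S K \<Longrightarrow> K \<subseteq> L \<Longrightarrow> T \<in> bounded_ops S L"
  unfolding bounded_ops_def by blast

lemma bounded_ops_zero: "closed_csubspace K \<Longrightarrow> (\<lambda>x. 0) \<in> bounded_ops S K"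
  by (rule bounded_opsI[where M = 0]) (auto simp: closed_csubspaceD)

lemma bounded_ops_add:
  assumes T: "T \<in> bounded_ops S K" and T': "T' \<in> bounded_ops S K" and K: "closed_csubspace K"
  shows "(\<lambda>x. T x + T' x) \<in> bounded_ops S K"
proof -
  obtain M where M: "\<And>x. norm (T x) \<le> M * norm x" using bounded_opsE[OF T] by metis
  obtain M' where M': "\<And>x. norm (T' x) \<le> M' * norm x" using bounded_opsE[OF T'] by metis
  show ?thesis
  proof (rule bounded_opsI[where M = "M + M'"])
    fix x
    show "norm (T x + T' x) \<le> (M + M') * norm x"
      using norm_triangle_ineq[of "T x" "T' x"] M[of x] M'[of x] by (simp add: algebra_simps)
  qed (auto simp: bounded_opsD[OF T] bounded_opsD[OF T'] closed_csubspaceD[OF K] scaleC_add_right)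
qed

lemma bounded_ops_scaleC:
  assumes T: "T \<in> bounded_ops S K" and K: "closed_csubspace K"
  shows "(\<lambda>x. c *\<^sub>C T x) \<in> bounded_ops S K"
proof -
  obtain M where M: "\<And>x. norm (T x) \<le> M * norm x" using bounded_opsE[OF T] by metis
  show ?thesis
  proof (rule bounded_opsI[where M = "cmod c * M"])
    fix x
    show "norm (c *\<^sub>C T x) \<le> cmod c * M * norm x"
      using M[of x] by (simp add: norm_scaleC mult.assoc mult_left_mono)
  qed (auto simp: bounded_opsD[OF T] closed_csubspaceD[OF K] scaleC_add_right scaleC_scaleC mult.commute)
qed

lemma bounded_ops_diff:
  assumes "T \<in> bounded_ops S K" "T' \<in> bounded_ops S K" "closed_csubspace K"
  shows "(\<lambda>x. T x - T' x) \<in> bounded_ops S K"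
  using bounded_ops_add[OF assms(1) bounded_ops_scaleC[OF assms(2,3), of "-1"] assms(3)]
  by (simp add: complex_vector.scale_minus_left)

lemma bounded_ops_comp:
  assumes T: "T \<in> bounded_ops S K" and R: "R \<in> bounded_ops K L"
  shows "R \<circ> T \<in> bounded_ops S L"
proof -
  obtain M where M: "\<And>x. norm (T x) \<le> M * norm x" using bounded_opsE[OF T] by metis
  obtain M' where M': "M' \<ge> 0" "\<And>x. norm (R x) \<le> M' * norm x" using bounded_opsE[OF R] by metis
  show ?thesis
  proof (rule bounded_opsI[where M = "M' * M"])
    fix x
    have "norm (R (T x)) \<le> M' * norm (T x)" by (rule M')
    also have "\<dots> \<le> M' * (M * norm x)" using M' M by (intro mult_left_mono)
    finally show "norm ((R \<circ> T) x) \<le> M' * M * norm x" by (simp add: mult.assoc)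
  qed (auto simp: bounded_opsD[OF T] bounded_opsD[OF R] bounded_ops_0[OF R])
qed

lemma restrict_op_id: "closed_csubspace S \<Longrightarrow> restrict_op S (\<lambda>x. x) \<in> bounded_ops S S"
  by (rule bounded_opsI[where M = 1]) (auto simp: restrict_op_def closed_csubspaceD)

lemma proj_bounded_ops: "closed_csubspace S \<Longrightarrow> proj S \<in> bounded_ops UNIV S"
  by (rule bounded_opsI[where M = 1]) (auto simp: proj_in proj_add proj_scaleC norm_proj_le)

lemma bounded_ops_restrict:
  assumes T: "T \<in> bounded_ops S K" and "L \<subseteq> S" and L: "closed_csubspace L"
  shows "restrict_op L T \<in> bounded_ops L K"
proof -
  obtain M where M: "\<And>x. norm (T x) \<le> M * norm x" using bounded_opsE[OF T] by metis
  show ?thesis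
    by (rule bounded_opsI[where M = M])
      (use M assms(2) in \<open>auto simp: restrict_op_def closed_csubspaceD[OF L] subset_eq
        bounded_opsD[OF T]\<close>)
qed

lemma bounded_linear_bounded_ops:
  assumes "T \<in> bounded_ops UNIV K"
  shows "bounded_linear T"
proof
  show "\<exists>M. \<forall>x. norm (T x) \<le> norm x * M" using bounded_opsE[OF assms] by (metis mult.commute)
qed (auto simp: bounded_opsD[OF assms] scaleR_scaleC)

section \<open>Riesz representation and adjoints\<close>

lemma riesz_representation:
  fixes S :: "'a::complex_hilbert set" and \<phi> :: "'a \<Rightarrow> complex"
  assumes S: "closed_csubspace S"
    and add: "\<And>x y. x \<in> S \<Longrightarrow> y \<in> S \<Longrightarrow> \<phi> (x + y) = \<phi> x + \<phi> y"
    and scale: "\<And>c x. x \<in> S \<Longrightarrow> \<phi> (c *\<^sub>C x) = c * \<phi> x"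
    and bound: "\<And>x. x \<in> S \<Longrightarrow> cmod (\<phi> x) \<le> M * norm x"
  shows "\<exists>w\<in>S. \<forall>x\<in>S. \<phi> x = cinner x w"
proof -
  note S' = closed_csubspaceD[OF S]
  define K where "K = {x \<in> S. \<phi> x = 0}"
  have diff: "\<phi> (x - y) = \<phi> x - \<phi> y" if "x \<in> S" "y \<in> S" for x y
    using add[of "x - y" y] S'(3)[OF that] that by simp
  have z: "\<phi> 0 = 0" using scale[of 0 0] S'(1) by simp
  have K: "closed_csubspace K"
    unfolding closed_csubspace_def
  proof
    show "complex_vector.subspace K"
      unfolding complex_vector.subspace_def K_def using S' z add scale by auto
    show "closed K"
      unfolding closed_sequential_limits
    proof (intro allI impI, elim conjE)
      fix u l assume u: "\<forall>n. u n \<in> K" "u \<longlonglongrightarrow> l"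
      have l: "l \<in> S" using S'(6) u closed_sequentially K_def by (metis (no_types, lifting) mem_Collect_eq)
      have "(\<lambda>n. M * norm (l - u n)) \<longlonglongrightarrow> M * norm (l - l)" by (intro tendsto_intros u)
      \<comment> \<open>\<open>\<phi>\<close> vanishes at \<open>u n\<close>, so its value at
        \<open>l\<close> is its value at \<open>l - u n\<close>; thus boundedness makes the kernel
        closed.\<close>
      moreover have "cmod (\<phi> l) \<le> M * norm (l - u n)" for n
        using bound[of "l - u n"] diff[of l "u n"] S'(3)[of l "u n"] u(1) l by (auto simp: K_def)
      ultimately have "cmod (\<phi> l) \<le> M * norm (l - l)" by (intro LIMSEQ_le_const) auto
      then show "l \<in> K" using l by (simp add: K_def)
    qed
  qed
  show ?thesis
  proof (cases "K = S")
    case True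
    then show ?thesis using S' by (intro bexI[of _ 0]) (auto simp: K_def)
  next
    case False
    then obtain x0 where x0: "x0 \<in> S" "x0 \<notin> K" by (auto simp: K_def)
    define e where "e = x0 - proj K x0"
    have eS: "e \<in> S" unfolding e_def using x0 proj_in[OF K, of x0] by (intro S') (auto simp: K_def)
    have e0: "e \<noteq> 0" using x0 proj_in[OF K, of x0] by (auto simp: e_def)
    have eK: "cinner x e = 0" if "x \<in> K" for x
      unfolding e_def using proj_orthogonal[OF K that] cinner_eq_zero_commute by blast
    have pe: "\<phi> e \<noteq> 0" using eK[of e] eS e0 by (auto simp: K_def)
    show ?thesis
    proof (intro bexI ballI)
      \<comment> \<open>The complement of the kernel in \<open>S\<close> is the line through
        \<open>e\<close>. The factor is forced by the value at \<open>e\<close>, conjugated because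
        the inner product is conjugate linear in its second argument.\<close>
      show "(cnj (\<phi> e) / (norm e)\<^sup>2) *\<^sub>C e \<in> S" by (intro S' eS)
      fix x assume x: "x \<in> S"
      have "x - (\<phi> x / \<phi> e) *\<^sub>C e \<in> K"
        using x eS S' pe by (auto simp: K_def diff scale)
      from eK[OF this] have "cinner x e = \<phi> x / \<phi> e * (norm e)\<^sup>2"
        by (simp add: cinner_simps cinner_self)
      then show "\<phi> x = cinner x ((cnj (\<phi> e) / (norm e)\<^sup>2) *\<^sub>C e)"
        using pe e0 by (simp add: cinner_scaleC_right)
    qed
  qed
qed

lemma ex_adjoint:
  fixes S :: "'a::complex_hilbert set" and K :: "'b::complex_hilbert set"
  assumes S: "closed_csubspace S" and K: "closed_csubspace K" and T: "T \<in> bounded_ops S K"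
  shows "\<exists>T'. T' \<in> bounded_ops K S \<and> (\<forall>x\<in>S. \<forall>y\<in>K. cinner (T x) y = cinner x (T' y))"
proof -
  note S' = closed_csubspaceD[OF S] and K' = closed_csubspaceD[OF K]
  obtain M where M: "M \<ge> 0" "\<And>x. norm (T x) \<le> M * norm x" using bounded_opsE[OF T] by metis
  have "\<exists>w\<in>S. \<forall>x\<in>S. cinner (T x) y = cinner x w" for y
  proof (rule riesz_representation[OF S, where M = "M * norm y"])
    fix x
    have "cmod (cinner (T x) y) \<le> norm (T x) * norm y" by (rule cmod_cinner_le)
    also have "\<dots> \<le> M * norm x * norm y" using M by (intro mult_right_mono) auto
    finally show "cmod (cinner (T x) y) \<le> M * norm y * norm x" by (simp add: mult.assoc mult.left_commute mult.commute)
  qed (auto simp: bounded_opsD[OF T] cinner_simps)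
  then obtain t where t: "\<And>y. t y \<in> S" "\<And>x y. x \<in> S \<Longrightarrow> cinner (T x) y = cinner x (t y)"
    by metis
  have uniq: "w = w'" if "w \<in> S" "w' \<in> S" "\<And>x. x \<in> S \<Longrightarrow> cinner x w = cinner x w'" for w w'
    using that(3)[of "w - w'"] S'(3)[OF that(1,2)]
    by (metis cinner_diff_right cinner_eq_zero_iff eq_iff_diff_eq_0)
  have "restrict_op K t \<in> bounded_ops K S"
  proof (rule bounded_opsI[where M = M])
    fix y
    \<comment> \<open>The bound of \<open>T\<close> passes to the adjoint by testing at
      \<open>x = t y\<close> and cancelling one factor \<open>norm (t y)\<close>.\<close>
    have "complex_of_real ((norm (t y))\<^sup>2) = cinner (T (t y)) y"
      using t by (simp add: cinner_self)
    then have "(norm (t y))\<^sup>2 \<le> norm (T (t y)) * norm y"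
      using cmod_cinner_le[of "T (t y)" y] by (metis abs_of_nonneg norm_of_real zero_le_power2)
    also have "\<dots> \<le> M * norm (t y) * norm y" using M by (intro mult_right_mono) auto
    finally have "norm (t y) * norm (t y) \<le> norm (t y) * (M * norm y)"
      by (simp add: power2_eq_square mult.assoc mult.left_commute)
    then have "norm (t y) \<le> M * norm y"
      using M by (cases "t y = 0") auto
    then show "norm (restrict_op K t y) \<le> M * norm y"
      using M by (simp add: restrict_op_def)
  qed (auto simp: restrict_op_def K' t S' cinner_simps simp flip: t(2) intro!: uniq)
  then show ?thesis using t by (intro exI[of _ "restrict_op K t"]) (auto simp: restrict_op_def)
qed

lemma adjoint_opI:
  assumes S: "closed_csubspace S" and "T' \<in> bounded_ops K S"
    and "\<And>x y. x \<in> S \<Longrightarrow> y \<in> K \<Longrightarrow> cinner (T x) y = cinner x (T' y)"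
  shows "adjoint_op S K T = T'"
  unfolding adjoint_op_def
proof (rule the_equality)
  fix R assume R: "R \<in> bounded_ops K S \<and> (\<forall>x\<in>S. \<forall>y\<in>K. cinner (T x) y = cinner x (R y))"
  then have Rb: "R \<in> bounded_ops K S" by blast
  show "R = T'"
  proof
    fix y
    show "R y = T' y"
    proof (cases "y \<in> K")
      case True
      then have "R y - T' y \<in> S"
        by (intro closed_csubspaceD[OF S] bounded_opsD(1)[OF assms(2)] bounded_opsD(1)[OF Rb])
      then have "cinner (R y - T' y) (R y - T' y) = 0"
        using R assms(3) True by (metis cinner_diff_right diff_self)
      then show ?thesis by simp
    next
      case False
      then show ?thesis by (simp add: bounded_opsD(2)[OF assms(2)] bounded_opsD(2)[OF Rb])
    qed
  qed
qed (use assms in auto)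

lemma
  fixes S :: "'a::complex_hilbert set" and K :: "'b::complex_hilbert set"
  assumes S: "closed_csubspace S" and K: "closed_csubspace K" and T: "T \<in> bounded_ops S K"
  shows adjoint_op_bounded: "adjoint_op S K T \<in> bounded_ops K S"
    and cinner_adjoint: "x \<in> S \<Longrightarrow> y \<in> K \<Longrightarrow> cinner (T x) y = cinner x (adjoint_op S K T y)"
proof -
  obtain T' where T': "T' \<in> bounded_ops K S" "\<And>x y. x \<in> S \<Longrightarrow> y \<in> K \<Longrightarrow> cinner (T x) y = cinner x (T' y)"
    using ex_adjoint[OF assms] by blast
  have "adjoint_op S K T = T'" by (rule adjoint_opI[OF S T'])
  with T' show "adjoint_op S K T \<in> bounded_ops K S"
    "x \<in> S \<Longrightarrow> y \<in> K \<Longrightarrow> cinner (T x) y = cinner x (adjoint_op S K T y)" by auto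
qed

lemma cinner_adjoint':
  fixes S :: "'a::complex_hilbert set" and K :: "'b::complex_hilbert set"
  assumes "closed_csubspace S" "closed_csubspace K" "T \<in> bounded_ops S K" "x \<in> S" "y \<in> K"
  shows "cinner y (T x) = cinner (adjoint_op S K T y) x"
  using cinner_adjoint[OF assms] by (metis cinner_commute)

section \<open>Operator norm\<close>

lemma op_norm_le:
  assumes "closed_csubspace S" "M \<ge> 0" "\<And>x. x \<in> S \<Longrightarrow> norm (T x) \<le> M * norm x"
  shows "op_norm S T \<le> M"
  unfolding op_norm_def
proof (rule cSUP_least)
  show "{x \<in> S. norm x \<le> 1} \<noteq> {}" using closed_csubspaceD(1)[OF assms(1)] by auto
  fix x assume "x \<in> {x \<in> S. norm x \<le> 1}"
  then show "norm (T x) \<le> M" using assms(2) assms(3)[of x] mult_left_le[of "norm x" M] by auto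
qed

lemma
  assumes S: "closed_csubspace S" and T: "T \<in> bounded_ops S K"
  shows norm_le_op_norm: "x \<in> S \<Longrightarrow> norm x \<le> 1 \<Longrightarrow> norm (T x) \<le> op_norm S T"
    and op_norm_nonneg: "0 \<le> op_norm S T"
proof -
  obtain M where M: "M \<ge> 0" "\<And>x. norm (T x) \<le> M * norm x" using bounded_opsE[OF T] by metis
  have bdd: "bdd_above ((\<lambda>x. norm (T x)) ` {x \<in> S. norm x \<le> 1})"
  proof (rule bdd_aboveI2)
    fix x assume "x \<in> {x \<in> S. norm x \<le> 1}"
    then show "norm (T x) \<le> M" using M(1) M(2)[of x] mult_left_le[of "norm x" M] by auto
  qed
  then show "x \<in> S \<Longrightarrow> norm x \<le> 1 \<Longrightarrow> norm (T x) \<le> op_norm S T"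
    unfolding op_norm_def by (intro cSUP_upper) auto
  have "norm (T 0) \<le> op_norm S T"
    unfolding op_norm_def using closed_csubspaceD[OF S] by (intro cSUP_upper[OF _ bdd]) auto
  then show "0 \<le> op_norm S T" using norm_ge_zero order_trans by blast
qed

lemma op_norm_bound:
  assumes S: "closed_csubspace S" and T: "T \<in> bounded_ops S K"
  shows "norm (T x) \<le> op_norm S T * norm x"
proof (cases "x \<in> S \<and> x \<noteq> 0")
  case True
  define y where "y = complex_of_real (inverse (norm x)) *\<^sub>C x"
  have "norm y = 1" using True by (simp add: y_def norm_scaleC norm_inverse)
  moreover have "y \<in> S" using True closed_csubspaceD[OF S] by (simp add: y_def)
  ultimately have "norm (T y) \<le> op_norm S T" by (simp add: norm_le_op_norm[OF S T])
  moreover have "norm (T y) = norm (T x) / norm x"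
    using True by (simp add: y_def bounded_opsD[OF T] norm_scaleC norm_inverse norm_divide divide_inverse)
  ultimately show ?thesis using True by (simp add: field_simps)
next
  case False
  then have "T x = 0" using T bounded_opsD(2)[OF T] by auto
  then show ?thesis using op_norm_nonneg[OF S T] by simp
qed

section \<open>Finite-dimensional subspaces\<close>

text \<open>Dependence is phrased for an indexed family because a repeated value, invisible in the
  image set, is itself a dependence, with coefficients 1 and -1. Otherwise \<open>card B + 1\<close>
  distinct vectors exceed the size of a spanning set.\<close>

lemma family_dependent:
  fixes f :: "nat \<Rightarrow> 'a::complex_inner"
  assumes B: "finite B" and f: "\<And>i. i \<le> card B \<Longrightarrow> f i \<in> complex_vector.span B"
  shows "\<exists>c. (\<exists>i\<le>card B. c i \<noteq> 0) \<and> (\<Sum>i\<le>card B. c i *\<^sub>C f i) = 0"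
proof (cases "inj_on f {..card B}")
  case True
  have "complex_vector.dependent (f ` {..card B})"
  proof (rule ccontr)
    assume "complex_vector.independent (f ` {..card B})"
    from complex_vector.independent_span_bound[OF B this] f
    have "card (f ` {..card B}) \<le> card B" by auto
    then show False by (simp add: card_image[OF True])
  qed
  then obtain u where u: "\<exists>v\<in>f ` {..card B}. u v \<noteq> 0" "(\<Sum>v\<in>f ` {..card B}. u v *\<^sub>C v) = 0"
    using complex_vector.dependent_finite[of "f ` {..card B}"] by auto
  then show ?thesis
    by (intro exI[of _ "u \<circ> f"]) (auto simp: sum.reindex[OF True])
next
  case False
  then obtain i j where ij: "i \<le> card B" "j \<le> card B" "i \<noteq> j" "f i = f j"
    by (auto simp: inj_on_def)
  define c :: "nat \<Rightarrow> complex" where "c k = (if k = i then 1 else if k = j then -1 else 0)" for k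
  have "(\<Sum>k\<le>card B. c k *\<^sub>C f k) = (\<Sum>k\<in>{i, j}. c k *\<^sub>C f k)"
    by (rule sum.mono_neutral_right) (use ij in \<open>auto simp: c_def\<close>)
  also have "\<dots> = 0" using ij by (simp add: c_def)
  finally show ?thesis using ij by (intro exI[of _ c]) (auto simp: c_def)
qed

text \<open>\<open>L\<close> is linear on \<open>V\<close> only, so membership in \<open>V\<close>
  is carried along in the induction.\<close>

lemma linear_on_span:
  fixes V :: "'a::complex_inner set" and L :: "'a \<Rightarrow> 'b::complex_inner"
  assumes V: "complex_vector.subspace V" "B \<subseteq> V"
    and add: "\<And>x y. x \<in> V \<Longrightarrow> y \<in> V \<Longrightarrow> L (x + y) = L x + L y"
    and scale: "\<And>c x. x \<in> V \<Longrightarrow> L (c *\<^sub>C x) = c *\<^sub>C L x"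
    and w: "w \<in> complex_vector.span B"
  shows "L w \<in> complex_vector.span (L ` B)"
proof -
  have z: "0 \<in> V" by (rule complex_vector.subspace_0[OF V(1)])
  have "w \<in> V \<and> L w \<in> complex_vector.span (L ` B)"
    using w
  proof (induction rule: complex_vector.span_induct_alt)
    case base
    show ?case using z scale[of 0 0] by (simp add: complex_vector.span_zero)
  next
    case (step c x y)
    then have x: "x \<in> V" using V by blast
    then have "L (c *\<^sub>C x + y) = c *\<^sub>C L x + L y"
      using step V add[of "c *\<^sub>C x" y] scale[of x c] by (simp add: complex_vector.subspace_scale)
    moreover have "c *\<^sub>C L x + L y \<in> complex_vector.span (L ` B)"
      using step complex_vector.span_add[OF complex_vector.span_scale[OF complex_vector.span_base]]
      by blast
    ultimately show ?case
      using step x V by (simp add: complex_vector.subspace_add complex_vector.subspace_scale)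
  qed
  then show ?thesis by simp
qed

lemma gram_schmidt:
  fixes B :: "'a::complex_inner set"
  assumes "finite B"
  shows "\<exists>E. finite E \<and> complex_vector.span E = complex_vector.span B \<and>
    (\<forall>e\<in>E. \<forall>e'\<in>E. cinner e e' = (if e = e' then 1 else 0))"
  using assms
proof (induction B rule: finite_induct)
  case empty
  show ?case by (intro exI[of _ "{}"]) auto
next
  case (insert b B)
  then obtain E where E: "finite E" "complex_vector.span E = complex_vector.span B"
    "\<And>e e'. e \<in> E \<Longrightarrow> e' \<in> E \<Longrightarrow> cinner e e' = (if e = e' then 1 else 0)"
    by blast
  define s where "s = (\<Sum>e\<in>E. cinner b e *\<^sub>C e)"
  have s: "s \<in> complex_vector.span E"
    unfolding s_def by (intro complex_vector.span_sum complex_vector.span_scale complex_vector.span_base)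
  have orth: "cinner (b - s) e = 0" if "e \<in> E" for e
  proof -
    have "cinner s e = (\<Sum>e'\<in>E. if e' = e then cinner b e else 0)"
      unfolding s_def cinner_sum_left
      by (rule sum.cong) (use that E(3) in \<open>auto simp: cinner_scaleC_left\<close>)
    also have "\<dots> = cinner b e" using that E(1) by simp
    finally show ?thesis by (simp add: cinner_diff_left)
  qed
  have span: "complex_vector.span (insert (b - s) E) = complex_vector.span (insert b B)"
  proof -
    \<comment> \<open>\<open>b\<close> and \<open>b - s\<close> differ by an element of the span of
      \<open>E\<close>, so exchanging one for the other does not change the span.\<close>
    have "b - (b - s) \<in> complex_vector.span E" using s by simp
    from complex_vector.eq_span_insert_eq[OF this]
    have "complex_vector.span (insert (b - s) E) = complex_vector.span (insert b E)" by simp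
    then show ?thesis by (simp add: complex_vector.span_insert E(2))
  qed
  show ?case
  proof (cases "b = s")
    case True
    then have "complex_vector.span E = complex_vector.span (insert b B)"
      using s by (metis E(2) complex_vector.span_redundant)
    then show ?thesis using E by blast
  next
    case False
    define e where "e = complex_of_real (inverse (norm (b - s))) *\<^sub>C (b - s)"
    have ee: "cinner e e = 1"
    proof -
      have "norm e = 1" unfolding e_def norm_scaleC using False by (simp add: norm_inverse)
      then show ?thesis by (simp add: cinner_self)
    qed
    have eE: "cinner e x = 0" "cinner x e = 0" if "x \<in> E" for x
    proof -
      show "cinner e x = 0" using orth[OF that] by (simp add: e_def cinner_scaleC_left)
      then show "cinner x e = 0" by (simp add: cinner_eq_zero_commute)
    qed
    have "complex_vector.span (insert e E) = complex_vector.span (insert (b - s) E)"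
    proof (rule complex_vector.span_eq[THEN iffD2], intro conjI insert_subsetI)
      have "b - s = complex_of_real (norm (b - s)) *\<^sub>C e"
        using False by (simp add: e_def scaleC_scaleC flip: of_real_mult)
      then show "b - s \<in> complex_vector.span (insert e E)"
        by (metis complex_vector.span_base complex_vector.span_scale insertI1)
      show "e \<in> complex_vector.span (insert (b - s) E)"
        unfolding e_def by (intro complex_vector.span_scale complex_vector.span_base) auto
    qed (auto intro: complex_vector.span_base)
    moreover have "\<forall>x\<in>insert e E. \<forall>y\<in>insert e E. cinner x y = (if x = y then 1 else 0)"
      using ee eE E(3) by auto (metis zero_neq_one)+
    ultimately show ?thesis using E(1) span by (intro exI[of _ "insert e E"]) auto
  qed
qed

lemma orthonormal_expansion:
  fixes E :: "'a::complex_inner set"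
  assumes "finite E" "\<And>e e'. e \<in> E \<Longrightarrow> e' \<in> E \<Longrightarrow> cinner e e' = (if e = e' then 1 else 0)"
    and "x \<in> complex_vector.span E"
  shows "x = (\<Sum>e\<in>E. cinner x e *\<^sub>C e)"
  using assms(3)
proof (induction rule: complex_vector.span_induct_alt)
  case (step c x y)
  have "(\<Sum>e\<in>E. cinner x e *\<^sub>C e) = (\<Sum>e\<in>E. if e = x then x else 0)"
    by (rule sum.cong) (use step(1) assms(2)[of x] in auto)
  also have "\<dots> = x" using assms(1) step(1) by simp
  finally have x: "(\<Sum>e\<in>E. cinner x e *\<^sub>C e) = x" .
  have y: "(\<Sum>e\<in>E. cinner y e *\<^sub>C e) = y" by (rule step(2)[symmetric])
  have "(\<Sum>e\<in>E. cinner (c *\<^sub>C x + y) e *\<^sub>C e) =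
      (\<Sum>e\<in>E. c *\<^sub>C (cinner x e *\<^sub>C e) + cinner y e *\<^sub>C e)"
    by (simp add: cinner_simps scaleC_add_left)
  also have "\<dots> = c *\<^sub>C x + y"
    unfolding sum.distrib complex_vector.scale_sum_right[symmetric] x y ..
  finally show ?case by (rule sym)
qed auto

text \<open>
  Polynomials in \<open>L\<close> are applied to \<open>v\<close> by Horner's scheme, because \<open>L\<close> is only linear on \<open>V\<close>.
\<close>

lemma ex_eigenvector:
  fixes V :: "'a::complex_inner set" and L :: "'a \<Rightarrow> 'a"
  assumes V: "complex_vector.subspace V" "finite B" "V \<subseteq> complex_vector.span B"
    and v: "v \<in> V" "v \<noteq> 0"
    and L: "\<And>x. x \<in> V \<Longrightarrow> L x \<in> V"
    and add: "\<And>x y. x \<in> V \<Longrightarrow> y \<in> V \<Longrightarrow> L (x + y) = L x + L y"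
    and scale: "\<And>c x. x \<in> V \<Longrightarrow> L (c *\<^sub>C x) = c *\<^sub>C L x"
  shows "\<exists>c u. u \<in> V \<and> u \<noteq> 0 \<and> L u = c *\<^sub>C u"
proof -
  note V' = complex_vector.subspace_0[OF V(1)] complex_vector.subspace_add[OF V(1)]
    complex_vector.subspace_scale[OF V(1)]
  have L0: "L 0 = 0" using scale[of 0 0] V' by simp
  define ev where "ev p = fold_coeffs (\<lambda>a w. a *\<^sub>C v + L w) p 0" for p
  have ev0: "ev 0 = 0" by (simp add: ev_def)
  have evp: "ev (pCons a p) = a *\<^sub>C v + L (ev p)" for a p
    using L0 by (cases "a = 0 \<and> p = 0") (auto simp: ev_def)
  have evV: "ev p \<in> V" for p
    by (induction p) (auto simp: ev0 evp intro!: V' v L)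
  have ev_add: "ev (p + q) = ev p + ev q" for p q
    by (induction p q rule: poly_induct2)
      (auto simp: ev0 evp add evV scaleC_add_left)
  have ev_smult: "ev (smult c p) = c *\<^sub>C ev p" for c p
    by (induction p) (auto simp: ev0 evp scale evV scaleC_add_right scaleC_scaleC)
  have ev_sum: "ev (\<Sum>i\<in>I. p i) = (\<Sum>i\<in>I. ev (p i))" for I :: "nat set" and p
    by (induction I rule: infinite_finite_induct) (auto simp: ev0 ev_add)
  have Lv: "(L ^^ i) v \<in> V" for i by (induction i) (auto intro: v L)
  \<comment> \<open>\<open>ev (monom 1 i)\<close> is the \<open>i\<close>-th iterate of
    \<open>L\<close> at \<open>v\<close>; the iterates from 0 to \<open>card B\<close> are one too
    many to be independent.\<close>
  obtain c where c: "\<exists>i\<le>card B. c i \<noteq> 0" "(\<Sum>i\<le>card B. c i *\<^sub>C ev (monom 1 i)) = 0"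
    using family_dependent[OF V(2), of "\<lambda>i. ev (monom 1 i)"] evV V(3) by blast
  define p0 where "p0 = (\<Sum>i\<le>card B. smult (c i) (monom 1 i))"
  have p0: "ev p0 = 0" unfolding p0_def ev_sum ev_smult by (rule c(2))
  have "coeff p0 i = c i" if "i \<le> card B" for i
    using that by (simp add: p0_def coeff_sum if_distrib cong: if_cong)
  then have "p0 \<noteq> 0" using c(1) by auto
  \<comment> \<open>The degree is minimal among nonzero polynomials annihilating \<open>v\<close>.
    Splitting off a linear factor therefore leaves \<open>q\<close> with
    \<open>ev q \<noteq> 0\<close>, and this vector is the eigenvector.\<close>
  then obtain p where p: "p \<noteq> 0" "ev p = 0" and min: "\<And>q. q \<noteq> 0 \<Longrightarrow> ev q = 0 \<Longrightarrow> degree p \<le> degree q"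
    using p0 ex_has_least_nat[of "\<lambda>p. p \<noteq> 0 \<and> ev p = 0" p0 degree] by blast
  have "degree p \<noteq> 0"
  proof
    assume "degree p = 0"
    then obtain a where "p = [:a:]" by (rule degree_eq_zeroE)
    with p v show False by (simp add: evp ev0 L0)
  qed
  then obtain z where "poly p z = 0"
    using fundamental_theorem_of_algebra[of p] by (auto simp: constant_degree)
  then obtain q where q: "p = [:- z, 1:] * q" by (auto simp: poly_eq_0_iff_dvd)
  have "q \<noteq> 0" using p(1) q by auto
  have "degree p = degree q + 1" unfolding q using \<open>q \<noteq> 0\<close> by (subst degree_mult_eq) auto
  then have "ev q \<noteq> 0" using min[of q] \<open>q \<noteq> 0\<close> by force
  moreover have "p = smult (- z) q + pCons 0 q" using q by simp
  then have "ev p = (- z) *\<^sub>C ev q + L (ev q)" by (simp only: ev_add ev_smult evp) simp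
  then have "L (ev q) = z *\<^sub>C ev q" using p(2) by (simp add: complex_vector.scale_minus_left)
  ultimately show ?thesis using evV by blast
qed


section \<open>C*-algebras\<close>

lemma cstar_subalgebraD:
  assumes "cstar_subalgebra S A"
  shows "T \<in> A \<Longrightarrow> T \<in> bounded_ops S S" "(\<lambda>x. 0) \<in> A"
    "T \<in> A \<Longrightarrow> T' \<in> A \<Longrightarrow> (\<lambda>x. T x + T' x) \<in> A" "T \<in> A \<Longrightarrow> (\<lambda>x. c *\<^sub>C T x) \<in> A"
    "T \<in> A \<Longrightarrow> T' \<in> A \<Longrightarrow> T \<circ> T' \<in> A" "T \<in> A \<Longrightarrow> adjoint_op S S T \<in> A"
  using assms unfolding cstar_subalgebra_def by auto

lemma cstar_subalgebra_diff:
  assumes "cstar_subalgebra S A" "T \<in> A" "T' \<in> A"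
  shows "(\<lambda>x. T x - T' x) \<in> A"
  using cstar_subalgebraD(3)[OF assms(1,2) cstar_subalgebraD(4)[OF assms(1,3), of "-1"]]
  by (simp add: complex_vector.scale_minus_left)

lemma cstar_subalgebra_sum:
  assumes "cstar_subalgebra S A" "\<And>i. i \<in> I \<Longrightarrow> T i \<in> A"
  shows "(\<lambda>x. \<Sum>i\<in>I. T i x) \<in> A"
  using assms(2)
  by (induction I rule: infinite_finite_induct) (auto intro: cstar_subalgebraD[OF assms(1)])

text \<open>A bound vector by vector, with constants tending to 0, squeezes the operator norms;
  applications then need no suprema.\<close>

lemma cstar_subalgebra_limit:
  assumes A: "cstar_subalgebra S A" and S: "closed_csubspace S" and T: "T \<in> bounded_ops S S"
    and X: "\<And>m. X m \<in> A" and c: "\<And>m. c m \<ge> 0" "c \<longlonglongrightarrow> 0"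
    and le: "\<And>m x. x \<in> S \<Longrightarrow> norm (X m x - T x) \<le> c m * norm x"
  shows "T \<in> A"
proof -
  have "(\<lambda>m. op_norm S (\<lambda>x. X m x - T x)) \<longlonglongrightarrow> 0"
  proof (rule tendsto_sandwich[OF _ _ tendsto_const c(2)])
    show "\<forall>\<^sub>F m in sequentially. 0 \<le> op_norm S (\<lambda>x. X m x - T x)"
      by (intro always_eventually allI op_norm_nonneg[OF S bounded_ops_diff[OF _ T S]]
          cstar_subalgebraD(1)[OF A X])
    show "\<forall>\<^sub>F m in sequentially. op_norm S (\<lambda>x. X m x - T x) \<le> c m"
      by (intro always_eventually allI op_norm_le[OF S c(1) le])
  qed
  then show ?thesis using A T X unfolding cstar_subalgebra_def by blast
qed

text \<open>The closure condition may be checked against explicit bounds, since the operator norms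
  of the differences are themselves such bounds.\<close>

lemma cstar_subalgebraI:
  assumes S: "closed_csubspace S"
    and "\<And>T. T \<in> A \<Longrightarrow> T \<in> bounded_ops S S" "(\<lambda>x. 0) \<in> A"
    "\<And>T T'. T \<in> A \<Longrightarrow> T' \<in> A \<Longrightarrow> (\<lambda>x. T x + T' x) \<in> A"
    "\<And>T c. T \<in> A \<Longrightarrow> (\<lambda>x. c *\<^sub>C T x) \<in> A"
    "\<And>T T'. T \<in> A \<Longrightarrow> T' \<in> A \<Longrightarrow> T \<circ> T' \<in> A" "\<And>T. T \<in> A \<Longrightarrow> adjoint_op S S T \<in> A"
    and lim: "\<And>X T c. T \<in> bounded_ops S S \<Longrightarrow> (\<And>m::nat. X m \<in> A) \<Longrightarrow> (\<And>m. c m \<ge> 0) \<Longrightarrow>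
      c \<longlonglongrightarrow> 0 \<Longrightarrow> (\<And>m x. x \<in> S \<Longrightarrow> norm (X m x - T x) \<le> c m * norm x) \<Longrightarrow> T \<in> A"
  shows "cstar_subalgebra S A"
  unfolding cstar_subalgebra_def
proof (intro conjI allI ballI impI subsetI)
  fix X :: "nat \<Rightarrow> 'a \<Rightarrow> 'a" and T
  assume T: "T \<in> bounded_ops S S" and X: "\<forall>m. X m \<in> A"
    and l: "(\<lambda>m. op_norm S (\<lambda>x. X m x - T x)) \<longlonglongrightarrow> 0"
  have b: "(\<lambda>x. X m x - T x) \<in> bounded_ops S S" for m
    by (intro bounded_ops_diff[OF _ T S] assms(2)) (use X in auto)
  show "T \<in> A"
    by (rule lim[OF T _ op_norm_nonneg[OF S b] l op_norm_bound[OF S b]]) (use X in auto)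
qed (use assms in auto)

lemma bounded_ops_cstar_subalgebra:
  fixes S :: "'a::complex_hilbert set"
  assumes S: "closed_csubspace S"
  shows "cstar_subalgebra S (bounded_ops S S)"
  by (rule cstar_subalgebraI[OF S]) (auto intro: S bounded_ops_zero bounded_ops_add
      bounded_ops_scaleC bounded_ops_comp adjoint_op_bounded)

lemma cstar_generated_subalgebra:
  fixes S :: "'a::complex_hilbert set"
  assumes S: "closed_csubspace S" and G: "G \<subseteq> bounded_ops S S"
  shows "cstar_subalgebra S (cstar_generated S G)"
  unfolding cstar_generated_def
proof (rule cstar_subalgebraI[OF S])
  \<comment> \<open>The algebra of all bounded operators is among those intersected, so the family
    is not empty.\<close>
  show "T \<in> bounded_ops S S" if "T \<in> \<Inter>{A. cstar_subalgebra S A \<and> G \<subseteq> A}" for T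
    using that bounded_ops_cstar_subalgebra[OF S] G by blast
  fix X :: "nat \<Rightarrow> 'a \<Rightarrow> 'a" and T and c :: "nat \<Rightarrow> real"
  assume T: "T \<in> bounded_ops S S" and X: "\<And>m. X m \<in> \<Inter>{A. cstar_subalgebra S A \<and> G \<subseteq> A}"
    and c: "\<And>m. c m \<ge> 0" "c \<longlonglongrightarrow> 0" "\<And>m x. x \<in> S \<Longrightarrow> norm (X m x - T x) \<le> c m * norm x"
  show "T \<in> \<Inter>{A. cstar_subalgebra S A \<and> G \<subseteq> A}"
  proof (rule InterI)
    fix A assume A: "A \<in> {A. cstar_subalgebra S A \<and> G \<subseteq> A}"
    then show "T \<in> A" using X by (intro cstar_subalgebra_limit[OF _ S T _ c]) auto
  qed
qed (auto intro: cstar_subalgebraD)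

lemma cstar_generated_base: "g \<in> G \<Longrightarrow> g \<in> cstar_generated S G"
  unfolding cstar_generated_def by blast

lemma cstar_generated_least: "cstar_subalgebra S A \<Longrightarrow> G \<subseteq> A \<Longrightarrow> cstar_generated S G \<subseteq> A"
  unfolding cstar_generated_def by blast


section \<open>Finite rank operators in irreducible C*-algebras\<close>

definition rank_one :: "'a::complex_inner set \<Rightarrow> 'a \<Rightarrow> 'a \<Rightarrow> 'a \<Rightarrow> 'a" where
  "rank_one S u v = restrict_op S (\<lambda>x. cinner x v *\<^sub>C u)"

lemma rank_one_bounded:
  assumes S: "closed_csubspace S" and "u \<in> S"
  shows "rank_one S u v \<in> bounded_ops S S"
proof (rule bounded_opsI[where M = "norm v * norm u"])
  fix x
  have "cmod (cinner x v) * norm u \<le> norm x * norm v * norm u"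
    by (intro mult_right_mono cmod_cinner_le) auto
  then show "norm (rank_one S u v x) \<le> norm v * norm u * norm x"
    by (simp add: rank_one_def restrict_op_def norm_scaleC mult.commute mult.left_commute)
qed (auto simp: rank_one_def restrict_op_def closed_csubspaceD[OF S] assms cinner_simps
    scaleC_add_left scaleC_scaleC)

text \<open>Closedness reduces the question for which \<open>u\<close> the operator lies in
  \<open>A\<close> to an orthogonality test.\<close>

lemma closed_csubspace_rank_one_left:
  assumes S: "closed_csubspace S" and A: "cstar_subalgebra S A"
  shows "closed_csubspace {u \<in> S. rank_one S u v \<in> A}"
  unfolding closed_csubspace_def
proof
  have eq: "rank_one S (u + w) v = (\<lambda>x. rank_one S u v x + rank_one S w v x)"
    "rank_one S (c *\<^sub>C u) v = (\<lambda>x. c *\<^sub>C rank_one S u v x)" "rank_one S 0 v = (\<lambda>x. 0)" for u w c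
    by (auto simp: rank_one_def restrict_op_def scaleC_add_right scaleC_scaleC mult.commute)
  show "complex_vector.subspace {u \<in> S. rank_one S u v \<in> A}"
    unfolding complex_vector.subspace_def
    by (auto simp: closed_csubspaceD[OF S] eq intro: cstar_subalgebraD[OF A])
  show "closed {u \<in> S. rank_one S u v \<in> A}"
    unfolding closed_sequential_limits
  proof (intro allI impI, elim conjE)
    fix u l assume u: "\<forall>n. u n \<in> {u \<in> S. rank_one S u v \<in> A}" "u \<longlonglongrightarrow> l"
    have l: "l \<in> S"
      using u by (intro closed_sequentially[OF closed_csubspaceD(6)[OF S] _ u(2)]) auto
    have "(\<lambda>n. norm v * norm (u n - l)) \<longlonglongrightarrow> norm v * norm (l - l)" by (intro tendsto_intros u)
    then have c: "(\<lambda>n. norm v * norm (u n - l)) \<longlonglongrightarrow> 0" by simp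
    have "rank_one S l v \<in> A"
    proof (rule cstar_subalgebra_limit[OF A S rank_one_bounded[OF S l] _ _ c])
      fix n x assume x: "x \<in> S"
      have "rank_one S (u n) v x - rank_one S l v x = cinner x v *\<^sub>C (u n - l)"
        using x by (simp add: rank_one_def restrict_op_def complex_vector.scale_right_diff_distrib)
      then show "norm (rank_one S (u n) v x - rank_one S l v x) \<le> norm v * norm (u n - l) * norm x"
        using mult_right_mono[OF cmod_cinner_le[of x v], of "norm (u n - l)"]
        by (simp add: norm_scaleC mult.commute mult.left_commute)
    qed (use u in auto)
    with l show "l \<in> {u \<in> S. rank_one S u v \<in> A}" by simp
  qed
qed

lemma closed_csubspace_rank_one_right:
  assumes S: "closed_csubspace S" and A: "cstar_subalgebra S A" and u: "u \<in> S"
  shows "closed_csubspace {v \<in> S. rank_one S u v \<in> A}"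
  unfolding closed_csubspace_def
proof
  have eq: "rank_one S u (v + w) = (\<lambda>x. rank_one S u v x + rank_one S u w x)"
    "rank_one S u (c *\<^sub>C v) = (\<lambda>x. cnj c *\<^sub>C rank_one S u v x)" "rank_one S u 0 = (\<lambda>x. 0)" for v w c
    by (auto simp: rank_one_def restrict_op_def cinner_simps scaleC_add_left scaleC_scaleC)
  show "complex_vector.subspace {v \<in> S. rank_one S u v \<in> A}"
    unfolding complex_vector.subspace_def
    by (auto simp: closed_csubspaceD[OF S] eq intro: cstar_subalgebraD[OF A])
  show "closed {v \<in> S. rank_one S u v \<in> A}"
    unfolding closed_sequential_limits
  proof (intro allI impI, elim conjE)
    fix v l assume v: "\<forall>n. v n \<in> {v \<in> S. rank_one S u v \<in> A}" "v \<longlonglongrightarrow> l"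
    have l: "l \<in> S"
      using v by (intro closed_sequentially[OF closed_csubspaceD(6)[OF S] _ v(2)]) auto
    have "(\<lambda>n. norm u * norm (v n - l)) \<longlonglongrightarrow> norm u * norm (l - l)" by (intro tendsto_intros v)
    then have c: "(\<lambda>n. norm u * norm (v n - l)) \<longlonglongrightarrow> 0" by simp
    have "rank_one S u l \<in> A"
    proof (rule cstar_subalgebra_limit[OF A S rank_one_bounded[OF S u] _ _ c])
      fix n x assume x: "x \<in> S"
      have "rank_one S u (v n) x - rank_one S u l x = cinner x (v n - l) *\<^sub>C u"
        using x by (simp add: rank_one_def restrict_op_def cinner_simps
            complex_vector.scale_left_diff_distrib)
      then show "norm (rank_one S u (v n) x - rank_one S u l x) \<le> norm u * norm (v n - l) * norm x"
        using mult_right_mono[OF cmod_cinner_le[of x "v n - l"], of "norm u"]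
        by (simp add: norm_scaleC mult.commute mult.left_commute)
    qed (use v in auto)
    with l show "l \<in> {v \<in> S. rank_one S u v \<in> A}" by simp
  qed
qed

text \<open>
  An operator \<open>T\<close> of minimal nonzero rank satisfies \<open>T B T = \<lambda> T\<close> for every \<open>B\<close> in the
  algebra, since for an eigenvalue \<open>\<lambda>\<close> of \<open>T B\<close> on the range of \<open>T\<close> the difference has
  smaller rank.  As every nonzero vector is cyclic, \<open>T\<close> then has rank one.
\<close>

lemma rank_one_in_irreducible:
  fixes S :: "'a::complex_hilbert set"
  assumes S: "closed_csubspace S" and A: "cstar_subalgebra S A"
    and cyclic: "\<And>x g. x \<in> S \<Longrightarrow> x \<noteq> 0 \<Longrightarrow> g \<in> S \<Longrightarrow> (\<And>B. B \<in> A \<Longrightarrow> cinner (B x) g = 0) \<Longrightarrow> g = 0"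
    and T0: "T0 \<in> A" "T0 \<noteq> (\<lambda>x. 0)" "finite F0" "range T0 \<subseteq> complex_vector.span F0"
    and u: "u \<in> S" and v: "v \<in> S"
  shows "rank_one S u v \<in> A"
proof -
  note S' = closed_csubspaceD[OF S] and A' = cstar_subalgebraD[OF A]
  define R where "R n \<longleftrightarrow> (\<exists>T\<in>A. T \<noteq> (\<lambda>x. 0) \<and>
    (\<exists>F. finite F \<and> card F \<le> n \<and> range T \<subseteq> complex_vector.span F))" for n
  have "R (card F0)" unfolding R_def using T0 by blast
  then obtain r where r: "R r" "\<And>n. R n \<Longrightarrow> r \<le> n"
    using ex_has_least_nat[of R _ "\<lambda>n. n"] by blast
  then obtain T F where T: "T \<in> A" "T \<noteq> (\<lambda>x. 0)"
    and F: "finite F" "card F \<le> r" "range T \<subseteq> complex_vector.span F"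
    unfolding R_def by blast
  have Tb: "T \<in> bounded_ops S S" by (rule A'(1)[OF T(1)])
  note Tb' = bounded_opsD[OF Tb]
  define V where "V = T ` S"
  have TV: "T x \<in> V" for x
    using Tb'(2)[of x] bounded_ops_0[OF Tb] S'(1) unfolding V_def by (cases "x \<in> S") (auto intro: rev_image_eqI)
  have VS: "V \<subseteq> S" using Tb'(1) by (auto simp: V_def)
  have Vsub: "complex_vector.subspace V"
    unfolding complex_vector.subspace_def V_def
    using S' Tb' bounded_ops_0[OF Tb] by (auto simp: image_iff) metis+
  have VF: "V \<subseteq> complex_vector.span F" using F(3) by (auto simp: V_def)
  obtain x1 where x1: "T x1 \<noteq> 0" using T(2) by auto
  have x1S: "x1 \<in> S" using x1 Tb'(2) by blast
  have scalar: "\<exists>c. \<forall>x. T (B (T x)) = c *\<^sub>C T x" if B: "B \<in> A" for B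
  proof -
    note Bb' = bounded_opsD[OF A'(1)[OF B]]
    define L where "L x = T (B x)" for x
    have Ladd: "L (x + y) = L x + L y" if "x \<in> S" "y \<in> S" for x y
      using that by (simp add: L_def Bb' Tb')
    have Lscale: "L (c *\<^sub>C x) = c *\<^sub>C L x" if "x \<in> S" for x c
      using that by (simp add: L_def Bb' Tb')
    obtain c w where w: "w \<in> V" "w \<noteq> 0" "L w = c *\<^sub>C w"
      using ex_eigenvector[OF Vsub F(1) VF TV x1, of L] TV Ladd Lscale VS
      by (auto simp: L_def subset_eq)
    define L' where "L' x = L x - c *\<^sub>C x" for x
    have L'add: "L' (x + y) = L' x + L' y" if "x \<in> V" "y \<in> V" for x y
      using that VS by (auto simp: L'_def Ladd subset_eq scaleC_add_right)
    have L'scale: "L' (a *\<^sub>C x) = a *\<^sub>C L' x" if "x \<in> V" for a x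
      using that VS by (auto simp: L'_def Lscale subset_eq complex_vector.scale_right_diff_distrib
          scaleC_scaleC mult.commute)
    have "complex_vector.independent {w}" using w by simp
    then obtain W where W: "{w} \<subseteq> W" "W \<subseteq> V" "complex_vector.independent W"
      "V \<subseteq> complex_vector.span W"
      using complex_vector.maximal_independent_subset_extend[of "{w}" V] w by auto
    have fW: "finite W" "card W \<le> card F"
      using complex_vector.independent_span_bound[OF F(1) W(3)] W(2) VF by auto
    \<comment> \<open>\<open>w\<close> lies in the kernel of \<open>L'\<close>, so in a basis of
      \<open>V\<close> containing \<open>w\<close> the remaining vectors already produce the range
      of \<open>L'\<close>. This is the drop in rank.\<close>
    have rng: "L' x \<in> complex_vector.span (L' ` (W - {w}))" if "x \<in> V" for x
    proof -
      have "x \<in> complex_vector.span W" using that W by auto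
      then obtain k where k: "x - k *\<^sub>C w \<in> complex_vector.span (W - {w})"
        using complex_vector.span_breakdown[of w W x] W(1) by auto
      have kV: "x - k *\<^sub>C w \<in> V" "k *\<^sub>C w \<in> V"
        using that w Vsub by (auto intro: complex_vector.subspace_diff complex_vector.subspace_scale)
      have "L' x = L' ((x - k *\<^sub>C w) + k *\<^sub>C w)" by simp
      also have "\<dots> = L' (x - k *\<^sub>C w) + L' (k *\<^sub>C w)" by (rule L'add[OF kV])
      also have "L' (k *\<^sub>C w) = 0" using w by (simp add: L'scale) (simp add: L'_def)
      finally have "L' x = L' (x - k *\<^sub>C w)" by simp
      moreover have "L' (x - k *\<^sub>C w) \<in> complex_vector.span (L' ` (W - {w}))"
        by (rule linear_on_span[OF Vsub _ L'add L'scale k]) (use W in auto)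
      ultimately show ?thesis by simp
    qed
    define T' where "T' = (\<lambda>x. L' (T x))"
    have "(T \<circ> (B \<circ> T)) \<in> A" by (intro A' T B)
    from cstar_subalgebra_diff[OF A this A'(4)[OF T(1), of c]]
    have T'A: "T' \<in> A" by (simp add: T'_def L'_def L_def)
    have "T' = (\<lambda>x. 0)"
    proof (rule ccontr)
      assume nz: "T' \<noteq> (\<lambda>x. 0)"
      have "range T' \<subseteq> complex_vector.span (L' ` (W - {w}))" using rng TV by (auto simp: T'_def)
      then have "R (card (L' ` (W - {w})))" unfolding R_def
        by (intro bexI[OF _ T'A] conjI nz exI[of _ "L' ` (W - {w})"]) (use fW in auto)
      then have "r \<le> card (L' ` (W - {w}))" by (rule r)
      also have "\<dots> \<le> card (W - {w})" using fW by (intro card_image_le) auto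
      also have "\<dots> < card W" using fW W by (intro card_Diff1_less) auto
      also have "\<dots> \<le> r" using fW F by simp
      finally show False by simp
    qed
    then have "L' (T x) = 0" for x unfolding T'_def by metis
    then show ?thesis by (auto simp: L'_def L_def)
  qed
  define x where "x = T x1"
  have x: "x \<in> S" "x \<noteq> 0" using x1 x1S Tb' by (auto simp: x_def)
  define T' where "T' = adjoint_op S S T"
  have T'b: "T' \<in> bounded_ops S S" unfolding T'_def by (rule adjoint_op_bounded[OF S S Tb])
  note adj = cinner_adjoint[OF S S Tb, folded T'_def]
  \<comment> \<open>If \<open>w\<close> is orthogonal to \<open>x\<close>, then \<open>T' w\<close>
    is orthogonal to every \<open>B x\<close>, because \<open>T (B x)\<close> is a multiple of
    \<open>x\<close>; cyclicity gives \<open>T' w = 0\<close>. For the part of \<open>T y\<close>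
    orthogonal to \<open>x\<close> this means that it vanishes.\<close>
  have line: "T y = (cinner (T y) x / (norm x)\<^sup>2) *\<^sub>C x" if y: "y \<in> S" for y
  proof -
    define w where "w = T y - (cinner (T y) x / (norm x)\<^sup>2) *\<^sub>C x"
    have w: "w \<in> S" unfolding w_def by (intro S' Tb' x y)
    have wx: "cinner w x = 0" using x by (simp add: w_def cinner_simps cinner_self)
    then have xw: "cinner x w = 0" by (simp add: cinner_eq_zero_commute)
    have "T' w = 0"
    proof (rule cyclic[OF x])
      show "T' w \<in> S" by (rule bounded_opsD(1)[OF T'b w])
      fix B assume B: "B \<in> A"
      then obtain c where c: "\<And>x. T (B (T x)) = c *\<^sub>C T x" using scalar by blast
      have "cinner (B x) (T' w) = cinner (T (B x)) w"
        by (rule adj[symmetric]) (auto intro: w x bounded_opsD[OF A'(1)[OF B]])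
      also have "\<dots> = 0" using xw by (simp add: x_def c cinner_simps)
      finally show "cinner (B x) (T' w) = 0" .
    qed
    then have "cinner (T y) w = 0" by (simp add: adj[OF y w])
    then have "cinner (T y - (cinner (T y) x / (norm x)\<^sup>2) *\<^sub>C x) w = 0"
      using xw by (simp add: cinner_diff_left cinner_scaleC_left)
    then have "cinner w w = 0" by (simp only: w_def[symmetric])
    then show ?thesis by (simp add: w_def)
  qed
  define a where "a = (1 / complex_of_real ((norm x)\<^sup>2)) *\<^sub>C T' x"
  have aS: "a \<in> S" unfolding a_def by (intro S' bounded_opsD(1)[OF T'b] x)
  have Ta: "T = rank_one S x a"
  proof
    fix y
    show "T y = rank_one S x a y"
    proof (cases "y \<in> S")
      case True
      have "cinner y a = cinner (T y) x / (norm x)\<^sup>2"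
        by (simp add: a_def cinner_simps adj[OF True x(1)])
      then show ?thesis using line[OF True] True by (simp add: rank_one_def restrict_op_def)
    qed (simp add: Tb' rank_one_def restrict_op_def)
  qed
  have a0: "a \<noteq> 0" using T(2) by (auto simp: Ta rank_one_def restrict_op_def)
  \<comment> \<open>The first vector of a rank one operator is moved by composing with
    \<open>B\<close> on the left, the second by composing with the adjoint of \<open>B\<close> on
    the right. Cyclicity of \<open>x\<close> and of \<open>a\<close> then reaches all pairs.\<close>
  have left: "{w \<in> S. rank_one S w a \<in> A} = S"
  proof (rule closed_csubspace_eqI[OF closed_csubspace_rank_one_left[OF S A] S])
    fix g assume g: "g \<in> S" "\<And>w. w \<in> {w \<in> S. rank_one S w a \<in> A} \<Longrightarrow> cinner w g = 0"
    show "g = 0"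
    proof (rule cyclic[OF x g(1)])
      fix B assume B: "B \<in> A"
      note Bb = A'(1)[OF B]
      have "B \<circ> T = rank_one S (B x) a"
        by (rule ext) (simp add: Ta rank_one_def restrict_op_def bounded_opsD[OF Bb] x bounded_ops_0[OF Bb])
      then have "rank_one S (B x) a \<in> A" using A'(5)[OF B T(1)] by simp
      then show "cinner (B x) g = 0" by (intro g(2)) (simp add: bounded_opsD[OF Bb] x)
    qed
  qed auto
  then have ua: "rank_one S u a \<in> A" using u by blast
  have "{w \<in> S. rank_one S u w \<in> A} = S"
  proof (rule closed_csubspace_eqI[OF closed_csubspace_rank_one_right[OF S A u] S])
    fix g assume g: "g \<in> S" "\<And>w. w \<in> {w \<in> S. rank_one S u w \<in> A} \<Longrightarrow> cinner w g = 0"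
    show "g = 0"
    proof (rule cyclic[OF aS a0 g(1)])
      fix B assume B: "B \<in> A"
      note Bb = A'(1)[OF B]
      note B'b = adjoint_op_bounded[OF S S Bb]
      have "rank_one S u a \<circ> adjoint_op S S B = rank_one S u (B a)"
        by (rule ext) (auto simp: rank_one_def restrict_op_def bounded_opsD[OF B'b]
            cinner_adjoint'[OF S S Bb aS] )
      then have "rank_one S u (B a) \<in> A" using A'(5)[OF ua A'(6)[OF B]] by simp
      then show "cinner (B a) g = 0" by (intro g(2)) (simp add: bounded_opsD[OF Bb] aS)
    qed
  qed auto
  then show ?thesis using v by blast
qed

lemma finite_rank_in_cstar_subalgebra:
  fixes S :: "'a::complex_hilbert set"
  assumes S: "closed_csubspace S" and A: "cstar_subalgebra S A"
    and rank_one: "\<And>u v. u \<in> S \<Longrightarrow> v \<in> S \<Longrightarrow> rank_one S u v \<in> A"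
    and T: "T \<in> bounded_ops S S" and F: "finite F" "T ` S \<subseteq> complex_vector.span F"
  shows "T \<in> A"
proof -
  note T' = bounded_opsD[OF T]
  \<comment> \<open>The spanning set \<open>F\<close> may lie outside \<open>S\<close>. Projecting
    it first gives an orthonormal \<open>E\<close> within \<open>S\<close>, along which
    \<open>T\<close> splits into rank one operators of \<open>S\<close>.\<close>
  obtain E where E: "finite E" "complex_vector.span E = complex_vector.span (proj S ` F)"
    "\<And>e e'. e \<in> E \<Longrightarrow> e' \<in> E \<Longrightarrow> cinner e e' = (if e = e' then 1 else 0)"
    using gram_schmidt[of "proj S ` F"] F by blast
  have "complex_vector.span (proj S ` F) \<subseteq> S"
    by (rule complex_vector.span_minimal) (auto simp: proj_in S closed_csubspaceD[OF S])
  then have ES: "E \<subseteq> S" using E(2) complex_vector.span_superset by blast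
  let ?T' = "adjoint_op S S T"
  have "T = (\<lambda>x. \<Sum>e\<in>E. rank_one S e (?T' e) x)"
  proof
    fix x
    show "T x = (\<Sum>e\<in>E. rank_one S e (?T' e) x)"
    proof (cases "x \<in> S")
      case True
      have "T x = proj S (T x)" by (simp add: proj_ident S T' True)
      also have "\<dots> \<in> complex_vector.span (proj S ` F)"
        by (rule linear_on_span[of UNIV])
          (use F True in \<open>auto simp: proj_add proj_scaleC S\<close>)
      finally have "T x = (\<Sum>e\<in>E. cinner (T x) e *\<^sub>C e)"
        using orthonormal_expansion[OF E(1,3)] E(2) by auto
      also have "\<dots> = (\<Sum>e\<in>E. rank_one S e (?T' e) x)"
        using True ES by (intro sum.cong) (auto simp: rank_one_def restrict_op_def
            cinner_adjoint[OF S S T True])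
      finally show ?thesis .
    qed (simp add: T' rank_one_def restrict_op_def)
  qed
  also have "\<dots> \<in> A"
    by (intro cstar_subalgebra_sum[OF A] rank_one)
      (use ES in \<open>auto intro: bounded_opsD[OF adjoint_op_bounded[OF S S T]]\<close>)
  finally show ?thesis .
qed

section \<open>Coordinate multiplications on the Hardy space\<close>

definition hardy_monom :: "('n::finite \<Rightarrow> nat) \<Rightarrow> 'n hardy" where
  "hardy_monom k = (SOME f. hardy_coeff f = (\<lambda>l. if l = k then 1 else 0))"

lemma hardy_coeff_monom: "hardy_coeff (hardy_monom k) l = (if l = k then 1 else 0)"
proof -
  have "square_summable (\<lambda>l. if l = k then 1 else 0 :: complex)"
    unfolding square_summable_def
    by (rule summable_on_cong_neutral[THEN iffD1, OF _ _ _ summable_on_finite[of "{k}"]]) auto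
  then obtain f where f: "hardy_coeff f = (\<lambda>l. if l = k then 1 else 0)" by (rule hardy_coeff_surj)
  have "hardy_coeff (hardy_monom k) = (\<lambda>l. if l = k then 1 else 0)"
    unfolding hardy_monom_def by (rule someI[of _ f]) (rule f)
  then show ?thesis by simp
qed

lemma cinner_hardy_monom: "cinner f (hardy_monom k) = hardy_coeff f k"
proof -
  have "cinner f (hardy_monom k) = (\<Sum>\<^sub>\<infinity>l\<in>{k}. hardy_coeff f k)"
    unfolding cinner_hardy_def by (rule infsum_cong_neutral) (auto simp: hardy_coeff_monom)
  then show ?thesis by simp
qed

lemma hardy_monom_dense:
  fixes N :: "('n::finite) hardy set"
  assumes N: "closed_csubspace N" and "\<And>k. hardy_monom k \<in> N"
  shows "N = UNIV"
proof (rule closed_csubspace_eqI[OF N closed_csubspace_UNIV])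
  fix g :: "'n hardy" assume g: "\<And>x. x \<in> N \<Longrightarrow> cinner x g = 0"
  have "cinner g (hardy_monom k) = 0" for k using g[OF assms(2)] cinner_eq_zero_commute by blast
  then show "g = 0"
    by (intro hardy_coeff_eqI) (simp add: cinner_hardy_monom hardy_coeff_simps)
qed auto

text \<open>Relabelling monomials along an injection is isometric; off the range a single vanishing
  factor removes each term of the sum.\<close>

lemma cinner_hardy_reindex:
  fixes f g f' g' :: "('n::finite) hardy"
  assumes s: "inj s" and "\<And>k. hardy_coeff f' (s k) = hardy_coeff f k"
    and "\<And>k. hardy_coeff g' (s k) = hardy_coeff g k"
    and "\<And>l. l \<notin> range s \<Longrightarrow> hardy_coeff f' l = 0"
  shows "cinner f' g' = cinner f g"
proof -
  have "cinner f' g' = (\<Sum>\<^sub>\<infinity>l\<in>range s. hardy_coeff f' l * cnj (hardy_coeff g' l))"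
    unfolding cinner_hardy_def by (rule infsum_cong_neutral) (use assms(4) in auto)
  also have "\<dots> = cinner f g"
    unfolding cinner_hardy_def by (subst infsum_reindex[OF s]) (simp add: o_def assms)
  finally show ?thesis .
qed

lemma inj_fun_upd_Suc: "inj (\<lambda>k :: 'n \<Rightarrow> nat. k(i := Suc (k i)))"
  by (rule injI) (metis fun_upd_same fun_upd_triv fun_upd_upd nat.inject)

lemma range_fun_upd_Suc: "range (\<lambda>k :: 'n \<Rightarrow> nat. k(i := Suc (k i))) = {k. k i \<noteq> 0}"
proof (intro equalityI subsetI)
  fix k :: "'n \<Rightarrow> nat" assume "k \<in> {k. k i \<noteq> 0}"
  then show "k \<in> range (\<lambda>k. k(i := Suc (k i)))"
    by (intro image_eqI[of _ _ "k(i := k i - 1)"]) auto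
qed auto

lemma hardy_coeff_coord_mult:
  "hardy_coeff (coord_mult i f) k = (if k i = 0 then 0 else hardy_coeff f (k(i := k i - 1)))"
proof -
  let ?a = "hardy_coeff f" and ?h = "\<lambda>k. k(i := Suc (k i))"
  define b where "b k = (if k i = 0 then 0 else ?a (k(i := k i - 1)))" for k
  have bh: "b (?h k) = ?a k" for k by (simp add: b_def)
  have b0: "b k = 0" if "k \<notin> range ?h" for k using that by (auto simp: b_def range_fun_upd_Suc)
  have a: "hardy_expansion ?a (hardy_fun f)" by (rule hardy_expansion_hardy_coeff)
  have "(\<lambda>k. (cmod (b k))\<^sup>2) summable_on range ?h"
    using a by (subst summable_on_reindex[OF inj_fun_upd_Suc])
      (simp add: o_def bh hardy_expansion_def square_summable_def)
  then have "square_summable b"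
    unfolding square_summable_def
    by (rule summable_on_cong_neutral[THEN iffD1, rotated -1]) (auto simp: b0)
  moreover have "((\<lambda>k. b k * mpow z k) has_sum (z $ i * hardy_fun f z)) UNIV" if "z \<in> polydisc" for z
  proof -
    have mp: "mpow z (?h k) = z $ i * mpow z k" for k
    proof -
      have "(\<Prod>j\<in>UNIV - {i}. (z $ j) ^ (?h k) j) = (\<Prod>j\<in>UNIV - {i}. (z $ j) ^ k j)"
        by (rule prod.cong) auto
      then show ?thesis unfolding mpow_def by (simp add: prod.remove[of UNIV i])
    qed
    have "((\<lambda>k. ?a k * mpow z k) has_sum hardy_fun f z) UNIV"
      using a that by (auto simp: hardy_expansion_def)
    then have "((\<lambda>k. z $ i * (?a k * mpow z k)) has_sum (z $ i * hardy_fun f z)) UNIV"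
      by (rule has_sum_cmult_right)
    then have "((\<lambda>k. b k * mpow z k) has_sum (z $ i * hardy_fun f z)) (range ?h)"
      by (subst has_sum_reindex[OF inj_fun_upd_Suc]) (simp add: o_def bh mp algebra_simps)
    then show ?thesis
      by (rule has_sum_cong_neutral[THEN iffD1, rotated -1]) (auto simp: b0)
  qed
  moreover have "z $ i * hardy_fun f z = 0" if "z \<notin> polydisc" for z
    using a that by (simp add: hardy_expansion_def)
  ultimately have "hardy_expansion b (\<lambda>z. z $ i * hardy_fun f z)"
    unfolding hardy_expansion_def by blast
  then have "hardy_coeff (coord_mult i f) = b" unfolding coord_mult_def by (rule hardy_coeff_Abs)
  then show ?thesis by (simp add: b_def)
qed

lemma coord_mult_add: "coord_mult i (f + g) = coord_mult i f + coord_mult i g"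
  by (rule hardy_coeff_eqI) (simp add: hardy_coeff_coord_mult hardy_coeff_simps)

lemma coord_mult_diff: "coord_mult i (f - g) = coord_mult i f - coord_mult i g"
  by (rule hardy_coeff_eqI) (simp add: hardy_coeff_coord_mult hardy_coeff_simps)

lemma coord_mult_scaleC: "coord_mult i (c *\<^sub>C f) = c *\<^sub>C coord_mult i f"
  by (rule hardy_coeff_eqI) (simp add: hardy_coeff_coord_mult hardy_coeff_simps)

lemma coord_mult_monom: "coord_mult i (hardy_monom k) = hardy_monom (k(i := Suc (k i)))"
proof (rule hardy_coeff_eqI)
  fix l
  show "hardy_coeff (coord_mult i (hardy_monom k)) l = hardy_coeff (hardy_monom (k(i := Suc (k i)))) l"
    by (auto simp: hardy_coeff_coord_mult hardy_coeff_monom fun_eq_iff)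
qed

lemma cinner_coord_mult: "cinner (coord_mult i f) (coord_mult i g) = cinner f g"
  by (rule cinner_hardy_reindex[OF inj_fun_upd_Suc[of i]])
    (auto simp: range_fun_upd_Suc hardy_coeff_coord_mult)

lemma norm_coord_mult: "norm (coord_mult i f) = norm f"
proof -
  have "(norm (coord_mult i f))\<^sup>2 = (norm f)\<^sup>2"
    using cinner_coord_mult[of i f f] unfolding cinner_self of_real_eq_iff .
  then show ?thesis by simp
qed

lemma coord_mult_bounded: "coord_mult i \<in> bounded_ops UNIV UNIV"
  by (rule bounded_opsI[where M = 1])
    (auto simp: coord_mult_add coord_mult_scaleC norm_coord_mult)

abbreviation coord_adj :: "'n::finite \<Rightarrow> 'n hardy \<Rightarrow> 'n hardy" where
  "coord_adj i \<equiv> adjoint_op UNIV UNIV (coord_mult i)"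

lemma cinner_coord_adj:
  "cinner (coord_mult i f) g = cinner f (coord_adj i g)"
  "cinner g (coord_mult i f) = cinner (coord_adj i g) f"
  using cinner_adjoint[OF closed_csubspace_UNIV closed_csubspace_UNIV coord_mult_bounded]
    cinner_adjoint'[OF closed_csubspace_UNIV closed_csubspace_UNIV coord_mult_bounded] by auto

text \<open>Backward shift: pairing with a monomial moves the adjoint onto that monomial.\<close>

lemma hardy_coeff_coord_adj: "hardy_coeff (coord_adj i g) k = hardy_coeff g (k(i := Suc (k i)))"
  by (simp add: cinner_hardy_monom[symmetric] cinner_coord_adj(2)[symmetric] coord_mult_monom)

section \<open>Multi-indices and injectivity of multipliers\<close>

lemma multi_index_induct [case_names zero Suc]:
  fixes k :: "'n::finite \<Rightarrow> nat"
  assumes "P (\<lambda>i. 0)" and "\<And>k i. P k \<Longrightarrow> P (k(i := Suc (k i)))"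
  shows "P k"
proof (induction "\<Sum>i\<in>UNIV. k i" arbitrary: k)
  case 0
  then have "k = (\<lambda>i. 0)" by auto
  then show ?case using assms(1) by simp
next
  case (Suc n)
  then obtain i where i: "k i \<noteq> 0" by (metis sum.neutral nat.distinct(1))
  let ?l = "k(i := k i - 1)"
  have "(\<Sum>j\<in>UNIV. k j) = Suc (\<Sum>j\<in>UNIV. ?l j)"
  proof -
    have "(\<Sum>j\<in>UNIV - {i}. ?l j) = (\<Sum>j\<in>UNIV - {i}. k j)" by (rule sum.cong) auto
    then show ?thesis using i by (simp add: sum.remove[of UNIV i])
  qed
  then have "P ?l" using Suc by simp
  from assms(2)[OF this, of i] show ?case using i by simp
qed

text \<open>Distinct primes weight the coordinates. Unique factorization makes the weight injective,
  and values in the naturals give every nonempty set of multi-indices a lightest element.\<close>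

lemma ex_multiplicative_order:
  "\<exists>w :: ('n::finite \<Rightarrow> nat) \<Rightarrow> nat. inj w \<and> (\<forall>k. w k > 0) \<and> (\<forall>k l. w (\<lambda>i. k i + l i) = w k * w l)"
proof -
  obtain B where B: "finite B" "card B = CARD('n)" "B \<subseteq> {q::nat. prime q}"
    using infinite_arbitrarily_large[OF primes_infinite] by metis
  then obtain p :: "'n \<Rightarrow> nat" where "bij_betw p UNIV B"
    using finite_same_card_bij[of "UNIV :: 'n set" B] by auto
  with B have p: "inj p" "\<And>i. prime (p i)" by (auto simp: bij_betw_def)
  define w where "w k = (\<Prod>i\<in>UNIV. p i ^ k i)" for k :: "'n \<Rightarrow> nat"
  have mult: "multiplicity (p i) (w k) = k i" for i k
  proof -
    have "multiplicity (p i) (w k) = (\<Sum>j\<in>UNIV. multiplicity (p i) (p j ^ k j))"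
      unfolding w_def using p
      by (intro prime_elem_multiplicity_prod_distrib) (auto simp: image_iff dest: prime_gt_0_nat[of "p _"])
    also have "\<dots> = (\<Sum>j\<in>UNIV. if j = i then k i else 0)"
    proof (rule sum.cong[OF refl])
      fix j
      show "multiplicity (p i) (p j ^ k j) = (if j = i then k i else 0)"
      proof (cases "j = i")
        case True
        then show ?thesis using p(2)[of i]
          by (simp add: prime_gt_1_nat multiplicity_same_power prime_gt_0_nat)
      next
        case False
        then have "p i \<noteq> p j" using p(1) by (auto dest: injD)
        then show ?thesis using p(2) False by (simp add: multiplicity_distinct_prime_power)
      qed
    qed
    finally show ?thesis by simp
  qed
  have "inj w" by (rule injI) (metis ext mult)
  moreover have "w k > 0" for k using p(2) by (auto simp: w_def prime_gt_0_nat intro!: prod_pos)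
  moreover have "w (\<lambda>i. k i + l i) = w k * w l" for k l
    by (simp add: w_def power_add prod.distrib)
  ultimately show ?thesis by blast
qed

text \<open>
  Such a \<open>W\<close> is multiplication by \<open>W 1\<close>, and lowest monomials with respect to a
  multiplicative order do not cancel in a product.
\<close>

lemma multiplier_injective:
  fixes W :: "('n::finite) hardy \<Rightarrow> 'n hardy"
  assumes W: "W \<in> bounded_ops UNIV UNIV" and comm: "\<And>i h. W (coord_mult i h) = coord_mult i (W h)"
    and W1: "W (hardy_monom (\<lambda>i. 0)) \<noteq> 0" and Wh: "W h = 0"
  shows "h = 0"
proof (rule ccontr)
  assume "h \<noteq> 0"
  define f where "f = W (hardy_monom (\<lambda>i. 0))"
  obtain k1 where k1: "hardy_coeff h k1 \<noteq> 0"
    using \<open>h \<noteq> 0\<close> hardy_coeff_eqI[of h 0] by (auto simp: hardy_coeff_simps)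
  obtain l1 where l1: "hardy_coeff f l1 \<noteq> 0"
    using W1 hardy_coeff_eqI[of f 0] by (auto simp: f_def hardy_coeff_simps)
  obtain w :: "('n \<Rightarrow> nat) \<Rightarrow> nat" where w: "inj w" "\<And>k. w k > 0"
    "\<And>k l. w (\<lambda>i. k i + l i) = w k * w l"
    using ex_multiplicative_order by blast
  obtain k0 where k0: "hardy_coeff h k0 \<noteq> 0" "\<And>k. hardy_coeff h k \<noteq> 0 \<Longrightarrow> w k0 \<le> w k"
    using ex_has_least_nat[of "\<lambda>k. hardy_coeff h k \<noteq> 0" k1 w] k1 by blast
  obtain l0 where l0: "hardy_coeff f l0 \<noteq> 0" "\<And>l. hardy_coeff f l \<noteq> 0 \<Longrightarrow> w l0 \<le> w l"
    using ex_has_least_nat[of "\<lambda>l. hardy_coeff f l \<noteq> 0" l1 w] l1 by blast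
  define m where "m = (\<lambda>i. k0 i + l0 i)"
  have shift: "hardy_coeff (W (hardy_monom k)) m' =
      (if \<forall>i. k i \<le> m' i then hardy_coeff f (\<lambda>i. m' i - k i) else 0)" for k m'
  proof (induction k arbitrary: m' rule: multi_index_induct)
    case zero
    show ?case by (simp add: f_def)
  next
    case (Suc k i)
    have e: "(\<forall>j. (k(i := Suc (k i))) j \<le> m' j) \<longleftrightarrow> m' i \<noteq> 0 \<and> (\<forall>j. k j \<le> (m'(i := m' i - 1)) j)"
    proof -
      have "(\<forall>j. k j \<le> (m'(i := m' i - 1)) j) \<longleftrightarrow> k i \<le> m' i - 1 \<and> (\<forall>j. j \<noteq> i \<longrightarrow> k j \<le> m' j)"
        by auto
      moreover have "(\<forall>j. (k(i := Suc (k i))) j \<le> m' j) \<longleftrightarrow>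
          Suc (k i) \<le> m' i \<and> (\<forall>j. j \<noteq> i \<longrightarrow> k j \<le> m' j)"
        by auto
      ultimately show ?thesis by auto
    qed
    have "hardy_coeff (W (hardy_monom (k(i := Suc (k i))))) m' =
        (if m' i = 0 then 0 else hardy_coeff (W (hardy_monom k)) (m'(i := m' i - 1)))"
      by (simp only: coord_mult_monom[symmetric] comm hardy_coeff_coord_mult)
    also have "\<dots> = (if \<forall>j. (k(i := Suc (k i))) j \<le> m' j
        then hardy_coeff f (\<lambda>j. (m'(i := m' i - 1)) j - k j) else 0)"
      unfolding e Suc by auto
    also have "(\<lambda>j. (m'(i := m' i - 1)) j - k j) = (\<lambda>j. m' j - (k(i := Suc (k i))) j)" by auto
    finally show ?case .
  qed
  note U = closed_csubspace_UNIV
  let ?W' = "adjoint_op UNIV UNIV W"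
  \<comment> \<open>Coefficient \<open>m\<close> of \<open>W h\<close> is the inner product of
    \<open>h\<close> with a fixed vector. Expanding through the adjoint gives a series in the
    coefficients of \<open>h\<close> without interchanging \<open>W\<close> with an infinite
    sum.\<close>
  have adj: "cnj (hardy_coeff (?W' (hardy_monom m)) k) = hardy_coeff (W (hardy_monom k)) m" for k
  proof -
    have "hardy_coeff (W (hardy_monom k)) m = cinner (hardy_monom k) (?W' (hardy_monom m))"
      by (simp add: cinner_hardy_monom[symmetric] cinner_adjoint[OF U U W])
    also have "\<dots> = cnj (hardy_coeff (?W' (hardy_monom m)) k)"
      by (subst cinner_commute) (simp add: cinner_hardy_monom)
    finally show ?thesis ..
  qed
  have "hardy_coeff (W h) m = cinner h (?W' (hardy_monom m))"
    by (simp add: cinner_hardy_monom[symmetric] cinner_adjoint[OF U U W])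
  also have "\<dots> = (\<Sum>\<^sub>\<infinity>k. hardy_coeff h k * hardy_coeff (W (hardy_monom k)) m)"
    unfolding cinner_hardy_def adj ..
  \<comment> \<open>A surviving \<open>k\<close> splits \<open>m\<close> into \<open>k\<close> and
    \<open>m - k\<close> with nonzero coefficients of \<open>h\<close> and \<open>f\<close>, so both
    weights are at least the minimal ones. As the products of the weights agree,
    \<open>k = k0\<close>.\<close>
  also have "\<dots> = (\<Sum>\<^sub>\<infinity>k\<in>{k0}. hardy_coeff h k * hardy_coeff (W (hardy_monom k)) m)"
  proof (rule infsum_cong_neutral)
    fix k assume k: "k \<in> UNIV - {k0}"
    show "hardy_coeff h k * hardy_coeff (W (hardy_monom k)) m = 0"
    proof (rule ccontr)
      assume "\<not> ?thesis"
      then have nz: "hardy_coeff h k \<noteq> 0" "hardy_coeff (W (hardy_monom k)) m \<noteq> 0" by auto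
      then have le: "\<forall>i. k i \<le> m i" "hardy_coeff f (\<lambda>i. m i - k i) \<noteq> 0"
        by (auto simp: shift split: if_splits)
      have "w k * w (\<lambda>i. m i - k i) = w (\<lambda>i. k i + (m i - k i))" by (rule w(3)[symmetric])
      also have "(\<lambda>i. k i + (m i - k i)) = m" using le(1) by auto
      also have "w m = w k0 * w l0" unfolding m_def by (rule w(3))
      finally have eq: "w k * w (\<lambda>i. m i - k i) = w k0 * w l0" .
      have "w k0 < w k" using k0(2)[OF nz(1)] k w(1) by (metis DiffD2 injD insertI1 le_neq_implies_less)
      then have "w k0 * w l0 < w k * w l0" using w(2) by simp
      also have "\<dots> \<le> w k * w (\<lambda>i. m i - k i)" using l0(2)[OF le(2)] by simp
      finally show False using eq by simp
    qed
  qed auto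
  also have "\<dots> = hardy_coeff h k0 * hardy_coeff f l0"
    by (simp add: shift m_def)
  finally show False using k0(1) l0(1) Wh by (simp add: hardy_coeff_simps)
qed

section \<open>Irreducibility of the algebra of an invariant subspace\<close>

text \<open>\<open>1 - P\<close> kills \<open>S\<close>, so its range is spanned by the images of
  the finitely many vectors that span modulo \<open>S\<close>. This range is the orthogonal
  complement of \<open>S\<close>, which is therefore cut out by finitely many equations.\<close>

lemma finite_codimE:
  fixes S :: "'a::complex_hilbert set"
  assumes S: "closed_csubspace S" and "finite_codim S"
  obtains F where "finite F" "\<And>x. x - proj S x \<in> complex_vector.span F"
    "\<And>x. x \<in> S \<longleftrightarrow> (\<forall>b\<in>F. cinner x b = 0)"
proof -
  obtain B where B: "finite B" "complex_vector.span (S \<union> B) = UNIV"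
    using assms(2) unfolding finite_codim_def by blast
  define Q where "Q x = x - proj S x" for x
  have QS: "Q ` S \<subseteq> {0}" by (auto simp: Q_def proj_ident S)
  have span: "Q x \<in> complex_vector.span (Q ` B)" for x
  proof -
    have "Q x \<in> complex_vector.span (Q ` (S \<union> B))"
      by (rule linear_on_span[of UNIV])
        (auto simp: Q_def B proj_add proj_scaleC S complex_vector.scale_right_diff_distrib)
    moreover have "Q ` (S \<union> B) \<subseteq> insert 0 (Q ` B)" using QS by auto
    ultimately have "Q x \<in> complex_vector.span (insert 0 (Q ` B))"
      using complex_vector.span_mono by blast
    then show ?thesis by simp
  qed
  show ?thesis
  proof
    show "x - proj S x \<in> complex_vector.span (Q ` B)" for x using span by (simp add: Q_def)
    fix x
    show "x \<in> S \<longleftrightarrow> (\<forall>b\<in>Q ` B. cinner x b = 0)"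
    proof
      assume "x \<in> S"
      then show "\<forall>b\<in>Q ` B. cinner x b = 0"
        using proj_orthogonal[OF S] cinner_eq_zero_commute by (auto simp: Q_def)
    next
      assume x: "\<forall>b\<in>Q ` B. cinner x b = 0"
      have "cinner x y = 0" if "y \<in> complex_vector.span (Q ` B)" for y
        using that by (induction rule: complex_vector.span_induct_alt) (use x in \<open>auto simp: cinner_simps\<close>)
      then have "cinner x (Q x) = 0" using span by blast
      moreover have "cinner (proj S x) (Q x) = 0"
        using proj_orthogonal[OF S proj_in[OF S], of x x] cinner_eq_zero_commute by (auto simp: Q_def)
      ultimately have "cinner (Q x) (Q x) = 0" by (subst (1) Q_def) (simp add: cinner_diff_left)
      then show "x \<in> S" using proj_in[OF S, of x] by (simp add: Q_def)
    qed
  qed (use B in auto)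
qed

lemma closed_csubspace_vimage:
  assumes T: "T \<in> bounded_ops UNIV K" and S: "closed_csubspace S"
  shows "closed_csubspace {x. T x \<in> S}"
  unfolding closed_csubspace_def
proof
  show "complex_vector.subspace {x. T x \<in> S}"
    unfolding complex_vector.subspace_def
    by (auto simp: bounded_opsD[OF T] bounded_ops_0[OF T] closed_csubspaceD[OF S])
  have "closed (T -` S)"
    by (intro continuous_closed_vimage closed_csubspaceD[OF S] linear_continuous_at
        bounded_linear_bounded_ops[OF T])
  then show "closed {x. T x \<in> S}" by (simp add: vimage_def)
qed

lemma bounded_ops_sum:
  assumes K: "closed_csubspace K" and "\<And>i. i \<in> I \<Longrightarrow> T i \<in> bounded_ops S K"
  shows "(\<lambda>x. \<Sum>i\<in>I. T i x) \<in> bounded_ops S K"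
  using assms(2)
  by (induction I rule: infinite_finite_induct)
    (auto intro: bounded_ops_zero bounded_ops_add K)

lemma invariant_subspaceD:
  assumes "invariant_subspace S"
  shows "closed_csubspace S" "x \<in> S \<Longrightarrow> coord_mult i x \<in> S"
  using assms unfolding invariant_subspace_def by auto

lemma coord_mult_funpow_monom:
  "(coord_mult i ^^ j) (hardy_monom (\<lambda>l. 0)) = hardy_monom ((\<lambda>l. 0)(i := j))"
  by (induction j) (auto simp: coord_mult_monom fun_upd_def intro!: arg_cong[of _ _ hardy_monom])

lemma coord_mult_commute: "coord_mult i (coord_mult j f) = coord_mult j (coord_mult i f)"
proof (cases "i = j")
  case False
  then show ?thesis
    by (intro hardy_coeff_eqI) (auto simp: hardy_coeff_coord_mult fun_upd_twist)
qed simp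

text \<open>Powers of one coordinate are linearly dependent modulo \<open>S\<close>, so
  \<open>S\<close> contains a nonzero polynomial in that coordinate. By invariance and density of
  the monomials, multiplication by it maps H into \<open>S\<close>. The last clause records that
  \<open>Pi\<close> is a polynomial in the multiplications, which the quantifier would otherwise
  hide.\<close>

lemma ex_polynomial_multiplier:
  fixes S :: "('n::finite) hardy set"
  assumes "invariant_subspace S" "finite_codim S"
  shows "\<exists>Pi. Pi \<in> bounded_ops UNIV UNIV \<and> (\<forall>i h. Pi (coord_mult i h) = coord_mult i (Pi h)) \<and>
    (\<forall>h. Pi h \<in> S) \<and> Pi (hardy_monom (\<lambda>i. 0)) \<noteq> 0 \<and>
    (\<forall>L h. complex_vector.subspace L \<longrightarrow> (\<forall>i. coord_mult i ` L \<subseteq> L) \<longrightarrow> h \<in> L \<longrightarrow> Pi h \<in> L)"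
proof -
  note S = invariant_subspaceD[OF assms(1)]
  obtain F where F: "finite F" "\<And>x. x - proj S x \<in> complex_vector.span F"
    using finite_codimE[OF S(1) assms(2)] by metis
  fix i0 :: 'n
  let ?e = "hardy_monom (\<lambda>i. 0) :: 'n hardy"
  define p where "p j = (coord_mult i0 ^^ j)" for j
  obtain c where c: "\<exists>j\<le>card F. c j \<noteq> 0" "(\<Sum>j\<le>card F. c j *\<^sub>C (p j ?e - proj S (p j ?e))) = 0"
    using family_dependent[OF F(1), of "\<lambda>j. p j ?e - proj S (p j ?e)"] F(2) by blast
  define Pi where "Pi h = (\<Sum>j\<le>card F. c j *\<^sub>C p j h)" for h
  have pb: "p j \<in> bounded_ops UNIV UNIV" for j
  proof (induction j)
    case 0
    show ?case by (rule bounded_opsI[where M = 1]) (auto simp: p_def)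
  next
    case (Suc j)
    then show ?case unfolding p_def funpow.simps by (rule bounded_ops_comp[OF _ coord_mult_bounded])
  qed
  have pc: "p j (coord_mult i h) = coord_mult i (p j h)" for i j h
    by (induction j) (auto simp: p_def coord_mult_commute[of i0 i])
  have pL: "p j h \<in> L" if "\<forall>i. coord_mult i ` L \<subseteq> L" "h \<in> L" for L h j
    by (induction j) (use that in \<open>auto simp: p_def\<close>)
  have Pib: "Pi \<in> bounded_ops UNIV UNIV"
    unfolding Pi_def[abs_def] by (intro bounded_ops_sum bounded_ops_scaleC pb closed_csubspace_UNIV)
  have zero: "coord_mult i 0 = (0 :: 'n hardy)" for i by (rule bounded_ops_0[OF coord_mult_bounded])
  have sum: "coord_mult i (\<Sum>j\<in>J. g j) = (\<Sum>j\<in>J. coord_mult i (g j))" for i J and g :: "nat \<Rightarrow> 'n hardy"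
    by (induction J rule: infinite_finite_induct) (auto simp: zero coord_mult_add)
  have Pic: "Pi (coord_mult i h) = coord_mult i (Pi h)" for i h
    by (simp add: Pi_def pc sum coord_mult_scaleC)
  have PiL: "Pi h \<in> L" if "complex_vector.subspace L" "\<forall>i. coord_mult i ` L \<subseteq> L" "h \<in> L" for L h
    unfolding Pi_def
    by (intro complex_vector.subspace_sum complex_vector.subspace_scale pL that)
  have proj_sum: "proj S (\<Sum>j\<in>J. c j *\<^sub>C p j ?e) = (\<Sum>j\<in>J. c j *\<^sub>C proj S (p j ?e))" for J
    by (induction J rule: infinite_finite_induct)
      (auto simp: proj_add proj_scaleC S bounded_ops_0[OF proj_bounded_ops[OF S(1)]])
  have "Pi ?e - proj S (Pi ?e) = 0"
    unfolding Pi_def proj_sum using c(2) by (simp add: complex_vector.scale_right_diff_distrib sum_subtractf)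
  then have Pie: "Pi ?e \<in> S" using proj_in[OF S(1), of "Pi ?e"] by simp
  have "{h. Pi h \<in> S} = UNIV"
  proof (rule hardy_monom_dense[OF closed_csubspace_vimage[OF Pib S(1)]])
    fix k :: "'n \<Rightarrow> nat"
    show "hardy_monom k \<in> {h. Pi h \<in> S}"
    proof (induction k rule: multi_index_induct)
      case (Suc k i)
      then show ?case by (simp only: coord_mult_monom[symmetric] Pic mem_Collect_eq S)
    qed (simp add: Pie)
  qed
  then have PiS: "Pi h \<in> S" for h by blast
  have "Pi ?e \<noteq> 0"
  proof
    assume z: "Pi ?e = 0"
    obtain j where j: "j \<le> card F" "c j \<noteq> 0" using c by blast
    have "hardy_coeff (Pi ?e) k = (\<Sum>l\<le>card F. c l * hardy_coeff (p l ?e) k)" for k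
      unfolding Pi_def cinner_hardy_monom[symmetric] by (simp add: cinner_sum_left cinner_simps)
    \<comment> \<open>Different powers of the coordinate are different monomials, so the coefficient
      at the \<open>j\<close>-th power isolates \<open>c j\<close>.\<close>
    from this[of "(\<lambda>l. 0)(i0 := j)"]
    have "0 = (\<Sum>l\<le>card F. if l = j then c l else 0)"
      unfolding z p_def coord_mult_funpow_monom hardy_coeff_monom hardy_coeff_0
    proof (rule trans, intro sum.cong refl)
      fix l
      have "(\<lambda>l. 0)(i0 := j) = (\<lambda>l. 0 :: nat)(i0 := l) \<longleftrightarrow> l = j"
        by (metis fun_upd_eqD)
      then show "c l * (if (\<lambda>l. 0)(i0 := j) = (\<lambda>l. 0)(i0 := l) then 1 else 0) = (if l = j then c l else 0)"
        by simp
    qed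
    then show False using j by simp
  qed
  with Pib Pic PiS PiL show ?thesis by (intro exI[of _ Pi] conjI allI impI)
qed

text \<open>
  With \<open>E\<close> the projection onto \<open>N\<close>, the operator \<open>E \<Pi>\<close> is multiplication by a function
  and kills the complement of \<open>N\<close>; so one of the two vanishes.
\<close>

lemma invariant_complement_trivial:
  fixes S :: "('n::finite) hardy set"
  assumes S: "invariant_subspace S" "finite_codim S"
    and N: "closed_csubspace N" "N \<subseteq> S" "\<And>i x. x \<in> N \<Longrightarrow> coord_mult i x \<in> N"
    and N': "\<And>i x z. x \<in> S \<Longrightarrow> (\<And>y. y \<in> N \<Longrightarrow> cinner x y = 0) \<Longrightarrow> z \<in> N \<Longrightarrow> cinner (coord_mult i x) z = 0"
  shows "N = {0} \<or> N = S"
proof -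
  note S' = invariant_subspaceD[OF S(1)]
  obtain Pi where Pi: "Pi \<in> bounded_ops UNIV UNIV" "\<forall>i h. Pi (coord_mult i h) = coord_mult i (Pi h)"
    "\<forall>h. Pi h \<in> S" "Pi (hardy_monom (\<lambda>i. 0)) \<noteq> 0"
    and PiL: "\<forall>L h. complex_vector.subspace L \<longrightarrow> (\<forall>i. coord_mult i ` L \<subseteq> L) \<longrightarrow> h \<in> L \<longrightarrow> Pi h \<in> L"
    using ex_polynomial_multiplier[OF S] by (elim exE conjE) (rule that)
  define M where "M = S \<inter> {x. \<forall>z\<in>N. cinner x z = 0}"
  have M: "closed_csubspace M"
    unfolding M_def by (intro closed_csubspace_Int S' closed_csubspace_orthogonal)
  have Minv: "coord_mult i x \<in> M" if "x \<in> M" for i x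
    using that S'(2) N'[of x] by (simp add: M_def)
  \<comment> \<open>Both \<open>N\<close> and its complement \<open>M\<close> within
    \<open>S\<close> are invariant, so multiplying the decomposition of \<open>y\<close> gives the
    decomposition of the product.\<close>
  have comm: "proj N (coord_mult i y) = coord_mult i (proj N y)" if "y \<in> S" for i y
  proof (rule projI[OF N(1)])
    show "coord_mult i (proj N y) \<in> N" by (intro N proj_in)
    fix z assume z: "z \<in> N"
    have "y - proj N y \<in> M"
      using closed_csubspaceD(3)[OF S'(1) that subsetD[OF N(2) proj_in[OF N(1)]]]
        proj_orthogonal[OF N(1)] by (simp add: M_def)
    from Minv[OF this, of i] z show "cinner (coord_mult i y - coord_mult i (proj N y)) z = 0"
      by (simp add: M_def coord_mult_diff)
  qed
  define W where "W = proj N \<circ> Pi"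
  have W: "W \<in> bounded_ops UNIV UNIV"
    unfolding W_def using bounded_ops_comp[OF Pi(1) proj_bounded_ops[OF N(1)]]
    by (rule bounded_ops_mono) auto
  have Wc: "W (coord_mult i h) = coord_mult i (W h)" for i h
    by (simp add: W_def Pi(2) comm Pi(3))
  show ?thesis
  proof (cases "W (hardy_monom (\<lambda>i. 0)) = 0")
    case False
    have "N = S"
    proof (rule closed_csubspace_eqI[OF N(1) S'(1) N(2)])
      fix g assume "g \<in> S" "\<And>x. x \<in> N \<Longrightarrow> cinner x g = 0"
      then have "g \<in> M" using cinner_eq_zero_commute by (auto simp: M_def)
      then have "Pi g \<in> M" using PiL closed_csubspaceD(7)[OF M] Minv by (simp add: image_subset_iff)
      then have "W g = 0" unfolding W_def o_def
        by (intro projI[OF N(1)]) (auto simp: M_def closed_csubspaceD[OF N(1)])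
      then show "g = 0" by (rule multiplier_injective[OF W Wc False])
    qed
    then show ?thesis by simp
  next
    case True
    \<comment> \<open>\<open>Pi - W\<close> is again a multiplier, nonzero at 1 since
      \<open>W\<close> vanishes there, and zero on \<open>N\<close>, where \<open>W\<close> agrees
      with \<open>Pi\<close>.\<close>
    have "g = 0" if "g \<in> N" for g
    proof (rule multiplier_injective[where W = "\<lambda>h. Pi h - W h"])
      show "(\<lambda>h. Pi h - W h) \<in> bounded_ops UNIV UNIV"
        by (intro bounded_ops_diff Pi W closed_csubspace_UNIV)
      show "Pi (coord_mult i h) - W (coord_mult i h) = coord_mult i (Pi h - W h)" for i h
        by (simp add: Pi(2) Wc coord_mult_diff)
      have "Pi g \<in> N" using PiL closed_csubspaceD(7)[OF N(1)] N(3) that by (simp add: image_subset_iff)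
      then show "Pi g - W g = 0" by (simp add: W_def proj_ident N(1))
    qed (use True Pi(4) in simp)
    then show ?thesis using closed_csubspaceD(1)[OF N(1)] by auto
  qed
qed

section \<open>Restricted coordinate multiplications and cyclic vectors\<close>

abbreviation coord_restr :: "('n::finite) hardy set \<Rightarrow> 'n \<Rightarrow> 'n hardy \<Rightarrow> 'n hardy" where
  "coord_restr S i \<equiv> restrict_op S (coord_mult i)"

lemma restrict_op_apply: "x \<in> S \<Longrightarrow> restrict_op S T x = T x"
  by (simp add: restrict_op_def)

lemma coord_restr_bounded:
  assumes "invariant_subspace S"
  shows "coord_restr S i \<in> bounded_ops S S"
proof -
  note S = invariant_subspaceD[OF assms]
  show ?thesis
    by (rule bounded_opsI[where M = 1])
      (auto simp: restrict_op_def S coord_mult_add coord_mult_scaleC norm_coord_mult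
        closed_csubspaceD[OF S(1)])
qed

lemma toeplitz_algebra_cstar:
  assumes "invariant_subspace S"
  shows "cstar_subalgebra S (toeplitz_algebra S)"
  unfolding toeplitz_algebra_def
  using assms by (intro cstar_generated_subalgebra) (auto simp: invariant_subspaceD coord_restr_bounded)

lemma coord_restr_in_toeplitz: "coord_restr S i \<in> toeplitz_algebra S"
  unfolding toeplitz_algebra_def by (intro cstar_generated_base) auto

lemma adjoint_coord_restr:
  assumes "invariant_subspace S" "x \<in> S" "y \<in> S"
  shows "cinner (coord_mult i x) y = cinner x (adjoint_op S S (coord_restr S i) y)"
    "cinner y (coord_mult i x) = cinner (adjoint_op S S (coord_restr S i) y) x"
  using cinner_adjoint[OF _ _ coord_restr_bounded assms(2,3), of i]
    cinner_adjoint'[OF _ _ coord_restr_bounded assms(2,3), of i]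
    invariant_subspaceD(1)[OF assms(1)] assms by (auto simp: restrict_op_def)

text \<open>Invariance lets the projection be dropped when it is paired with
  \<open>coord_mult i z\<close>. The identity is what relates the recursion for
  \<open>defect\<close> on \<open>S\<close> to the one on H.\<close>

lemma adjoint_coord_restr_proj:
  assumes S: "invariant_subspace S"
  shows "adjoint_op S S (coord_restr S i) (proj S x) = proj S (coord_adj i x)"
proof (rule projI[symmetric])
  note S' = invariant_subspaceD[OF S]
  show "closed_csubspace S" by (rule S')
  show "adjoint_op S S (coord_restr S i) (proj S x) \<in> S"
    by (rule bounded_opsD(1)[OF adjoint_op_bounded[OF S'(1) S'(1) coord_restr_bounded[OF S]] proj_in[OF S'(1)]])
  fix z assume z: "z \<in> S"
  have "cinner (adjoint_op S S (coord_restr S i) (proj S x)) z = cinner (proj S x) (coord_mult i z)"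
    by (rule adjoint_coord_restr(2)[OF S z proj_in[OF S'(1)], symmetric])
  also have "\<dots> = cinner x (coord_mult i z)" by (rule cinner_proj[OF S'(1) S'(2)[OF z]])
  also have "\<dots> = cinner (coord_adj i x) z" by (rule cinner_coord_adj)
  finally show "cinner (coord_adj i x - adjoint_op S S (coord_restr S i) (proj S x)) z = 0"
    by (simp add: cinner_diff_left)
qed

lemma toeplitz_algebra_id:
  assumes "invariant_subspace S"
  shows "restrict_op S (\<lambda>x. x) \<in> toeplitz_algebra S"
proof -
  note S = invariant_subspaceD[OF assms] and A = toeplitz_algebra_cstar[OF assms]
  \<comment> \<open>Any coordinate serves, and \<open>undefined\<close> picks one. The generator is
    an isometry, so its adjoint times itself is the unit of the algebra.\<close>
  let ?R = "coord_restr S undefined"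
  have Rb: "adjoint_op S S ?R \<in> bounded_ops S S"
    by (rule adjoint_op_bounded[OF S(1) S(1) coord_restr_bounded[OF assms]])
  have "adjoint_op S S ?R \<circ> ?R = restrict_op S (\<lambda>x. x)"
  proof
    fix x
    show "(adjoint_op S S ?R \<circ> ?R) x = restrict_op S (\<lambda>x. x) x"
    proof (cases "x \<in> S")
      case True
      let ?y = "adjoint_op S S ?R (coord_mult undefined x)"
      have "?y \<in> S" by (intro bounded_opsD(1)[OF Rb] S True)
      then have d: "?y - x \<in> S" using True by (intro closed_csubspaceD[OF S(1)])
      have "cinner (?y - x) (?y - x) = 0"
        using adjoint_coord_restr(2)[OF assms d S(2)[OF True], of undefined undefined]
        by (simp add: cinner_diff_left cinner_coord_mult)
      then show ?thesis using True by (simp add: restrict_op_def)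
    qed (use bounded_ops_0[OF Rb] in \<open>simp add: restrict_op_def\<close>)
  qed
  then show ?thesis
    using cstar_subalgebraD(5,6)[OF A] coord_restr_in_toeplitz by metis
qed

text \<open>The vectors of \<open>S\<close> orthogonal to the orbit of \<open>x\<close> form a
  subspace invariant under the generators and their adjoints, hence \<open>{0}\<close> or
  \<open>S\<close>; it omits \<open>x\<close> because the unit belongs to the algebra.\<close>

lemma toeplitz_algebra_cyclic:
  fixes S :: "('n::finite) hardy set"
  assumes S: "invariant_subspace S" "finite_codim S"
    and x: "x \<in> S" "x \<noteq> 0" and g: "g \<in> S" "\<And>B. B \<in> toeplitz_algebra S \<Longrightarrow> cinner (B x) g = 0"
  shows "g = 0"
proof -
  note S' = invariant_subspaceD[OF S(1)] and A = cstar_subalgebraD[OF toeplitz_algebra_cstar[OF S(1)]]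
  note gen = coord_restr_in_toeplitz[of S]
  let ?A = "toeplitz_algebra S"
  define N where "N = S \<inter> {g. \<forall>y\<in>(\<lambda>B. B x) ` ?A. cinner g y = 0}"
  have N: "g \<in> N \<longleftrightarrow> g \<in> S \<and> (\<forall>B\<in>?A. cinner (B x) g = 0)" for g
    using cinner_eq_zero_commute by (auto simp: N_def)
  have Bx: "B x \<in> S" if "B \<in> ?A" for B using bounded_opsD(1)[OF A(1)[OF that] x(1)] .
  let ?R = "\<lambda>i. coord_restr S i" and ?R' = "\<lambda>i. adjoint_op S S (coord_restr S i)"
  have R'S: "?R' i y \<in> S" if "y \<in> S" for i y
    using bounded_opsD(1)[OF A(1)[OF A(6)[OF gen]] that] .
  have "N = {0} \<or> N = S"
  proof (rule invariant_complement_trivial[OF S])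
    show "closed_csubspace N"
      unfolding N_def by (intro closed_csubspace_Int S' closed_csubspace_orthogonal)
    show "N \<subseteq> S" by (auto simp: N)
    show "coord_mult i y \<in> N" if "y \<in> N" for i y
    proof -
      have y: "y \<in> S" using that by (simp add: N)
      have "cinner (B x) (coord_mult i y) = 0" if "B \<in> ?A" for B
      proof -
        have "cinner (B x) (coord_mult i y) = cinner ((?R' i \<circ> B) x) y"
          using adjoint_coord_restr(2)[OF S(1) y Bx[OF that]] by simp
        also have "\<dots> = 0" using \<open>y \<in> N\<close> A(5)[OF A(6)[OF gen] that] by (simp add: N del: o_apply)
        finally show ?thesis .
      qed
      then show ?thesis using y S' by (simp add: N)
    qed
    fix i y z assume y: "y \<in> S" "\<And>z. z \<in> N \<Longrightarrow> cinner y z = 0" and z: "z \<in> N"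
    then have zS: "z \<in> S" by (simp add: N)
    have "cinner (B x) (?R' i z) = 0" if "B \<in> ?A" for B
    proof -
      have "cinner (B x) (?R' i z) = cinner ((?R i \<circ> B) x) z"
        using adjoint_coord_restr(1)[OF S(1) Bx[OF that] zS] Bx[OF that] by (simp add: restrict_op_def)
      also have "\<dots> = 0" using z A(5)[OF gen that] by (simp add: N del: o_apply)
      finally show ?thesis .
    qed
    then have "?R' i z \<in> N" using R'S[OF zS] by (simp add: N)
    then show "cinner (coord_mult i y) z = 0"
      using adjoint_coord_restr(1)[OF S(1) y(1) zS] y(2) by simp
  qed
  moreover have "x \<notin> N"
    using x toeplitz_algebra_id[OF S(1)] by (force simp: N restrict_op_def)
  ultimately have "N = {0}" using x by auto
  then show ?thesis using g N by auto
qed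


section \<open>Finite rank operators\<close>

text \<open>
  For \<open>S = H\<^sup>2\<close> and \<open>l\<close> an enumeration of all coordinates this is
  \<open>(1 - M\<^sub>1 M\<^sub>1\<^sup>*) \<dots> (1 - M\<^sub>n M\<^sub>n\<^sup>*)\<close>, the projection onto the constants.
\<close>

primrec defect :: "('n::finite) hardy set \<Rightarrow> 'n list \<Rightarrow> 'n hardy \<Rightarrow> 'n hardy" where
  "defect S [] = restrict_op S (\<lambda>x. x)"
| "defect S (i # l) = (\<lambda>x. defect S l x -
     (coord_restr S i \<circ> (defect S l \<circ> adjoint_op S S (coord_restr S i))) x)"

lemma defect_in_toeplitz:
  assumes "invariant_subspace S"
  shows "defect S l \<in> toeplitz_algebra S"
proof (induction l)
  case Nil
  show ?case using toeplitz_algebra_id[OF assms] by simp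
next
  case (Cons i l)
  note A = toeplitz_algebra_cstar[OF assms]
  show ?case
    unfolding defect.simps
    by (intro cstar_subalgebra_diff[OF A] cstar_subalgebraD(5,6)[OF A] Cons coord_restr_in_toeplitz)
qed

lemma invariant_subspace_UNIV: "invariant_subspace UNIV"
  by (simp add: invariant_subspace_def closed_csubspace_UNIV)

lemma restrict_op_UNIV [simp]: "restrict_op UNIV T = T"
  by (simp add: restrict_op_def fun_eq_iff)

text \<open>Distinctness matters: lowering \<open>k i\<close> leaves the condition on the other
  coordinates unchanged, so the term subtracted for \<open>i\<close> is exactly the part with
  \<open>k i \<noteq> 0\<close>.\<close>

lemma hardy_coeff_defect:
  assumes "distinct l"
  shows "hardy_coeff (defect UNIV l f) k = (if \<forall>i\<in>set l. k i = 0 then hardy_coeff f k else 0)"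
  using assms
proof (induction l arbitrary: f k)
  case (Cons i l)
  have "(\<forall>j\<in>set l. (k(i := k i - 1)) j = 0) \<longleftrightarrow> (\<forall>j\<in>set l. k j = 0)"
    using Cons.prems by auto
  then show ?case
    using Cons by (simp add: hardy_coeff_simps hardy_coeff_coord_mult hardy_coeff_coord_adj)
qed simp

text \<open>The difference starts as \<open>1 - P\<close> and each new coordinate replaces
  \<open>d\<close> by \<open>d - M\<^sub>i d M\<^sub>i\<^sup>*\<close>, which preserves finite
  rank.\<close>

lemma defect_diff_finite_rank:
  fixes S :: "('n::finite) hardy set"
  assumes S: "invariant_subspace S" "finite_codim S"
  shows "\<exists>F. finite F \<and> (\<forall>x. defect UNIV l x - defect S l (proj S x) \<in> complex_vector.span F)"
proof (induction l)
  case Nil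
  note S' = invariant_subspaceD[OF S(1)]
  obtain F where F: "finite F" "\<And>x. x - proj S x \<in> complex_vector.span F"
    using finite_codimE[OF S'(1) S(2)] by metis
  then show ?case by (auto simp: restrict_op_def proj_in S')
next
  case (Cons i l)
  note S' = invariant_subspaceD[OF S(1)]
  have DS: "defect S l \<in> bounded_ops S S"
    by (rule cstar_subalgebraD(1)[OF toeplitz_algebra_cstar[OF S(1)] defect_in_toeplitz[OF S(1)]])
  obtain F where F: "finite F" "\<And>x. defect UNIV l x - defect S l (proj S x) \<in> complex_vector.span F"
    using Cons by blast
  define d where "d x = defect UNIV l x - defect S l (proj S x)" for x
  have "defect UNIV (i # l) x - defect S (i # l) (proj S x) \<in> complex_vector.span (F \<union> coord_mult i ` F)" for x
  proof -
    have "defect UNIV (i # l) x - defect S (i # l) (proj S x) = d x - coord_mult i (d (coord_adj i x))"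
      using bounded_opsD(1)[OF DS proj_in[OF S'(1)]]
      by (simp add: adjoint_coord_restr_proj[OF S(1)] d_def coord_mult_diff restrict_op_apply)
    moreover have "d x \<in> complex_vector.span F" "d (coord_adj i x) \<in> complex_vector.span F"
      using F(2) by (auto simp: d_def)
    moreover have "coord_mult i (d (coord_adj i x)) \<in> complex_vector.span (coord_mult i ` F)"
      using calculation by (intro linear_on_span[of UNIV]) (auto simp: coord_mult_add coord_mult_scaleC)
    ultimately show ?thesis
      by (auto intro!: complex_vector.span_diff intro: complex_vector.span_mono[THEN subsetD])
  qed
  then show ?case using F(1) by (intro exI[of _ "F \<union> coord_mult i ` F"]) auto
qed

text \<open>A vector is killed by all the adjoints when it is orthogonal to all shifts of elements
  of \<open>S\<close>. With \<open>m\<close> the least total degree of a monomial occurring in an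
  element of \<open>S\<close>, such shifts have no term of degree \<open>m\<close>, so they lie in
  the proper closed subspace \<open>K\<close>.\<close>

lemma ex_lowest_order:
  fixes S :: "('n::finite) hardy set"
  assumes S: "invariant_subspace S" and "p \<in> S" "p \<noteq> 0"
  shows "\<exists>f\<in>S. f \<noteq> 0 \<and> (\<forall>i. adjoint_op S S (coord_restr S i) f = 0)"
proof -
  note S' = invariant_subspaceD[OF S]
  define deg where "deg k = (\<Sum>i\<in>UNIV. k i)" for k :: "'n \<Rightarrow> nat"
  obtain k0 where k0: "hardy_coeff p k0 \<noteq> 0"
    using assms(3) hardy_coeff_eqI[of p 0] by (auto simp: hardy_coeff_simps)
  define Q where "Q m \<longleftrightarrow> (\<exists>g\<in>S. \<exists>k. deg k = m \<and> hardy_coeff g k \<noteq> 0)" for m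
  have "Q (deg k0)" unfolding Q_def using k0 assms by blast
  then obtain m where m: "Q m" "\<And>n. Q n \<Longrightarrow> m \<le> n"
    using ex_has_least_nat[of Q _ "\<lambda>n. n"] by blast
  obtain g k where g: "g \<in> S" "deg k = m" "hardy_coeff g k \<noteq> 0" using m(1) Q_def by auto
  define K where "K = S \<inter> {x. \<forall>y\<in>hardy_monom ` {k. deg k = m}. cinner x y = 0}"
  have K: "closed_csubspace K"
    unfolding K_def by (intro closed_csubspace_Int S' closed_csubspace_orthogonal)
  have shift: "coord_mult i x \<in> K" if "x \<in> S" for i x
  proof -
    have "hardy_coeff (coord_mult i x) l = 0" if l: "deg l = m" for l
    proof (cases "l i = 0")
      case False
      let ?l = "l(i := l i - 1)"
      have "(\<Sum>j\<in>UNIV - {i}. ?l j) = (\<Sum>j\<in>UNIV - {i}. l j)" by (rule sum.cong) auto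
      then have "deg ?l < m" using False l by (simp add: deg_def sum.remove[of UNIV i])
      then have "\<not> Q (deg ?l)" using m(2) by (meson not_le)
      then show ?thesis using \<open>x \<in> S\<close> False by (auto simp: Q_def hardy_coeff_coord_mult)
    qed (simp add: hardy_coeff_coord_mult)
    then show ?thesis using S' that by (auto simp: K_def cinner_hardy_monom)
  qed
  define f where "f = g - proj K g"
  have f: "f \<in> S"
    using g proj_in[OF K, of g] by (auto simp: f_def K_def closed_csubspaceD[OF S'(1)])
  have "g \<notin> K" using g by (auto simp: K_def cinner_hardy_monom)
  then have "f \<noteq> 0" using proj_in[OF K, of g] by (auto simp: f_def)
  moreover have "adjoint_op S S (coord_restr S i) f = 0" for i
  proof -
    let ?y = "adjoint_op S S (coord_restr S i) f"
    have y: "?y \<in> S"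
      by (rule bounded_opsD(1)[OF adjoint_op_bounded[OF S'(1) S'(1) coord_restr_bounded[OF S]] f])
    have "cinner ?y ?y = cinner f (coord_mult i ?y)" by (rule adjoint_coord_restr(2)[OF S y f, symmetric])
    also have "\<dots> = 0" unfolding f_def by (rule proj_orthogonal[OF K shift]) (use y f_def in simp)
    finally show ?thesis by simp
  qed
  ultimately show ?thesis using f by blast
qed

text \<open>Taken over all coordinates, \<open>defect S\<close> differs by finite rank from the
  projection onto the constants, so it has finite rank. It fixes any vector killed by all the
  adjoints, so it is not zero. Irreducibility then yields every rank one operator.\<close>

lemma finite_rank_in_toeplitz:
  fixes S :: "('n::finite) hardy set"
  assumes S: "invariant_subspace S" "finite_codim S"
    and T: "T \<in> bounded_ops S S" "finite F" "T ` S \<subseteq> complex_vector.span F"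
  shows "T \<in> toeplitz_algebra S"
proof -
  note S' = invariant_subspaceD[OF S(1)] and A = toeplitz_algebra_cstar[OF S(1)]
  obtain l :: "'n list" where l: "set l = UNIV" "distinct l"
    using finite_distinct_list[of "UNIV :: 'n set"] by auto
  define C where "C = defect S l"
  have CA: "C \<in> toeplitz_algebra S" unfolding C_def by (rule defect_in_toeplitz[OF S(1)])
  have Cb: "C \<in> bounded_ops S S" by (rule cstar_subalgebraD(1)[OF A CA])
  obtain G where G: "finite G" "\<And>x. defect UNIV l x - C (proj S x) \<in> complex_vector.span G"
    unfolding C_def using defect_diff_finite_rank[OF S] by metis
  let ?e = "hardy_monom (\<lambda>i. 0) :: 'n hardy"
  have rank: "C x \<in> complex_vector.span (insert ?e G)" for x
  proof (cases "x \<in> S")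
    case True
    have "defect UNIV l x = hardy_coeff x (\<lambda>i. 0) *\<^sub>C ?e"
      by (rule hardy_coeff_eqI)
        (auto simp: hardy_coeff_defect[OF l(2)] l(1) hardy_coeff_simps hardy_coeff_monom fun_eq_iff
          intro!: arg_cong[of _ _ "hardy_coeff x"])
    then have "C x = hardy_coeff x (\<lambda>i. 0) *\<^sub>C ?e - (defect UNIV l x - C (proj S x))"
      by (simp add: proj_ident[OF S'(1) True])
    also have "\<dots> \<in> complex_vector.span (insert ?e G)"
      using G(2)[of x] complex_vector.span_mono[OF subset_insertI[of G ?e]]
      by (intro complex_vector.span_diff[OF complex_vector.span_scale[OF complex_vector.span_base]]) auto
    finally show ?thesis .
  next
    case False
    then show ?thesis using bounded_opsD(2)[OF Cb] by (simp add: complex_vector.span_zero)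
  qed
  obtain Pi where "\<forall>h. Pi h \<in> S" "Pi ?e \<noteq> 0"
    using ex_polynomial_multiplier[OF S] by (elim exE conjE) (rule that)
  then have "Pi ?e \<in> S" "Pi ?e \<noteq> 0" by auto
  then obtain f where f: "f \<in> S" "f \<noteq> 0" "\<And>i. adjoint_op S S (coord_restr S i) f = 0"
    using ex_lowest_order[OF S(1)] by blast
  have "defect S l' f = f" for l'
  proof (induction l')
    case (Cons i l')
    have "defect S l' 0 = 0"
      by (rule bounded_ops_0[OF cstar_subalgebraD(1)[OF A defect_in_toeplitz[OF S(1)]]])
    with Cons f show ?case by (simp add: bounded_ops_0[OF coord_restr_bounded[OF S(1)]])
  qed (simp add: restrict_op_def f)
  then have "C f \<noteq> 0" using f by (simp add: C_def)
  then have "C \<noteq> (\<lambda>x. 0)" by auto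
  then have "rank_one S u v \<in> toeplitz_algebra S" if "u \<in> S" "v \<in> S" for u v
    using rank_one_in_irreducible[OF S'(1) A _ CA _ _ _ that, of "insert ?e G"]
      toeplitz_algebra_cyclic[OF S] G(1) rank by blast
  then show ?thesis by (rule finite_rank_in_cstar_subalgebra[OF S'(1) A _ T])
qed

section \<open>Isometries in the Toeplitz algebra with prescribed range\<close>

lemma finite_codim_UNIV: "finite_codim UNIV"
  unfolding finite_codim_def by (intro exI[of _ "{}"]) (simp add: complex_vector.span_UNIV)

lemma rank_one_in_toeplitz_UNIV: "rank_one UNIV u v \<in> toeplitz_algebra (UNIV :: ('n::finite) hardy set)"
  by (rule finite_rank_in_toeplitz[OF invariant_subspace_UNIV finite_codim_UNIV
      rank_one_bounded[OF closed_csubspace_UNIV], of u "{u}"])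
    (auto simp: rank_one_def intro: complex_vector.span_base complex_vector.span_scale)

lemmas toeplitz_UNIV_cstar = toeplitz_algebra_cstar[OF invariant_subspace_UNIV]

text \<open>
  On monomials the isometry is the shift along one coordinate axis and the identity elsewhere.
\<close>

lemma ex_isometry_codim_one:
  "\<exists>V\<in>toeplitz_algebra (UNIV :: ('n::finite) hardy set). (\<forall>f g. cinner (V f) (V g) = cinner f g) \<and>
     range V = {f. cinner f (hardy_monom (\<lambda>i. 0)) = 0}"
proof -
  fix a :: 'n
  obtain l where l: "set l = UNIV - {a}" "distinct l"
    using finite_distinct_list[of "UNIV - {a}"] by auto
  define axis where "axis k \<longleftrightarrow> (\<forall>i. i \<noteq> a \<longrightarrow> k i = (0::nat))" for k
  define s where "s k = (if axis k then k(a := Suc (k a)) else k)" for k :: "'n \<Rightarrow> nat"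
  have axis_upd: "axis (k(a := n)) \<longleftrightarrow> axis k" for k n by (auto simp: axis_def)
  have "axis (s k) = axis k" for k by (simp add: s_def axis_upd)
  then have inj: "inj s"
    using inj_fun_upd_Suc[of a] unfolding inj_def s_def by metis
  have ran: "range s = UNIV - {\<lambda>i. 0}"
  proof (intro equalityI subsetI)
    fix k :: "'n \<Rightarrow> nat" assume "k \<in> range s"
    then show "k \<in> UNIV - {\<lambda>i. 0}" by (auto simp: s_def axis_def fun_eq_iff split: if_splits)
  next
    fix k :: "'n \<Rightarrow> nat" assume k: "k \<in> UNIV - {\<lambda>i. 0}"
    show "k \<in> range s"
    proof (cases "axis k")
      case True
      then have "k a \<noteq> 0" using k unfolding axis_def by (metis DiffD2 ext singletonI)
      then have "k = s (k(a := k a - 1))" using True by (simp add: s_def axis_upd)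
      then show ?thesis by blast
    next
      case False
      then have "k = s k" by (simp add: s_def)
      then show ?thesis by blast
    qed
  qed
  let ?A = "toeplitz_algebra (UNIV :: 'n hardy set)"
  note A = cstar_subalgebraD[OF toeplitz_UNIV_cstar]
  \<comment> \<open>As \<open>l\<close> omits only \<open>a\<close>, this is the projection onto the
    power series in that coordinate alone.\<close>
  define E where "E = defect UNIV l"
  define V where "V f = coord_mult a (E f) + (f - E f)" for f
  have E: "E \<in> ?A" unfolding E_def by (rule defect_in_toeplitz[OF invariant_subspace_UNIV])
  have M: "coord_mult a \<in> ?A" using coord_restr_in_toeplitz[of UNIV a] by simp
  have I: "(\<lambda>f. f) \<in> ?A" using toeplitz_algebra_id[OF invariant_subspace_UNIV] by simp
  have VA: "V \<in> ?A"
    using A(3)[OF A(5)[OF M E] cstar_subalgebra_diff[OF toeplitz_UNIV_cstar I E]]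
    by (simp add: V_def[abs_def] o_def)
  have cE: "hardy_coeff (E f) k = (if axis k then hardy_coeff f k else 0)" for f k
    unfolding E_def hardy_coeff_defect[OF l(2)] l(1) axis_def by auto
  have cV: "hardy_coeff (V f) (s k) = hardy_coeff f k" for f k
    by (simp add: V_def hardy_coeff_simps cE hardy_coeff_coord_mult s_def axis_upd)
  have V0: "hardy_coeff (V f) k = 0" if "k \<notin> range s" for f k
  proof -
    have "k = (\<lambda>i. 0)" using that by (simp add: ran)
    then show ?thesis by (simp add: V_def hardy_coeff_simps cE hardy_coeff_coord_mult axis_def)
  qed
  have iso: "cinner (V f) (V g) = cinner f g" for f g
    by (rule cinner_hardy_reindex[OF inj]) (auto simp: cV V0)
  have "range V = {f. cinner f (hardy_monom (\<lambda>i. 0)) = 0}"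
  proof (intro equalityI subsetI)
    fix f assume "f \<in> range V"
    then show "f \<in> {f. cinner f (hardy_monom (\<lambda>i. 0)) = 0}"
      using V0[of "\<lambda>i. 0"] by (auto simp: cinner_hardy_monom ran)
  next
    fix f :: "'n hardy" assume "f \<in> {f. cinner f (hardy_monom (\<lambda>i. 0)) = 0}"
    then have f0: "hardy_coeff f (\<lambda>i. 0) = 0" by (simp add: cinner_hardy_monom)
    have "(\<lambda>k. (cmod (hardy_coeff f k))\<^sup>2) summable_on range s"
      by (rule summable_on_subset_banach[where A = UNIV])
        (use square_summable_hardy_coeff[of f] in \<open>auto simp: square_summable_def\<close>)
    then have "square_summable (\<lambda>k. hardy_coeff f (s k))"
      unfolding square_summable_def by (simp add: summable_on_reindex[OF inj] o_def)
    then obtain g :: "'n hardy" where g: "hardy_coeff g = (\<lambda>k. hardy_coeff f (s k))"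
      by (rule hardy_coeff_surj)
    have "V g = f"
    proof (rule hardy_coeff_eqI)
      fix k
      show "hardy_coeff (V g) k = hardy_coeff f k"
      proof (cases "k \<in> range s")
        case True
        then show ?thesis using cV[of g] g by auto
      next
        case False
        then show ?thesis using V0[OF False] f0 by (simp add: ran)
      qed
    qed
    then show "f \<in> range V" by blast
  qed
  with VA iso show ?thesis by blast
qed

text \<open>The isometry above is followed by a Householder reflection exchanging \<open>1\<close> and a multiple of \<open>u\<close>.\<close>

lemma ex_isometry_range_orthogonal:
  fixes u :: "('n::finite) hardy"
  assumes "u \<noteq> 0"
  shows "\<exists>B\<in>toeplitz_algebra UNIV. (\<forall>f g. cinner (B f) (B g) = cinner f g) \<and>
     range B = {f. cinner f u = 0}"
proof -
  let ?A = "toeplitz_algebra (UNIV :: 'n hardy set)"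
  note A = cstar_subalgebraD[OF toeplitz_UNIV_cstar]
  let ?e = "hardy_monom (\<lambda>i. 0) :: 'n hardy"
  obtain V where V: "V \<in> ?A" "\<And>f g. cinner (V f) (V g) = cinner f g" "range V = {f. cinner f ?e = 0}"
    using ex_isometry_codim_one by blast
  have ee: "cinner ?e ?e = 1" by (simp add: cinner_hardy_monom hardy_coeff_monom)
  \<comment> \<open>The phase makes the inner product of 1 with the unit vector \<open>b\<close>
    real, as a reflection exchanging the two requires. When that product is 0 any phase will do, but
    \<open>sgn\<close> would give 0.\<close>
  define t where "t = (if cinner ?e u = 0 then 1 else sgn (cinner ?e u))"
  have t: "cmod t = 1" "cnj t * cinner ?e u = complex_of_real (cmod (cinner ?e u))"
  proof -
    show "cmod t = 1" by (simp add: t_def norm_sgn)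
    show "cnj t * cinner ?e u = complex_of_real (cmod (cinner ?e u))"
    proof (cases "cinner ?e u = 0")
      case False
      then have "cinner ?e u = t * complex_of_real (cmod (cinner ?e u))"
        by (simp add: t_def sgn_div_norm scaleR_conv_of_real)
      then have "cnj t * cinner ?e u = (t * cnj t) * complex_of_real (cmod (cinner ?e u))"
        by (metis mult.assoc mult.commute)
      then show ?thesis using \<open>cmod t = 1\<close> by (simp add: complex_norm_square[symmetric])
    qed simp
  qed
  define r where "r = cmod (cinner ?e u) / norm u"
  define b where "b = (t / complex_of_real (norm u)) *\<^sub>C u"
  have nb: "norm b = 1" using assms t(1) by (simp add: b_def norm_scaleC norm_divide)
  have bb: "cinner b b = 1" using nb by (simp add: cinner_self)
  have eb: "cinner ?e b = complex_of_real r"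
    using t(2) by (simp add: b_def cinner_simps r_def)
  have be: "cinner b ?e = complex_of_real r" using eb by (subst cinner_commute) simp
  have perp: "cinner f b = 0 \<longleftrightarrow> cinner f u = 0" for f
    using assms t(1) by (auto simp: b_def cinner_simps)
  define w where "w = ?e - b"
  have ww: "complex_of_real ((norm w)\<^sup>2) = 2 - 2 * complex_of_real r"
    unfolding cinner_self[symmetric] w_def by (simp add: cinner_diff_left cinner_diff_right ee bb eb be)
  \<comment> \<open>For \<open>w = 0\<close>, when \<open>b\<close> is already 1, division by zero
    gives \<open>c = 0\<close> and \<open>W\<close> is the identity.\<close>
  define c where "c = 2 / complex_of_real ((norm w)\<^sup>2)"
  have c: "cnj c = c" "w \<noteq> 0 \<Longrightarrow> c * cinner w w = 2"
    by (simp_all add: c_def cinner_self)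
  define W where "W f = f - c *\<^sub>C rank_one UNIV w w f" for f
  have Wf: "W f = f - (c * cinner f w) *\<^sub>C w" for f
    by (simp add: W_def rank_one_def scaleC_scaleC)
  have I: "(\<lambda>f. f) \<in> ?A" using toeplitz_algebra_id[OF invariant_subspace_UNIV] by simp
  have WA: "W \<in> ?A"
    unfolding W_def[abs_def]
    by (intro cstar_subalgebra_diff[OF toeplitz_UNIV_cstar I] A(4) rank_one_in_toeplitz_UNIV)
  have WW: "cinner (W f) g = cinner f (W g)" for f g
    using c(1) by (simp add: Wf cinner_simps cinner_commute[of g w])
  have invol: "W (W f) = f" for f
  proof (cases "w = 0")
    case False
    let ?k = "c * cinner f w"
    have "W (W f) = f - (?k + c * cinner (f - ?k *\<^sub>C w) w) *\<^sub>C w"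
      by (simp add: Wf scaleC_add_left)
    also have "c * cinner (f - ?k *\<^sub>C w) w = ?k - ?k * (c * cinner w w)"
      by (simp add: cinner_simps algebra_simps)
    finally show ?thesis using c(2)[OF False] by simp
  qed (simp add: Wf)
  have We: "W ?e = b"
  proof (cases "w = 0")
    case False
    have "cinner ?e w = 1 - complex_of_real r" by (simp add: w_def cinner_diff_right ee eb)
    then have e: "complex_of_real ((norm w)\<^sup>2) = 2 * cinner ?e w" unfolding ww by simp
    then have "cinner ?e w \<noteq> 0" using False by auto
    then have "c * cinner ?e w = 1" unfolding c_def e by simp
    then show ?thesis by (simp add: Wf w_def)
  qed (simp add: Wf w_def)
  have iso: "cinner (W f) (W g) = cinner f g" for f g by (simp add: WW invol)
  show ?thesis
  proof (intro bexI[of _ "W \<circ> V"] conjI allI)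
    show "range (W \<circ> V) = {f. cinner f u = 0}"
    proof (intro equalityI subsetI)
      fix f assume "f \<in> range (W \<circ> V)"
      then obtain g where g: "f = W (V g)" by auto
      have "cinner (V g) ?e = 0" using V(3) by blast
      then have "cinner f b = 0" by (simp add: g We[symmetric] iso)
      then show "f \<in> {f. cinner f u = 0}" by (simp add: perp)
    next
      fix f assume "f \<in> {f. cinner f u = 0}"
      then have "cinner f b = 0" by (simp add: perp)
      then have "cinner (W f) ?e = 0" by (simp add: WW We)
      then obtain g where "W f = V g" using V(3) by blast
      then show "f \<in> range (W \<circ> V)" by (metis comp_apply invol rangeI)
    qed
    show "W \<circ> V \<in> ?A" by (rule A(5)[OF WA V(1)])
  qed (simp add: iso V)
qed

text \<open>One orthogonality condition is added at a time. Pulled back along \<open>A\<close>,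
  orthogonality to \<open>b\<close> becomes orthogonality to \<open>u\<close>. If
  \<open>u = 0\<close>, the condition already holds on the range; otherwise an isometry onto the
  complement of \<open>u\<close> is applied before \<open>A\<close>.\<close>

lemma ex_isometry_range:
  fixes F :: "('n::finite) hardy set"
  assumes "finite F"
  shows "\<exists>A\<in>toeplitz_algebra UNIV. (\<forall>f g. cinner (A f) (A g) = cinner f g) \<and>
     range A = {f. \<forall>b\<in>F. cinner f b = 0}"
  using assms
proof (induction F rule: finite_induct)
  case empty
  show ?case
    using toeplitz_algebra_id[OF invariant_subspace_UNIV]
    by (intro bexI[of _ "\<lambda>f. f"]) auto
next
  case (insert b F)
  note T = cstar_subalgebraD[OF toeplitz_UNIV_cstar]
  obtain A where A: "A \<in> toeplitz_algebra UNIV" "\<And>f g. cinner (A f) (A g) = cinner f g"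
    "range A = {f. \<forall>b\<in>F. cinner f b = 0}"
    using insert.IH by blast
  define u where "u = adjoint_op UNIV UNIV A b"
  have u: "cinner (A f) b = cinner f u" for f
    unfolding u_def by (rule cinner_adjoint[OF closed_csubspace_UNIV closed_csubspace_UNIV T(1)[OF A(1)]]) auto
  show ?case
  proof (cases "u = 0")
    case True
    then have "range A \<subseteq> {f. cinner f b = 0}" using u by auto
    then have "range A = {f. \<forall>b\<in>insert b F. cinner f b = 0}" unfolding A(3) by auto
    with A(1,2) show ?thesis by (intro bexI[of _ A]) auto
  next
    case False
    obtain B where B: "B \<in> toeplitz_algebra UNIV" "\<And>f g. cinner (B f) (B g) = cinner f g"
      "range B = {f. cinner f u = 0}"
      using ex_isometry_range_orthogonal[OF False] by blast
    have "range (A \<circ> B) = A ` {f. cinner f u = 0}" by (simp only: image_comp[symmetric] B(3))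
    also have "\<dots> = range A \<inter> {f. cinner f b = 0}" by (auto simp: u)
    also have "\<dots> = {f. \<forall>b\<in>insert b F. cinner f b = 0}" unfolding A(3) by auto
    finally show ?thesis
      using T(5)[OF A(1) B(1)] A(2) B(2) by (intro bexI[of _ "A \<circ> B"]) auto
  qed
qed


section \<open>Unitary equivalence\<close>

text \<open>Extension by zero on the complement of \<open>S\<close> respects the algebra operations,
  adjoints and norm limits. Hence the operators whose extension lies in the algebra of H form a
  C*-subalgebra, and it contains the generators because \<open>P\<close> lies in the algebra of
  H.\<close>

lemma toeplitz_extend:
  fixes S :: "('n::finite) hardy set"
  assumes S: "invariant_subspace S" and P: "proj S \<in> toeplitz_algebra UNIV"
    and "T \<in> toeplitz_algebra S"
  shows "T \<circ> proj S \<in> toeplitz_algebra UNIV"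
proof -
  note S' = invariant_subspaceD[OF S] and U = closed_csubspace_UNIV
  let ?A = "toeplitz_algebra (UNIV :: 'n hardy set)"
  note A = cstar_subalgebraD[OF toeplitz_UNIV_cstar]
  define Y where "Y = {T \<in> bounded_ops S S. T \<circ> proj S \<in> ?A}"
  have "cstar_subalgebra S Y"
  proof (rule cstar_subalgebraI[OF S'(1)])
    fix T T' assume T: "T \<in> Y" "T' \<in> Y"
    have "(T \<circ> proj S) \<circ> (T' \<circ> proj S) = (T \<circ> T') \<circ> proj S"
      using T(2) proj_ident[OF S'(1)] proj_in[OF S'(1)] bounded_opsD(1)[of T' S S] by (auto simp: Y_def)
    then show "T \<circ> T' \<in> Y"
      using T A(5)[of "T \<circ> proj S" "T' \<circ> proj S"] bounded_ops_comp[of T' S S T] by (simp add: Y_def)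
    show "(\<lambda>x. T x + T' x) \<in> Y"
      using T A(3)[of "T \<circ> proj S" "T' \<circ> proj S"] bounded_ops_add[of T S S T'] S'(1)
      by (simp add: Y_def o_def)
  next
    fix T c assume T: "T \<in> Y"
    then show "(\<lambda>x. c *\<^sub>C T x) \<in> Y"
      using A(4)[of "T \<circ> proj S" c] bounded_ops_scaleC[of T S S c] S'(1) by (simp add: Y_def o_def)
    have Tb: "T \<in> bounded_ops S S" using T by (simp add: Y_def)
    let ?T = "adjoint_op S S T"
    have T': "?T \<in> bounded_ops S S" by (rule adjoint_op_bounded[OF S'(1) S'(1) Tb])
    have "adjoint_op UNIV UNIV (T \<circ> proj S) = ?T \<circ> proj S"
    proof (rule adjoint_opI[OF U])
      show "?T \<circ> proj S \<in> bounded_ops UNIV UNIV"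
        using bounded_ops_comp[OF proj_bounded_ops[OF S'(1)] T'] by (rule bounded_ops_mono) auto
      fix x y
      note P' = proj_in[OF S'(1)] and c = cinner_proj[OF S'(1)]
      show "cinner ((T \<circ> proj S) x) y = cinner x ((?T \<circ> proj S) y)"
        using cinner_adjoint[OF S'(1) S'(1) Tb P' P', of x y]
        by (simp add: c bounded_opsD(1)[OF T' P'] bounded_opsD(1)[OF Tb P'])
    qed
    then show "?T \<in> Y" using A(6)[of "T \<circ> proj S"] T T' by (simp add: Y_def)
  next
    fix X T and c :: "nat \<Rightarrow> real"
    assume T: "T \<in> bounded_ops S S" and X: "\<And>m. X m \<in> Y" and c: "\<And>m. c m \<ge> 0" "c \<longlonglongrightarrow> 0"
      and le: "\<And>m x. x \<in> S \<Longrightarrow> norm (X m x - T x) \<le> c m * norm x"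
    have "T \<circ> proj S \<in> ?A"
    proof (rule cstar_subalgebra_limit[OF toeplitz_UNIV_cstar U _ _ c])
      show "T \<circ> proj S \<in> bounded_ops UNIV UNIV"
        using bounded_ops_comp[OF proj_bounded_ops[OF S'(1)] T] by (rule bounded_ops_mono) auto
      show "X m \<circ> proj S \<in> ?A" for m using X by (simp add: Y_def)
      show "norm ((X m \<circ> proj S) x - (T \<circ> proj S) x) \<le> c m * norm x" for m x
        using le[OF proj_in[OF S'(1)], of m x] mult_left_mono[OF norm_proj_le[OF S'(1), of x] c(1)[of m]]
        by simp
    qed
    with T show "T \<in> Y" by (simp add: Y_def)
  qed (use A(2) bounded_ops_zero[OF S'(1)] in \<open>auto simp: Y_def o_def\<close>)
  moreover have "coord_restr S i \<in> Y" for i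
  proof -
    have "coord_mult i \<circ> proj S \<in> ?A"
      using A(5)[OF coord_restr_in_toeplitz P, of i] by simp
    moreover have "coord_restr S i \<circ> proj S = coord_mult i \<circ> proj S"
      by (auto simp: restrict_op_apply proj_in S')
    ultimately show ?thesis using coord_restr_bounded[OF S] by (simp add: Y_def)
  qed
  ultimately have "toeplitz_algebra S \<subseteq> Y"
    unfolding toeplitz_algebra_def by (intro cstar_generated_least) auto
  then show ?thesis using assms(3) by (auto simp: Y_def)
qed

text \<open>
  Compression to \<open>S\<close> is multiplicative up to finite rank operators, which lie in the algebra.
\<close>

lemma toeplitz_compress:
  fixes S :: "('n::finite) hardy set"
  assumes S: "invariant_subspace S" "finite_codim S" and "X \<in> toeplitz_algebra UNIV"
  shows "restrict_op S (proj S \<circ> X) \<in> toeplitz_algebra S"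
proof -
  note S' = invariant_subspaceD[OF S(1)] and U = closed_csubspace_UNIV
  let ?A = "toeplitz_algebra S"
  note cstar = toeplitz_algebra_cstar[OF S(1)]
  note A = cstar_subalgebraD[OF cstar]
  note P = proj_bounded_ops[OF S'(1)] and P' = proj_in[OF S'(1)] and pc = cinner_proj[OF S'(1)]
  obtain F where F: "finite F" "\<And>x. x - proj S x \<in> complex_vector.span F"
    using finite_codimE[OF S'(1) S(2)] by metis
  define Y where "Y = {X \<in> bounded_ops UNIV UNIV. restrict_op S (proj S \<circ> X) \<in> ?A}"
  have Yb: "restrict_op S (proj S \<circ> X) \<in> bounded_ops S S" if "X \<in> bounded_ops UNIV UNIV" for X
    by (rule bounded_ops_restrict[OF bounded_ops_comp[OF that P]]) (auto simp: S')
  have "cstar_subalgebra UNIV Y"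
  proof (rule cstar_subalgebraI[OF U])
    fix X X' assume X: "X \<in> Y" "X' \<in> Y"
    then have Xb: "X \<in> bounded_ops UNIV UNIV" and X'b: "X' \<in> bounded_ops UNIV UNIV"
      by (auto simp: Y_def)
    have "restrict_op S (proj S \<circ> (\<lambda>x. X x + X' x)) =
        (\<lambda>x. restrict_op S (proj S \<circ> X) x + restrict_op S (proj S \<circ> X') x)"
      by (auto simp: restrict_op_def proj_add S')
    then show "(\<lambda>x. X x + X' x) \<in> Y"
      using X A(3)[of "restrict_op S (proj S \<circ> X)" "restrict_op S (proj S \<circ> X')"] bounded_ops_add[OF Xb X'b U]
      by (simp add: Y_def)
    \<comment> \<open>\<open>D\<close> separates the compression of the product from the product of
      the compressions. It passes through the range of \<open>1 - P\<close>, so its rank is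
      finite.\<close>
    define D where "D = restrict_op S (proj S \<circ> (X \<circ> ((\<lambda>x. x - proj S x) \<circ> X')))"
    have Db: "D \<in> bounded_ops S S"
    proof -
      have "(\<lambda>x. x - proj S x) \<in> bounded_ops UNIV UNIV"
        using bounded_ops_diff[OF restrict_op_id[OF U] bounded_ops_mono[OF P] U] by simp
      then show ?thesis unfolding D_def by (intro Yb bounded_ops_comp[OF bounded_ops_comp[OF X'b] Xb])
    qed
    have "D \<in> ?A"
    proof (rule finite_rank_in_toeplitz[OF S Db, of "(proj S \<circ> X) ` F"])
      have "(proj S \<circ> X) (X' x - proj S (X' x)) \<in> complex_vector.span ((proj S \<circ> X) ` F)" for x
        by (rule linear_on_span[of UNIV]) (auto simp: F bounded_opsD[OF Xb] proj_add proj_scaleC S')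
      then show "D ` S \<subseteq> complex_vector.span ((proj S \<circ> X) ` F)"
        by (auto simp: D_def restrict_op_apply)
    qed (use F in simp)
    moreover have "restrict_op S (proj S \<circ> (X \<circ> X')) =
        (\<lambda>x. (restrict_op S (proj S \<circ> X) \<circ> restrict_op S (proj S \<circ> X')) x + D x)"
    proof
      fix x
      have "proj S (X (X' x)) = proj S (X (proj S (X' x))) + proj S (X (X' x - proj S (X' x)))"
        by (simp add: proj_add[OF S'(1), symmetric] bounded_opsD(3)[OF Xb, symmetric])
      moreover have "proj S (X 0) = 0" by (simp add: bounded_ops_0[OF Xb] bounded_ops_0[OF P])
      ultimately show "restrict_op S (proj S \<circ> (X \<circ> X')) x =
          (restrict_op S (proj S \<circ> X) \<circ> restrict_op S (proj S \<circ> X')) x + D x"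
        by (simp add: restrict_op_def D_def P')
    qed
    ultimately show "X \<circ> X' \<in> Y"
      using X A(3)[OF A(5)] bounded_ops_comp[OF X'b Xb] by (simp add: Y_def)
  next
    fix X c assume X: "X \<in> Y"
    then have Xb: "X \<in> bounded_ops UNIV UNIV" by (simp add: Y_def)
    have "restrict_op S (proj S \<circ> (\<lambda>x. c *\<^sub>C X x)) = (\<lambda>x. c *\<^sub>C restrict_op S (proj S \<circ> X) x)"
      by (auto simp: restrict_op_def proj_scaleC S')
    then show "(\<lambda>x. c *\<^sub>C X x) \<in> Y"
      using X A(4)[of "restrict_op S (proj S \<circ> X)" c] bounded_ops_scaleC[OF Xb U]
      by (simp add: Y_def)
    let ?X = "adjoint_op UNIV UNIV X"
    have X'b: "?X \<in> bounded_ops UNIV UNIV" by (rule adjoint_op_bounded[OF U U Xb])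
    have "adjoint_op S S (restrict_op S (proj S \<circ> X)) = restrict_op S (proj S \<circ> ?X)"
      by (rule adjoint_opI[OF S'(1) Yb[OF X'b]])
        (simp add: restrict_op_apply pc cinner_adjoint[OF U U Xb])
    then show "?X \<in> Y" using X A(6)[of "restrict_op S (proj S \<circ> X)"] X'b by (simp add: Y_def)
  next
    fix X T and c :: "nat \<Rightarrow> real"
    assume T: "T \<in> bounded_ops UNIV UNIV" and X: "\<And>m. X m \<in> Y" and c: "\<And>m. c m \<ge> 0" "c \<longlonglongrightarrow> 0"
      and le: "\<And>m x. x \<in> UNIV \<Longrightarrow> norm (X m x - T x) \<le> c m * norm x"
    have "restrict_op S (proj S \<circ> T) \<in> ?A"
    proof (rule cstar_subalgebra_limit[OF cstar S'(1) Yb[OF T] _ c])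
      show "restrict_op S (proj S \<circ> X m) \<in> ?A" for m using X by (simp add: Y_def)
      show "norm (restrict_op S (proj S \<circ> X m) x - restrict_op S (proj S \<circ> T) x) \<le> c m * norm x"
        if "x \<in> S" for m x
      proof -
        have "proj S (X m x) - proj S (T x) = proj S (X m x - T x)"
          by (rule bounded_ops_diff_arg[OF P U, symmetric]) auto
        then show ?thesis
          using that le[of x m] norm_proj_le[OF S'(1), of "X m x - T x"] by (simp add: restrict_op_apply)
      qed
    qed
    with T show "T \<in> Y" by (simp add: Y_def)
  next
    have "restrict_op S (proj S \<circ> (\<lambda>x. 0)) = (\<lambda>x. 0)"
      by (simp add: restrict_op_def fun_eq_iff bounded_ops_0[OF P])
    then show "(\<lambda>x. 0) \<in> Y" using A(2) bounded_ops_zero[OF U] by (simp add: Y_def)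
  qed (simp add: Y_def)
  moreover have "coord_mult i \<in> Y" for i
  proof -
    have "restrict_op S (proj S \<circ> coord_mult i) = coord_restr S i"
      by (auto simp: restrict_op_def fun_eq_iff proj_ident S')
    then show ?thesis using coord_restr_in_toeplitz[of S i] coord_mult_bounded by (simp add: Y_def)
  qed
  ultimately have "toeplitz_algebra UNIV \<subseteq> Y"
    unfolding toeplitz_algebra_def by (intro cstar_generated_least) auto
  then show ?thesis using assms(3) by (auto simp: Y_def)
qed

theorem theorem5p8:
  fixes S :: "('n::finite) hardy set"
  assumes "CARD('n) \<ge> 2"
    and "invariant_subspace S"
    and "finite_codim S"
  shows "\<exists>U. unitary_op S (UNIV :: 'n hardy set) U \<and>
    (\<lambda>T. U \<circ> T \<circ> adjoint_op S UNIV U) ` toeplitz_algebra S = toeplitz_algebra UNIV"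
proof -
  note S = assms(2,3) and S' = invariant_subspaceD[OF assms(2)] and H = closed_csubspace_UNIV
  note T = cstar_subalgebraD[OF toeplitz_UNIV_cstar]
  obtain F where F: "finite F" "\<And>x. x \<in> S \<longleftrightarrow> (\<forall>b\<in>F. cinner x b = 0)"
    using finite_codimE[OF S'(1) S(2)] by metis
  obtain A where A: "A \<in> toeplitz_algebra UNIV" "\<And>f g. cinner (A f) (A g) = cinner f g"
    "range A = {f. \<forall>b\<in>F. cinner f b = 0}"
    using ex_isometry_range[OF F(1)] by blast
  have AS: "range A = S" unfolding A(3) using F(2) by blast
  then have AinS: "A x \<in> S" for x by blast
  have Ab: "A \<in> bounded_ops UNIV UNIV" by (rule T(1)[OF A(1)])
  have AbS: "A \<in> bounded_ops UNIV S"
    using Ab AinS unfolding bounded_ops_def by auto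
  define B where "B = adjoint_op UNIV UNIV A"
  have BA: "B \<in> toeplitz_algebra UNIV" unfolding B_def by (rule T(6)[OF A(1)])
  have Bb: "B \<in> bounded_ops UNIV UNIV" by (rule T(1)[OF BA])
  have adj: "cinner (A x) y = cinner x (B y)" "cinner y (A x) = cinner (B y) x" for x y
    unfolding B_def using cinner_adjoint[OF H H Ab] cinner_adjoint'[OF H H Ab] by auto
  have BAx: "B (A x) = x" for x
  proof -
    have "cinner (B (A x) - x) (B (A x) - x) = 0"
      using A(2)[of x "B (A x) - x"] adj(2)[of "A x" "B (A x) - x"] by (simp add: cinner_diff_left)
    then show ?thesis by simp
  qed
  have ABS: "A (B x) = x" if "x \<in> S" for x
  proof -
    obtain y where "x = A y" using \<open>x \<in> S\<close> unfolding AS[symmetric] by (rule imageE)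
    then show ?thesis by (simp add: BAx)
  qed
  \<comment> \<open>An isometry times its adjoint is the projection onto its range; this is how
    \<open>P\<close> enters the algebra of H.\<close>
  have P: "proj S = A \<circ> B"
  proof
    fix x
    show "proj S x = (A \<circ> B) x"
    proof (rule projI[OF S'(1)])
      fix z assume "z \<in> S"
      then show "cinner (x - (A \<circ> B) x) z = 0"
        using adj(2)[of x "B z"] A(2)[of "B x" "B z"] by (simp add: cinner_diff_left ABS)
    qed (simp add: AinS)
  qed
  define U where "U = restrict_op S B"
  have Ub: "U \<in> bounded_ops S UNIV" unfolding U_def by (rule bounded_ops_restrict[OF Bb _ S'(1)]) simp
  have unitary: "unitary_op S UNIV U"
    unfolding unitary_op_def
  proof (intro conjI ballI Ub)
    show "U ` S = UNIV"
    proof (intro equalityI subsetI)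
      fix x
      have "x = U (A x)" by (simp add: U_def restrict_op_apply AinS BAx)
      then show "x \<in> U ` S" using AinS by blast
    qed simp
    show "cinner (U x) (U y) = cinner x y" if "x \<in> S" "y \<in> S" for x y
      using that A(2)[of "B x" "B y"] by (simp add: U_def restrict_op_apply ABS)
  qed
  have adjU: "adjoint_op S UNIV U = A"
    by (rule adjoint_opI[OF S'(1) AbS]) (simp add: U_def restrict_op_apply adj)
  have "(\<lambda>T. U \<circ> T \<circ> A) ` toeplitz_algebra S = toeplitz_algebra UNIV"
  proof (intro equalityI subsetI)
    fix X assume "X \<in> (\<lambda>T. U \<circ> T \<circ> A) ` toeplitz_algebra S"
    then obtain R where R: "R \<in> toeplitz_algebra S" "X = U \<circ> R \<circ> A" by blast
    have Rb: "R \<in> bounded_ops S S" by (rule cstar_subalgebraD(1)[OF toeplitz_algebra_cstar[OF S(1)] R(1)])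
    have "R \<circ> proj S \<in> toeplitz_algebra UNIV"
      by (rule toeplitz_extend[OF S(1) _ R(1)]) (simp only: P T(5)[OF A(1) BA])
    then have "B \<circ> ((R \<circ> proj S) \<circ> A) \<in> toeplitz_algebra UNIV"
      by (rule T(5)[OF BA T(5)[OF _ A(1)]])
    \<comment> \<open>\<open>A\<close> takes its values in \<open>S\<close>, so the inserted
      projection changes nothing, and \<open>R\<close> returns to \<open>S\<close>, where
      \<open>U\<close> agrees with \<open>B\<close>.\<close>
    also have "B \<circ> ((R \<circ> proj S) \<circ> A) = X"
      by (auto simp: R(2) U_def restrict_op_apply proj_ident S' AinS bounded_opsD(1)[OF Rb])
    finally show "X \<in> toeplitz_algebra UNIV" .
  next
    fix X :: "'n hardy \<Rightarrow> 'n hardy" assume X: "X \<in> toeplitz_algebra UNIV"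
    \<comment> \<open>\<open>X\<close> is carried back by conjugation with \<open>A\<close>. The
      values already lie in \<open>S\<close>, so the compression only restricts the domain.\<close>
    let ?R = "restrict_op S (proj S \<circ> (A \<circ> (X \<circ> B)))"
    have R: "?R \<in> toeplitz_algebra S"
      by (intro toeplitz_compress S T(5)[OF A(1)] T(5)[OF X BA])
    have "X = U \<circ> ?R \<circ> A"
      by (auto simp: U_def restrict_op_apply proj_ident S' AinS BAx)
    with R show "X \<in> (\<lambda>T. U \<circ> T \<circ> A) ` toeplitz_algebra S" by blast
  qed
  with unitary adjU show ?thesis by auto
qed

end
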